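(* Let $G$ be a planar bipartite graph and let $L_G$ be the associated positive special alternating link, with Alexander polynomial $\Delta_{L_G}(t)$. Then $$\Delta_{L_G}(-t)\sim \sum_{\substack{H\subset G\\ H\text{ connected}}} \mathrm{Vol}(Q_H)\,(t-1)^{|E(H)|-|V(G)|+1},$$ where the sum is over connected subgraphs $H$ of $G$ with vertex set $V(G)$, and $\sim$ denotes equality up to multiplication by $\pm t^k$ for some integer $k$.
   Context: Construction of $L_G$: let $G$ be a planar bipartite graph with a fixed planar drawing, and let $D$ be its planar dual, oriented so that it is an alternating dimap, i.e. around each vertex of $D$ the edges alternate between incoming and outgoing. The medial graph $M(G)$ has a vertex $v_e$ at the midpoint of each edge $e$ of $G$, with $v_e,v_{e'}$ joined by an edge whenever $e,e'$ are consecutive in the boundary of a face of $G$. Regions of $M(G)$ correspond to vertices of $G$ and vertices of $D$. Partition the regions corresponding to vertices of $G$ into color classes $A$ and $B$ so that whenever an edge of $D$ passes through a vertex of $M(G)$, traveling in its direction it passes a region in $A$ on the left and a region in $B$ on the right. Orient the edges of $M(G)$ so that the boundary of every region in $A$ is a counterclockwise cycle and the boundary of every region in $B$ is a clockwise cycle. Replace each vertex of $M(G)$ by a positive crossing (when the picture is rotated so that the over-strand runs left to right, the under-strand runs bottom to top). The result is a diagram of $L_G$. For a subgraph $H$ as in the sum, orient all edges from one color class of $G$ to the other; $Q_H$ is the root polytope of a totally unimodular matrix representing the resulting oriented graphic matroid of $H$; concretely one may take $Q_H=\mathrm{conv}\{\mathbf e_a-\mathbf e_b : ab\in E(H)\}\subset\mathbb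 R^{V(G)}$ with $a$ in the first class and $b$ in the second. $\mathrm{Vol}$ is normalized volume, for which the simplex spanned by the points corresponding to the edges of any spanning tree of $H$ has volume $1$. *)

theory Defs
  imports
    "HOL-Analysis.Analysis"
    "HOL-Computational_Algebra.Polynomial_Factorial"
    "Graph_Theory.Graph_Theory"
    "Jordan_Normal_Form.Determinant"
begin

section \<open>Plane graphs\<close>

text \<open>
  An undirected (multi)graph is a bidirected digraph: each edge is a pair of mutually reverse
  darts \<open>e\<close>, \<open>arev e\<close>, each based at its tail. A drawing in the plane is recorded up to isotopy of
  the sphere by the rotation system \<open>rot\<close>: \<open>rot e\<close> is the next dart after \<open>e\<close> in the
  counterclockwise order around \<open>tail G e\<close>.
\<close>

definition face_succ :: "('b \<Rightarrow> 'b) \<Rightarrow> ('b \<Rightarrow> 'b) \<Rightarrow> 'b \<Rightarrow> 'b" where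
  \<comment> \<open>follows the boundary of the face lying to the right of the dart\<close>
  "face_succ arev rot e = rot (arev e)"

definition facial_walks :: "('a, 'b) pre_digraph \<Rightarrow> ('b \<Rightarrow> 'b) \<Rightarrow> ('b \<Rightarrow> 'b) \<Rightarrow> 'b set set" where
  "facial_walks G arev rot = orbit (face_succ arev rot) ` arcs G"

definition isolated_verts :: "('a, 'b) pre_digraph \<Rightarrow> 'a set" where
  "isolated_verts G = {v \<in> verts G. out_arcs G v = {}}"

text \<open>
  Planarity is Euler's formula \<open>V - E + F = 2\<close>, summed over the connected components. Here a
  component that is an isolated vertex contributes one face, although it has no facial walk.
  Every component has non-negative genus, so the summed formula forces each one to be planar.
\<close>

locale plane_graph = fin_digraph G + bidirected_digraph G arev
  for G :: "('a, 'b) pre_digraph" and arev :: "'b \<Rightarrow> 'b" +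
  fixes rot :: "'b \<Rightarrow> 'b"
  assumes verts_nonempty: "verts G \<noteq> {}"
    and rot_permutes: "rot permutes arcs G"
    and rot_cyclic: "\<And>v. v \<in> verts G \<Longrightarrow> out_arcs G v \<noteq> {} \<Longrightarrow> cyclic_on rot (out_arcs G v)"
    and euler: "card (verts G) + (card (facial_walks G arev rot) + card (isolated_verts G))
      = card (arcs G) div 2 + 2 * card (pre_digraph.sccs G)"

definition bipartition :: "('a, 'b) pre_digraph \<Rightarrow> 'a set \<Rightarrow> 'a set \<Rightarrow> bool" where
  "bipartition G A B \<longleftrightarrow> A \<union> B = verts G \<and> A \<inter> B = {} \<and>
     (\<forall>e\<in>arcs G. tail G e \<in> A \<and> head G e \<in> B \<or> tail G e \<in> B \<and> head G e \<in> A)"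

text \<open>
  The planar dual \<open>D\<close> has the faces of \<open>G\<close> as vertices and one edge across each edge of \<open>G\<close>. An
  orientation of \<open>D\<close> is given by the set \<open>Out\<close> of darts \<open>e\<close> of \<open>G\<close> that the dual edge crosses from
  right to left; thus at the face to the right of \<open>e\<close> the dual edge across \<open>e\<close> is outgoing if
  \<open>e \<in> Out\<close> and incoming otherwise. Consecutive edges around this vertex of \<open>D\<close> are those across
  \<open>e\<close> and \<open>face_succ arev rot e\<close>, so the second condition below says that \<open>D\<close> is an alternating
  dimap.
\<close>

definition alternating_dual_orientation ::
  "('a, 'b) pre_digraph \<Rightarrow> ('b \<Rightarrow> 'b) \<Rightarrow> ('b \<Rightarrow> 'b) \<Rightarrow> 'b set \<Rightarrow> bool" where
  "alternating_dual_orientation G arev rot Out \<longleftrightarrow> Out \<subseteq> arcs G \<and>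
     (\<forall>e\<in>arcs G. e \<in> Out \<longleftrightarrow> arev e \<notin> Out) \<and>
     (\<forall>e\<in>arcs G. e \<in> Out \<longleftrightarrow> face_succ arev rot e \<notin> Out)"

text \<open>
  A dual edge crossing the dart \<open>e\<close> from right to left has the tail of \<open>e\<close> on its left and the
  head of \<open>e\<close> on its right.
\<close>

definition left_right_classes ::
  "('a, 'b) pre_digraph \<Rightarrow> 'b set \<Rightarrow> 'a set \<Rightarrow> 'a set \<Rightarrow> bool" where
  "left_right_classes G Out A B \<longleftrightarrow> (\<forall>e\<in>Out. tail G e \<in> A \<and> head G e \<in> B)"

context plane_graph
begin

lemma tail_rot:
  assumes "e \<in> arcs G"
  shows "tail G (rot e) = tail G e"
proof -
  have v: "tail G e \<in> verts G" "out_arcs G (tail G e) \<noteq> {}" "e \<in> out_arcs G (tail G e)"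
    using assms by auto
  have "rot e \<in> out_arcs G (tail G e)"
    using cyclic_on_funpow_in[OF rot_cyclic[OF v(1,2)] v(3), of 1] by simp
  then show ?thesis by simp
qed

text \<open>The dual of a bipartite plane graph does have an orientation as required.\<close>

lemma alternating_dual_orientation_exists:
  assumes "bipartition G A B"
  defines "Out \<equiv> {e \<in> arcs G. tail G e \<in> A}"
  shows "alternating_dual_orientation G arev rot Out" "left_right_classes G Out A B"
proof -
  have swap: "tail G (arev e) \<in> A \<longleftrightarrow> tail G e \<notin> A" if "e \<in> arcs G" for e
    using assms that by (auto simp: bipartition_def)
  have rot_arcs: "rot e \<in> arcs G" if "e \<in> arcs G" for e
    using permutes_in_image[OF rot_permutes] that by simp
  show "alternating_dual_orientation G arev rot Out"
    using swap rot_arcs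
    by (auto simp: alternating_dual_orientation_def face_succ_def Out_def tail_rot)
  show "left_right_classes G Out A B"
    using assms(1) by (auto simp: left_right_classes_def Out_def bipartition_def)
qed

end


section \<open>Link diagrams and the Alexander polynomial\<close>

text \<open>
  An oriented link diagram: \<open>segments\<close> are the oriented edges of the underlying 4-valent plane
  graph, together with the components without crossings; at each crossing two segments arrive and
  two leave. Over-strands are also cut at crossings.
\<close>

record ('c, 's) link_diagram =
  crossings :: "'c set"
  segments :: "'s set"
  over_in :: "'c \<Rightarrow> 's"
  over_out :: "'c \<Rightarrow> 's"
  under_in :: "'c \<Rightarrow> 's"
  under_out :: "'c \<Rightarrow> 's"
  positive :: "'c \<Rightarrow> bool"

text \<open>
  The Fox Jacobian, with every meridian sent to \<open>t\<close>, of the Wirtinger presentation of the link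
  group. The generators are the segments; each crossing has a relation \<open>over_in = over_out\<close>
  (row \<open>Inl c\<close>) and, writing \<open>o\<close> for \<open>over_out\<close>, a relation \<open>o under_out = under_in o\<close> if the
  crossing is positive and \<open>under_out o = o under_in\<close> if it is negative (row \<open>Inr c\<close>). Entries are
  added up because the segments at a crossing need not be distinct.
\<close>

fun alexander_matrix :: "('c, 's) link_diagram \<Rightarrow> 'c + 'c \<Rightarrow> 's \<Rightarrow> int poly" where
  "alexander_matrix L (Inl c) s = of_bool (s = over_in L c) - of_bool (s = over_out L c)"
| "alexander_matrix L (Inr c) s =
     of_bool (s = over_out L c) * [:1, -1:] +
     (if positive L c
      then of_bool (s = under_out L c) * [:0, 1:] - of_bool (s = under_in L c)
      else of_bool (s = under_in L c) * [:0, 1:] - of_bool (s = under_out L c))"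

definition alexander_minors :: "('c, 's) link_diagram \<Rightarrow> nat \<Rightarrow> int poly set" where
  "alexander_minors L k = {Determinant.det (Matrix.mat k k (\<lambda>(i, j). alexander_matrix L (f i) (g j))) | f g.
     f ` {..<k} \<subseteq> crossings L <+> crossings L \<and> inj_on f {..<k} \<and>
     g ` {..<k} \<subseteq> segments L \<and> inj_on g {..<k}}"

text \<open>
  The greatest common divisor of the minors of size one less than the number of generators, i.e. a
  generator of the smallest principal ideal containing the first elementary ideal. The matrix has
  entries in \<open>\<int>[t]\<close>, and the gcd there is a gcd in \<open>\<int>[t, 1/t]\<close>.
\<close>

definition alexander_polynomial :: "('c, 's) link_diagram \<Rightarrow> int poly" where
  "alexander_polynomial L = Gcd (alexander_minors L (card (segments L) - 1))"

text \<open>Equality up to multiplication by \<open>\<plusminus>t^k\<close> with \<open>k \<in> \<int>\<close>, without Laurent polynomials.\<close>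

definition unit_equiv :: "'a::comm_ring_1 poly \<Rightarrow> 'a poly \<Rightarrow> bool" (infix \<open>\<sim>\<^sub>t\<close> 50) where
  "p \<sim>\<^sub>t q \<longleftrightarrow> (\<exists>i j. monom 1 i * p = monom 1 j * q \<or> monom 1 i * p = - (monom 1 j * q))"


section \<open>The link of a plane bipartite graph\<close>

text \<open>
  The edges of the medial graph correspond to the corners of \<open>G\<close>, hence to its darts: the dart \<open>e\<close>
  stands for the medial edge cutting off the corner at \<open>tail G e\<close> between \<open>e\<close> and \<open>rot e\<close>. It joins
  the midpoints of the edges of \<open>e\<close> and \<open>rot e\<close>; it runs from \<open>e\<close> to \<open>rot e\<close>
  (counterclockwise around the tail) if \<open>tail G e \<in> A\<close>, and from \<open>rot e\<close> to \<open>e\<close> (clockwise) if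
  \<open>tail G e \<in> B\<close>.

  The crossings are the edges of \<open>G\<close>, represented by their darts based in \<open>A\<close>. Draw such a dart \<open>e\<close>
  from west to east. The medial edges at its midpoint are, by the above,
  \<open>inv rot e\<close> (south-west, arriving), \<open>arev e\<close> (south-east, arriving),
  \<open>e\<close> (north-west, leaving) and \<open>inv rot (arev e)\<close> (north-east, leaving).
  The crossing of the strands SW-NE and SE-NW is positive when SW-NE is the over-strand.

  The boundary of the region of an isolated vertex contains no medial vertex; it contributes a
  component without crossings.
\<close>

definition medial_link ::
  "('a, 'b) pre_digraph \<Rightarrow> ('b \<Rightarrow> 'b) \<Rightarrow> ('b \<Rightarrow> 'b) \<Rightarrow> 'a set \<Rightarrow> ('b, 'b + 'a) link_diagram" where
  "medial_link G arev rot A = \<lparr>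
     crossings = {e \<in> arcs G. tail G e \<in> A},
     segments = arcs G <+> isolated_verts G,
     over_in = (\<lambda>e. Inl (Hilbert_Choice.inv rot e)),
     over_out = (\<lambda>e. Inl (Hilbert_Choice.inv rot (arev e))),
     under_in = (\<lambda>e. Inl (arev e)),
     under_out = (\<lambda>e. Inl e),
     positive = (\<lambda>_. True)\<rparr>"


section \<open>Connected spanning subgraphs and root polytopes\<close>

definition num_edges :: "('a, 'b) pre_digraph \<Rightarrow> nat" where
  "num_edges H = card (arcs H) div 2"

definition connected_spanning_subgraphs ::
  "('a, 'b) pre_digraph \<Rightarrow> ('b \<Rightarrow> 'b) \<Rightarrow> ('a, 'b) pre_digraph set" where
  "connected_spanning_subgraphs G arev =
     {H. spanning H G \<and> arev ` arcs H = arcs H \<and> Digraph_Component.connected H}"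

text \<open>
  The library notion of a tree is about directed cycles, which include the closed walks
  \<open>e\<close>, \<open>arev e\<close>; these are not cycles of the undirected graph.
\<close>

definition undirected_spanning_tree ::
  "('b \<Rightarrow> 'b) \<Rightarrow> ('a, 'b) pre_digraph \<Rightarrow> ('a, 'b) pre_digraph \<Rightarrow> bool" where
  "undirected_spanning_tree arev T H \<longleftrightarrow> T \<in> connected_spanning_subgraphs H arev \<and>
     \<not> (\<exists>p. pre_digraph.cycle T p \<and> (\<forall>e\<in>set p. arev e \<notin> set p))"

definition edge_points :: "'a::finite set \<Rightarrow> ('a, 'b) pre_digraph \<Rightarrow> (real ^ 'a) set" where
  "edge_points A H = (\<lambda>e. axis (tail H e) 1 - axis (head H e) 1) ` {e \<in> arcs H. tail H e \<in> A}"

definition root_polytope :: "'a::finite set \<Rightarrow> ('a, 'b) pre_digraph \<Rightarrow> (real ^ 'a) set" where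
  "root_polytope A H = convex hull (edge_points A H)"

text \<open>
  Volume within the affine hull of a finite affinely independent set \<open>S\<close>, scaled so that the
  simplex \<open>convex hull S\<close> has volume 1: Lebesgue measure in the affine coordinates given by \<open>S\<close>,
  times the factorial of the dimension. The choice of the origin \<open>s0\<close> does not matter. The case
  \<open>S = {}\<close> arises only from the spanning tree of the one-vertex graph, whose empty simplex has
  volume 1 by convention.
\<close>

definition volume_wrt_simplex :: "'v::real_vector set \<Rightarrow> 'v set \<Rightarrow> real" where
  "volume_wrt_simplex S Q = (if S = {} then 1 else
     let s0 = (SOME s. s \<in> S); M = Pi\<^sub>M (S - {s0}) (\<lambda>_. lborel :: real measure)
     in fact (card S - 1) *
        measure M {c \<in> space M. s0 + (\<Sum>s\<in>S - {s0}. c s *\<^sub>R (s - s0)) \<in> Q})"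

text \<open>
  By total unimodularity of the oriented incidence matrix all spanning trees give the same
  normalization.
\<close>

definition normalized_volume :: "('b \<Rightarrow> 'b) \<Rightarrow> 'a::finite set \<Rightarrow> ('a, 'b) pre_digraph \<Rightarrow> real" where
  "normalized_volume arev A H =
     volume_wrt_simplex (edge_points A (SOME T. undirected_spanning_tree arev T H)) (root_polytope A H)"

end

theory Submission
  imports Defs
begin

text \<open>
  Write \<open>\<tau> = -t\<close>, let \<open>E\<close> be the set of edges of \<open>G\<close>, directed from \<open>A\<close> to \<open>B\<close>, and let \<open>D\<close> be
  the directed planar dual. Both sides of the formula are compared with the same sum over the
  spanning trees of \<open>D\<close>.

  For the left side, the relations of the over-strands eliminate half of the generators of the
  link group. What remains of the Fox matrix is the operator on functions \<open>y\<close> on \<open>E\<close> that sends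
  \<open>y\<close> to \<open>(y e - y (\<beta> e)) + \<tau> (y e - y (\<alpha> e))\<close>, where \<open>\<alpha> e\<close> and \<open>\<beta> e\<close> are the edges after \<open>e\<close>
  around its ends in \<open>A\<close> and \<open>B\<close>. It kills constants, and so does its transpose; the maximal
  minors of the Fox matrix all agree up to sign and a power of \<open>\<tau>\<close> (\<open>fox_minor\<close>). To compute
  one, feed the operator with functions of the face to the right of \<open>e\<close> and with functions of
  the end in \<open>A\<close>, and test the result against functions of the right face and of the end in \<open>B\<close>.
  By planar duality these families extend to unimodular bases, and in these bases the matrix is
  block triangular; its blocks are unimodular, \<open>\<tau>\<close> times unimodular, and the Laplacian of \<open>D\<close> in
  which a dual edge has weight \<open>\<tau>\<close> forwards and \<open>1\<close> backwards (\<open>idet_hop\<close>). By the matrix-tree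
  theorem the determinant of this Laplacian, grounded at a face \<open>f0\<close>, is the sum over the
  spanning trees \<open>T\<close> of \<open>D\<close> of \<open>\<tau>\<close> to the number of edges of \<open>T\<close> that point towards \<open>f0\<close>
  (\<open>idet_dual_laplacian_trees\<close>). Expanding in powers of \<open>\<tau> - 1\<close>, the term
  \<open>(\<tau> - 1) ^ (|T| - |S|)\<close> is obtained once for every \<open>S \<subseteq> T\<close> such that all edges of \<open>T - S\<close>
  point towards \<open>f0\<close>. Let \<open>H\<close> be the subgraph with edge set \<open>E - S\<close>. Then the exponent is
  \<open>|E(H)| - |V(G)| + 1\<close> by Euler's formula, and \<open>E - T\<close> is a spanning tree of \<open>H\<close>.

  For the right side it remains to see that the number of such \<open>T\<close>, for fixed \<open>S\<close>, is the volume
  of \<open>Q\<^sub>H\<close>. The simplices spanned by the edges of the spanning trees \<open>E - T\<close> of \<open>H\<close> all have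
  volume 1, because spanning trees are unimodular. Those simplices whose \<open>T\<close> is counted dissect
  \<open>Q\<^sub>H\<close>: two representations of a point as a combination of edges differ by a circulation of
  \<open>G\<close>, hence by the coboundary of a potential on the faces which vanishes at \<open>f0\<close>. Among the
  representations of a generic point of \<open>Q\<^sub>H\<close> by spanning trees, the one with the largest sum of
  potentials belongs to a tree that is counted (\<open>dissection_exists\<close>), by a pivot step of the
  simplex algorithm; and for two counted trees the potential between their representations is at
  the same time nowhere positive and nowhere negative (\<open>dissection_unique\<close>). This gives
  \<open>polytope_volume\<close>.

  If \<open>G\<close> is disconnected the sum is empty, and the Alexander polynomial vanishes because the
  meridians of a split part contribute an additional kernel vector.
\<close>


section \<open>Determinants over finite index sets\<close>

definition pm_eq :: "'a::ring_1 \<Rightarrow> 'a \<Rightarrow> bool" (infix \<open>=\<^sub>\<plusminus>\<close> 50) where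
  "x =\<^sub>\<plusminus> y \<longleftrightarrow> x = y \<or> x = - y"

lemma pm_eq_refl [simp]: "x =\<^sub>\<plusminus> x"
  by (simp add: pm_eq_def)

lemma pm_eq_sym: "x =\<^sub>\<plusminus> y \<Longrightarrow> y =\<^sub>\<plusminus> x"
  by (auto simp: pm_eq_def)

lemma pm_eq_trans [trans]: "x =\<^sub>\<plusminus> y \<Longrightarrow> y =\<^sub>\<plusminus> z \<Longrightarrow> x =\<^sub>\<plusminus> z"
  by (auto simp: pm_eq_def)

lemma pm_eq_mult: "x =\<^sub>\<plusminus> y \<Longrightarrow> x' =\<^sub>\<plusminus> y' \<Longrightarrow> x * x' =\<^sub>\<plusminus> y * y'"
  by (auto simp: pm_eq_def)

text \<open>
  The determinant is defined with the enumerations of \<open>from_nat_into\<close>. Other enumerations change it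
  only by a sign (\<open>det_enum_pm\<close>), so determinants over different row and column sets are compared
  up to sign; for \<open>I = J\<close> the choice does not matter.
\<close>

definition idet :: "'i set \<Rightarrow> 'j set \<Rightarrow> ('i \<Rightarrow> 'j \<Rightarrow> 'r::idom) \<Rightarrow> 'r" where
  "idet I J M = Determinant.det (Matrix.mat (card I) (card I)
     (\<lambda>(i, j). M (from_nat_into I i) (from_nat_into J j)))"

lemma det_enum_rows_pm:
  fixes N :: "'i \<Rightarrow> nat \<Rightarrow> 'r::idom"
  assumes "bij_betw f {..<n} I" and "bij_betw f' {..<n} I"
  shows "Determinant.det (Matrix.mat n n (\<lambda>(i, j). N (f i) j)) =\<^sub>\<plusminus>
         Determinant.det (Matrix.mat n n (\<lambda>(i, j). N (f' i) j))"
proof -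
  define p where "p = (\<lambda>i. if i < n then inv_into {..<n} f' (f i) else i)"
  have "bij_betw (inv_into {..<n} f' \<circ> f) {..<n} {..<n}"
    using bij_betw_trans[OF assms(1) bij_betw_inv_into[OF assms(2)]] .
  then have "bij_betw p {..<n} {..<n}"
    by (rule bij_betw_cong[THEN iffD1, rotated]) (auto simp: p_def)
  then have p: "p permutes {0..<n}"
    by (intro bij_imp_permutes) (auto simp: p_def atLeast0LessThan)
  have fp: "f' (p i) = f i" if "i < n" for i
  proof -
    have "f i \<in> f' ` {..<n}" using assms that by (auto simp: bij_betw_def)
    then show ?thesis using that by (simp add: p_def f_inv_into_f)
  qed
  have lt: "p i < n" if "i < n" for i using permutes_in_image[OF p, of i] that by simp
  let ?A = "Matrix.mat n n (\<lambda>(i, j). N (f' i) j)"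
  have "Matrix.mat n n (\<lambda>(i, j). N (f i) j) = Matrix.mat n n (\<lambda>(i, j). ?A $$ (p i, j))"
    by (rule eq_matI) (auto simp: fp lt)
  then have "Determinant.det (Matrix.mat n n (\<lambda>(i, j). N (f i) j)) = signof p * Determinant.det ?A"
    using det_permute_rows[OF _ p, of ?A] by simp
  then show ?thesis by (auto simp: pm_eq_def sign_def)
qed

lemma det_transpose_fun:
  fixes N :: "nat \<Rightarrow> nat \<Rightarrow> 'r::idom"
  shows "Determinant.det (Matrix.mat n n (\<lambda>(i, j). N j i)) = Determinant.det (Matrix.mat n n (\<lambda>(i, j). N i j))"
proof -
  have "transpose_mat (Matrix.mat n n (\<lambda>(i, j). N i j)) = Matrix.mat n n (\<lambda>(i, j). N j i)"
    by (rule eq_matI) auto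
  then show ?thesis
    using Determinant.det_transpose[of "Matrix.mat n n (\<lambda>(i, j). N i j)" n] by simp
qed

lemma det_enum_pm:
  fixes M :: "'i \<Rightarrow> 'j \<Rightarrow> 'r::idom"
  assumes "bij_betw f {..<n} I" and "bij_betw g {..<n} J"
  shows "Determinant.det (Matrix.mat n n (\<lambda>(i, j). M (f i) (g j))) =\<^sub>\<plusminus> idet I J M"
proof -
  have fin: "finite I" "finite J" and card: "card I = n" "card J = n"
    using assms by (auto dest: bij_betw_finite bij_betw_same_card)
  note enum = bij_betw_from_nat_into_finite[OF fin(1), unfolded card]
    bij_betw_from_nat_into_finite[OF fin(2), unfolded card]
  let ?f = "from_nat_into I" and ?g = "from_nat_into J"
  have "Determinant.det (Matrix.mat n n (\<lambda>(i, j). M (f i) (g j))) =\<^sub>\<plusminus>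
        Determinant.det (Matrix.mat n n (\<lambda>(i, j). M (?f i) (g j)))"
    using det_enum_rows_pm[OF assms(1) enum(1)] .
  also have "\<dots> = Determinant.det (Matrix.mat n n (\<lambda>(i, j). M (?f j) (g i)))"
    by (rule det_transpose_fun)
  also have "\<dots> =\<^sub>\<plusminus> Determinant.det (Matrix.mat n n (\<lambda>(i, j). M (?f j) (?g i)))"
    using det_enum_rows_pm[OF assms(2) enum(2), of "\<lambda>j i. M (?f i) j"] .
  also have "\<dots> = idet I J M"
    unfolding idet_def card by (rule det_transpose_fun)
  finally show ?thesis .
qed

lemma idet_cong:
  assumes "finite I" "finite J" "card I = card J" "\<And>i j. i \<in> I \<Longrightarrow> j \<in> J \<Longrightarrow> M i j = M' i j"
  shows "idet I J M = idet I J M'"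
proof -
  have "from_nat_into I i \<in> I" "from_nat_into J i \<in> J" if "i < card I" for i
    using bij_betw_from_nat_into_finite[OF assms(1)] bij_betw_from_nat_into_finite[OF assms(2)]
      that assms(3) by (auto simp: bij_betw_def)
  then show ?thesis
    using assms(4) unfolding idet_def
    by (intro arg_cong[of _ _ Determinant.det] eq_matI) (auto simp: assms(3))
qed

lemma idet_transpose:
  assumes "card I = card J"
  shows "idet J I (\<lambda>j i. M i j) = idet I J M"
  unfolding idet_def assms by (rule det_transpose_fun)

lemma idet_mult:
  assumes "finite J" and "card I = card J" and "card J = card K"
  shows "idet I K (\<lambda>i k. \<Sum>j\<in>J. M i j * N j k) = idet I J M * idet J K N"
proof -
  let ?n = "card J" and ?g = "from_nat_into J"
  let ?A = "Matrix.mat ?n ?n (\<lambda>(i, j). M (from_nat_into I i) (?g j))"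
  let ?B = "Matrix.mat ?n ?n (\<lambda>(j, k). N (?g j) (from_nat_into K k))"
  have "(\<Sum>j\<in>J. M i j * N j k) = (\<Sum>j<?n. M i (?g j) * N (?g j) k)" for i k
    using sum.reindex_bij_betw[OF bij_betw_from_nat_into_finite[OF assms(1)], of "\<lambda>j. M i j * N j k"] by simp
  then have "Matrix.mat ?n ?n (\<lambda>(i, k). \<Sum>j\<in>J. M (from_nat_into I i) j * N j (from_nat_into K k)) = ?A * ?B"
    by (intro eq_matI) (auto simp: scalar_prod_def lessThan_atLeast0 intro!: sum.cong)
  moreover have "Determinant.det (?A * ?B) = Determinant.det ?A * Determinant.det ?B"
    by (rule Determinant.det_mult) auto
  ultimately show ?thesis
    unfolding idet_def using assms by simp
qed

lemma idet_id:
  assumes I: "finite I"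
  shows "idet I I (\<lambda>i j. of_bool (i = j)) = (1 :: 'r::idom)"
proof -
  have inj: "inj_on (from_nat_into I) {..<card I}"
    using bij_betw_from_nat_into_finite[OF I] by (simp add: bij_betw_def)
  have "Matrix.mat (card I) (card I) (\<lambda>(i, j). of_bool (from_nat_into I i = from_nat_into I j)) = (1\<^sub>m (card I) :: 'r mat)"
    by (rule eq_matI) (auto simp: inj_on_eq_iff[OF inj])
  then show ?thesis unfolding idet_def by simp
qed

lemma idet_singleton: "idet {i} {j} M = M i j"
proof -
  have "from_nat_into {i} 0 = i" "from_nat_into {j} 0 = j"
    using from_nat_into[of "{i}" 0] from_nat_into[of "{j}" 0] by blast+
  then show ?thesis unfolding idet_def
    by (subst det_single) auto
qed

lemma idet_scale:
  shows "idet I J (\<lambda>i j. c * M i j) = c ^ card I * idet I J M"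
proof -
  have "Matrix.mat (card I) (card I) (\<lambda>(i, j). c * M (from_nat_into I i) (from_nat_into J j)) =
    c \<cdot>\<^sub>m Matrix.mat (card I) (card I) (\<lambda>(i, j). M (from_nat_into I i) (from_nat_into J j))"
    by (rule eq_matI) auto
  then show ?thesis unfolding idet_def by simp
qed

lemma bij_betw_append_enum:
  fixes m n :: nat
  assumes "bij_betw f {..<m} I1" "bij_betw f' {..<n} I2" "I1 \<inter> I2 = {}"
  shows "bij_betw (\<lambda>i. if i < m then f i else f' (i - m)) {..<m + n} (I1 \<union> I2)"
proof -
  let ?h = "\<lambda>i. if i < m then f i else f' (i - m)"
  have 1: "bij_betw ?h {..<m} I1"
    using assms(1) by (rule bij_betw_cong[THEN iffD1, rotated]) auto
  have "bij_betw (\<lambda>i. i - m) {m..<m + n} {..<n}"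
    by (rule bij_betw_byWitness[where f' = "\<lambda>i. i + m"]) auto
  from bij_betw_trans[OF this assms(2)] have 2: "bij_betw ?h {m..<m + n} I2"
    by (rule bij_betw_cong[THEN iffD1, rotated]) auto
  have "{..<m} \<union> {m..<m + n} = {..<m + n}" by auto
  then show ?thesis using bij_betw_combine[OF 1 2 assms(3)] by simp
qed

lemma idet_block:
  fixes M :: "'i \<Rightarrow> 'j \<Rightarrow> 'r::idom"
  assumes fin: "finite I1" "finite I2" "finite J1" "finite J2"
    and card: "card I1 = card J1" "card I2 = card J2"
    and disj: "I1 \<inter> I2 = {}" "J1 \<inter> J2 = {}"
    and zero: "\<And>i j. i \<in> I1 \<Longrightarrow> j \<in> J2 \<Longrightarrow> M i j = 0"
  shows "idet (I1 \<union> I2) (J1 \<union> J2) M =\<^sub>\<plusminus> idet I1 J1 M * idet I2 J2 M"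
proof -
  let ?m = "card I1" and ?n = "card I2"
  let ?f = "\<lambda>i. if i < ?m then from_nat_into I1 i else from_nat_into I2 (i - ?m)"
  let ?g = "\<lambda>i. if i < ?m then from_nat_into J1 i else from_nat_into J2 (i - ?m)"
  note e = fin[THEN bij_betw_from_nat_into_finite]
  have f: "bij_betw ?f {..<?m + ?n} (I1 \<union> I2)"
    by (intro bij_betw_append_enum e disj)
  have g: "bij_betw ?g {..<?m + ?n} (J1 \<union> J2)"
    using e(3,4) by (intro bij_betw_append_enum disj) (simp_all add: card)
  let ?X = "\<lambda>I J. Matrix.mat (card I) (card J) (\<lambda>(i, j). M (from_nat_into I i) (from_nat_into J j))"
  have in_I1: "from_nat_into I1 i \<in> I1" if "i < ?m" for i
    using e(1) that by (auto simp: bij_betw_def)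
  have in_J2: "from_nat_into J2 i \<in> J2" if "i < ?n" for i
    using e(4) that by (auto simp: bij_betw_def card)
  have "Matrix.mat (?m + ?n) (?m + ?n) (\<lambda>(i, j). M (?f i) (?g j)) =
      four_block_mat (?X I1 J1) (0\<^sub>m ?m ?n) (?X I2 J1) (?X I2 J2)"
    by (rule eq_matI) (auto simp: card[symmetric] intro!: zero in_I1 in_J2)
  also have "Determinant.det \<dots> = Determinant.det (?X I1 J1) * Determinant.det (?X I2 J2)"
    by (rule det_four_block_mat_upper_right_zero[where n = ?m and m = ?n]) (auto simp: card)
  also have "\<dots> = idet I1 J1 M * idet I2 J2 M" by (simp add: idet_def card)
  finally show ?thesis using det_enum_pm[OF f g, of M] by (simp add: pm_eq_sym)
qed

lemma idet_zero_if_kernel_vector: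
  fixes M :: "'i \<Rightarrow> 'j \<Rightarrow> 'r::idom"
  assumes "finite I" "finite J" "card I = card J" "j \<in> J" "v j \<noteq> 0"
    and "\<And>i. i \<in> I \<Longrightarrow> (\<Sum>j\<in>J. M i j * v j) = 0"
  shows "idet I J M = 0"
proof -
  let ?n = "card I"
  note eI = bij_betw_from_nat_into_finite[OF assms(1)]
  note eJ = bij_betw_from_nat_into_finite[OF assms(2), folded assms(3)]
  let ?A = "Matrix.mat ?n ?n (\<lambda>(i, j). M (from_nat_into I i) (from_nat_into J j))"
  let ?v = "Matrix.vec ?n (\<lambda>j. v (from_nat_into J j))"
  obtain k where k: "k < ?n" "from_nat_into J k = j"
    using eJ assms(4) unfolding bij_betw_def by (metis imageE lessThan_iff)
  have nz: "?v \<noteq> 0\<^sub>v ?n"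
  proof
    assume "?v = 0\<^sub>v ?n"
    then have "vec_index ?v k = vec_index (0\<^sub>v ?n) k" by (rule arg_cong)
    then show False using k assms(5) by simp
  qed
  have s: "(\<Sum>j<?n. h (from_nat_into J j)) = sum h J" for h :: "'j \<Rightarrow> 'r"
    using sum.reindex_bij_betw[OF eJ] .
  have "from_nat_into I i \<in> I" if "i < ?n" for i using eI that by (auto simp: bij_betw_def)
  then have Av: "?A *\<^sub>v ?v = 0\<^sub>v ?n"
    using assms(6) s[of "\<lambda>j. M (from_nat_into I i) j * v j" for i]
    by (intro eq_vecI) (auto simp: scalar_prod_def lessThan_atLeast0)
  then show ?thesis
    unfolding idet_def using nz Av
    by (intro det_0_iff_vec_prod_zero[of ?A ?n, THEN iffD2] exI[of _ ?v]) simp_all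
qed

lemma idet_unimodular:
  fixes M :: "'i \<Rightarrow> 'j \<Rightarrow> int"
  assumes "finite I" "finite J" "card I = card J"
    and inverse: "\<And>i i'. i \<in> I \<Longrightarrow> i' \<in> I \<Longrightarrow> (\<Sum>j\<in>J. M i j * N j i') = of_bool (i = i')"
  shows "idet I J M =\<^sub>\<plusminus> 1"
proof -
  have "idet I J M * idet J I N = idet I I (\<lambda>i i'. \<Sum>j\<in>J. M i j * N j i')"
    by (rule idet_mult[symmetric]) (use assms in auto)
  also have "\<dots> = idet I I (\<lambda>i i'. of_bool (i = i'))"
    using assms(1) by (intro idet_cong inverse) auto
  also have "\<dots> = 1" using assms(1) by (rule idet_id)
  finally have "idet I J M dvd 1" by (rule dvdI[OF sym])
  then have "\<bar>idet I J M\<bar> = 1" by simp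
  then show ?thesis unfolding pm_eq_def by linarith
qed

lemma idet_of_int:
  "idet I J (\<lambda>i j. of_int (M i j) :: 'r::{idom,ring_char_0}) = of_int (idet I J M)"
proof -
  have "(of_int (Determinant.det A) :: 'r) = Determinant.det (map_mat of_int A)" for A :: "int mat"
    by (rule comm_ring_hom.hom_det[symmetric]) (rule of_int_hom.comm_ring_hom_axioms)
  note this[of "Matrix.mat (card I) (card I) (\<lambda>(i, j). M (from_nat_into I i) (from_nat_into J j))"]
  also have "map_mat of_int (Matrix.mat (card I) (card I) (\<lambda>(i, j). M (from_nat_into I i) (from_nat_into J j))) =
    Matrix.mat (card I) (card I) (\<lambda>(i, j). of_int (M (from_nat_into I i) (from_nat_into J j)) :: 'r)"
    by (rule eq_matI) auto
  finally show ?thesis unfolding idet_def by (rule sym)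
qed

text \<open>
  Multilinearity in the rows: when row \<open>i\<close> is a sum over \<open>D i\<close>, the determinant is a sum over the
  choice functions. For the rows of a Laplacian, a choice function is a functional graph.
\<close>

lemma idet_Leibniz_expand_rows:
  fixes w :: "'i \<Rightarrow> 'd \<Rightarrow> 'r::idom"
  assumes "finite I" "\<And>i. i \<in> I \<Longrightarrow> finite (D i)"
  shows "idet I I (\<lambda>i j. \<Sum>d\<in>D i. w i d * M i d j) =
    (\<Sum>k\<in>Pi\<^sub>E I D. (\<Prod>i\<in>I. w i (k i)) * idet I I (\<lambda>i j. M i (k i) j))"
proof -
  let ?n = "card I" and ?e = "from_nat_into I"
  let ?P = "{p. p permutes {0..<?n}}"
  have e: "bij_betw ?e {0..<?n} I"
    using bij_betw_from_nat_into_finite[OF assms(1)] by (simp add: lessThan_atLeast0)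
  define ie where "ie = inv_into {0..<?n} ?e"
  have ie: "ie (?e i) = i" if "i < ?n" for i
    using e that by (simp add: ie_def bij_betw_def)
  have iI: "?e (ie i) = i" "ie i < ?n" if "i \<in> I" for i
    using e that f_inv_into_f[of i ?e "{0..<?n}"] inv_into_into[of i ?e "{0..<?n}"]
    by (auto simp: ie_def bij_betw_def)
  have det: "idet I I N = (\<Sum>p\<in>?P. signof p * (\<Prod>i\<in>I. N i (?e (p (ie i)))))" for N :: "'i \<Rightarrow> 'i \<Rightarrow> 'r"
  proof -
    have "(\<Prod>i = 0..<?n. N (?e i) (?e (p i))) = (\<Prod>i\<in>I. N i (?e (p (ie i))))" for p
    proof -
      have "(\<Prod>i = 0..<?n. N (?e i) (?e (p i))) = (\<Prod>i = 0..<?n. N (?e i) (?e (p (ie (?e i)))))"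
        using ie by (intro prod.cong) auto
      then show ?thesis
        using prod.reindex_bij_betw[OF e, of "\<lambda>i. N i (?e (p (ie i)))"] by simp
    qed
    moreover have "(\<Prod>i = 0..<?n. Matrix.mat ?n ?n (\<lambda>(i, j). N (?e i) (?e j)) $$ (i, p i)) =
        (\<Prod>i = 0..<?n. N (?e i) (?e (p i)))" if "p \<in> ?P" for p
      using that permutes_in_image[of p "{0..<?n}"] by (intro prod.cong) auto
    ultimately show ?thesis
      unfolding idet_def by (subst Determinant.det_def') (auto intro!: sum.cong)
  qed
  have "idet I I (\<lambda>i j. \<Sum>d\<in>D i. w i d * M i d j) =
      (\<Sum>p\<in>?P. signof p * (\<Prod>i\<in>I. \<Sum>d\<in>D i. w i d * M i d (?e (p (ie i)))))"
    by (rule det)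
  also have "\<dots> = (\<Sum>p\<in>?P. signof p * (\<Sum>k\<in>Pi\<^sub>E I D. \<Prod>i\<in>I. w i (k i) * M i (k i) (?e (p (ie i)))))"
    using assms by (simp add: prod_sum_PiE)
  also have "\<dots> = (\<Sum>p\<in>?P. \<Sum>k\<in>Pi\<^sub>E I D. (\<Prod>i\<in>I. w i (k i)) * (signof p * (\<Prod>i\<in>I. M i (k i) (?e (p (ie i))))))"
    by (simp add: sum_distrib_left prod.distrib mult_ac)
  also have "\<dots> = (\<Sum>k\<in>Pi\<^sub>E I D. \<Sum>p\<in>?P. (\<Prod>i\<in>I. w i (k i)) * (signof p * (\<Prod>i\<in>I. M i (k i) (?e (p (ie i))))))"
    by (rule sum.swap)
  also have "\<dots> = (\<Sum>k\<in>Pi\<^sub>E I D. (\<Prod>i\<in>I. w i (k i)) * idet I I (\<lambda>i j. M i (k i) j))"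
    by (simp add: det sum_distrib_left)
  finally show ?thesis .
qed

text \<open>
  Every non-zero term of the Leibniz formula belongs to a permutation that never raises the rank,
  and the sum of the ranks is invariant, so only the identity remains.
\<close>

lemma idet_rank_triangular:
  fixes M :: "'i \<Rightarrow> 'i \<Rightarrow> 'r::idom" and r :: "'i \<Rightarrow> nat"
  assumes "finite I" and "\<And>i. i \<in> I \<Longrightarrow> M i i = 1"
    and "\<And>i j. i \<in> I \<Longrightarrow> j \<in> I \<Longrightarrow> i \<noteq> j \<Longrightarrow> M i j \<noteq> 0 \<Longrightarrow> r j < r i"
  shows "idet I I M = 1"
proof -
  let ?n = "card I" and ?e = "from_nat_into I"
  let ?P = "{p. p permutes {0..<?n}}"
  have e: "bij_betw ?e {0..<?n} I"
    using bij_betw_from_nat_into_finite[OF assms(1)] by (simp add: lessThan_atLeast0)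
  have eI: "?e i \<in> I" if "i < ?n" for i using e that by (auto simp: bij_betw_def)
  have inj: "?e i = ?e j \<longleftrightarrow> i = j" if "i < ?n" "j < ?n" for i j
    using e that by (auto simp: bij_betw_def inj_on_def)
  have zero: "(\<Prod>i = 0..<?n. M (?e i) (?e (p i))) = 0" if p: "p permutes {0..<?n}" "p \<noteq> id" for p
  proof (rule ccontr)
    assume nz: "(\<Prod>i = 0..<?n. M (?e i) (?e (p i))) \<noteq> 0"
    have lt: "p i < ?n" if "i < ?n" for i using permutes_in_image[OF p(1), of i] that by simp
    have le: "r (?e (p i)) \<le> r (?e i)" if "i \<in> {0..<?n}" for i
      using assms(3)[OF eI eI, of i "p i"] nz that lt by (cases "?e i = ?e (p i)") (auto simp: order_less_imp_le)
    obtain i where i: "i < ?n" "p i \<noteq> i"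
      using p permutes_not_in[OF p(1)] by (metis atLeastLessThan_iff eq_id_iff le0)
    have "r (?e (p i)) < r (?e i)"
      using assms(3)[OF eI eI, of i "p i"] nz i lt inj by auto
    then have "(\<Sum>i = 0..<?n. r (?e (p i))) < (\<Sum>i = 0..<?n. r (?e i))"
      using le i by (intro sum_strict_mono_ex1) auto
    moreover have "(\<Sum>i = 0..<?n. r (?e (p i))) = (\<Sum>i = 0..<?n. r (?e i))"
      using sum.permute[OF p(1), of "\<lambda>i. r (?e i)"] by (simp add: o_def)
    ultimately show False by simp
  qed
  have "idet I I M = (\<Sum>p\<in>?P. signof p * (\<Prod>i = 0..<?n. M (?e i) (?e (p i))))"
  proof -
    have "(\<Prod>i = 0..<?n. Matrix.mat ?n ?n (\<lambda>(i, j). M (?e i) (?e j)) $$ (i, p i)) =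
        (\<Prod>i = 0..<?n. M (?e i) (?e (p i)))" if "p \<in> ?P" for p
      using that permutes_in_image[of p "{0..<?n}"] by (intro prod.cong) auto
    then show ?thesis
      unfolding idet_def by (subst Determinant.det_def') (auto intro!: sum.cong)
  qed
  also have "\<dots> = (\<Sum>p\<in>{id}. signof p * (\<Prod>i = 0..<?n. M (?e i) (?e (p i))))"
    using zero by (intro sum.mono_neutral_right) (auto simp: permutes_id finite_permutations)
  also have "\<dots> = 1" using assms(2)[OF eI] by simp
  finally show ?thesis .
qed

section \<open>Spanning trees and dual multigraphs\<close>

definition incidence :: "('e \<Rightarrow> 'v) \<Rightarrow> ('e \<Rightarrow> 'v) \<Rightarrow> 'e \<Rightarrow> 'v \<Rightarrow> 'r::comm_ring_1" where
  "incidence p q e v = of_bool (p e = v) - of_bool (q e = v)"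

definition crosses :: "('e \<Rightarrow> 'v) \<Rightarrow> ('e \<Rightarrow> 'v) \<Rightarrow> 'v set \<Rightarrow> 'e \<Rightarrow> bool" where
  "crosses p q X e \<longleftrightarrow> (p e \<in> X) \<noteq> (q e \<in> X)"

text \<open>
  Connectivity is expressed by cuts instead of paths, since in the plane the cuts of a graph are
  cycles of its dual.
\<close>

definition connects :: "'e set \<Rightarrow> ('e \<Rightarrow> 'v) \<Rightarrow> ('e \<Rightarrow> 'v) \<Rightarrow> 'v set \<Rightarrow> bool" where
  "connects Z p q V \<longleftrightarrow> finite Z \<and> finite V \<and> V \<noteq> {} \<and> p ` Z \<subseteq> V \<and> q ` Z \<subseteq> V \<and>
     (\<forall>X\<subseteq>V. X \<noteq> {} \<longrightarrow> X \<noteq> V \<longrightarrow> (\<exists>e\<in>Z. crosses p q X e))"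

definition spans_tree :: "'e set \<Rightarrow> ('e \<Rightarrow> 'v) \<Rightarrow> ('e \<Rightarrow> 'v) \<Rightarrow> 'v set \<Rightarrow> bool" where
  "spans_tree T p q V \<longleftrightarrow> connects T p q V \<and> card T + 1 = card V"

lemma connectsD:
  assumes "connects Z p q V"
  shows "finite Z" "finite V" "V \<noteq> {}" "e \<in> Z \<Longrightarrow> p e \<in> V" "e \<in> Z \<Longrightarrow> q e \<in> V"
    "X \<subseteq> V \<Longrightarrow> X \<noteq> {} \<Longrightarrow> X \<noteq> V \<Longrightarrow> \<exists>e\<in>Z. crosses p q X e"
  using assms by (auto simp: connects_def)

lemma spans_treeD:
  assumes "spans_tree T p q V"
  shows "connects T p q V" "card T + 1 = card V"
  using assms by (auto simp: spans_tree_def)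

lemma connects_mono:
  "connects Z p q V \<Longrightarrow> Z \<subseteq> Z' \<Longrightarrow> finite Z' \<Longrightarrow> p ` Z' \<subseteq> V \<Longrightarrow> q ` Z' \<subseteq> V \<Longrightarrow> connects Z' p q V"
  unfolding connects_def by blast

lemma sum_incidence:
  assumes "finite X"
  shows "(\<Sum>v\<in>X. incidence p q e v :: 'r::comm_ring_1) = of_bool (p e \<in> X) - of_bool (q e \<in> X)"
  using assms by (simp add: incidence_def sum_subtractf of_bool_def sum.delta)

lemma sum_incidence_mult:
  assumes "finite V" "p e \<in> V" "q e \<in> V"
  shows "(\<Sum>v\<in>V. \<phi> v * incidence p q e v :: 'r::comm_ring_1) = \<phi> (p e) - \<phi> (q e)"
proof -
  have "(\<Sum>v\<in>V. \<phi> v * incidence p q e v) =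
      (\<Sum>v\<in>V. if p e = v then \<phi> v else 0) - (\<Sum>v\<in>V. if q e = v then \<phi> v else 0)"
    by (simp add: incidence_def right_diff_distrib of_bool_def if_distrib[of "\<lambda>x. _ * x"] sum_subtractf cong: if_cong)
  then show ?thesis using assms by (simp add: sum.delta)
qed

text \<open>
  A connected set of vertices is grown one vertex at a time along edges that leave it.
\<close>

lemma spans_tree_exists:
  assumes "connects Z p q V"
  shows "\<exists>T\<subseteq>Z. spans_tree T p q V"
proof -
  note V = connectsD[OF assms]
  have grow: "\<exists>X T. X \<subseteq> V \<and> card X = Suc k \<and> T \<subseteq> Z \<and> connects T p q X \<and> card T = k" if "Suc k \<le> card V" for k
    using that
  proof (induction k)
    case 0
    obtain v where "v \<in> V" using V by blast
    then have "{v} \<subseteq> V \<and> card {v} = Suc 0 \<and> {} \<subseteq> Z \<and> connects {} p q {v} \<and> card ({} :: 'a set) = 0"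
      by (auto simp: connects_def)
    then show ?case by blast
  next
    case (Suc k)
    then obtain X T where X: "X \<subseteq> V" "card X = Suc k" "T \<subseteq> Z" "connects T p q X" "card T = k"
      by auto
    note XT = connectsD[OF X(4)]
    have "X \<noteq> V" using X(2) Suc.prems by auto
    then obtain e where e: "e \<in> Z" "crosses p q X e" using V(6)[of X] X(1) XT by blast
    obtain w where w: "w \<in> V" "w \<notin> X" "{p e, q e} \<subseteq> insert w X" "w \<in> {p e, q e}"
      using e V(4,5) by (auto simp: crosses_def)
    have eT: "e \<notin> T" using XT e by (auto simp: crosses_def)
    have "connects (insert e T) p q (insert w X)"
      unfolding connects_def
    proof (intro conjI allI impI)
      show "finite (insert e T)" "finite (insert w X)" "insert w X \<noteq> {}"
        "p ` insert e T \<subseteq> insert w X" "q ` insert e T \<subseteq> insert w X"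
        using XT w by auto
      fix Y assume Y: "Y \<subseteq> insert w X" "Y \<noteq> {}" "Y \<noteq> insert w X"
      show "\<exists>e'\<in>insert e T. crosses p q Y e'"
      proof (cases "Y \<inter> X = {} \<or> Y \<inter> X = X")
        case True
        then have "Y = {w} \<or> Y = X" using Y w(2) by blast
        then have "crosses p q Y e" using e w by (auto simp: crosses_def)
        then show ?thesis by blast
      next
        case False
        then obtain e' where "e' \<in> T" "crosses p q (Y \<inter> X) e'"
          using XT(6)[of "Y \<inter> X"] by blast
        then show ?thesis using XT(4,5)[of e'] by (auto simp: crosses_def)
      qed
    qed
    moreover have "card (insert w X) = Suc (Suc k)" "card (insert e T) = Suc k"
      using X XT w eT by auto
    moreover have "insert w X \<subseteq> V" "insert e T \<subseteq> Z" using X w e by auto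
    ultimately show ?case by blast
  qed
  moreover have "card V > 0" using V by (simp add: card_gt_0_iff)
  ultimately obtain X T where "X \<subseteq> V" "card X = card V" "T \<subseteq> Z" "connects T p q X" "card T = card V - 1"
    using grow[of "card V - 1"] by auto
  moreover from this have "X = V" using V(2) by (simp add: card_subset_eq)
  ultimately show ?thesis
    using \<open>card V > 0\<close> by (intro exI[of _ T]) (auto simp: spans_tree_def)
qed

lemma connects_card_le:
  assumes "connects Z p q V"
  shows "card V \<le> card Z + 1"
proof -
  obtain T where "T \<subseteq> Z" "spans_tree T p q V" using spans_tree_exists[OF assms] by blast
  then show ?thesis
    using card_mono[OF connectsD(1)[OF assms], of T] by (simp add: spans_tree_def)
qed

text \<open>
  By its number of edges, \<open>T - {e}\<close> no longer connects \<open>V\<close>. The side of the resulting cut that does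
  not contain \<open>v0\<close> serves as \<open>X\<close>.
\<close>

lemma fundamental_cut:
  assumes "spans_tree T p q V" "e \<in> T" "v0 \<in> V"
  shows "\<exists>X\<subseteq>V - {v0}. \<forall>e'\<in>T. crosses p q X e' \<longleftrightarrow> e' = e"
proof -
  note T = spans_treeD[OF assms(1)] and C = connectsD[OF spans_treeD(1)[OF assms(1)]]
  have "card T = Suc (card (T - {e}))" by (rule card.remove[OF C(1) assms(2)])
  then have "\<not> connects (T - {e}) p q V"
    using connects_card_le[of "T - {e}" p q V] T(2) by linarith
  moreover have "finite (T - {e}) \<and> finite V \<and> V \<noteq> {} \<and> p ` (T - {e}) \<subseteq> V \<and> q ` (T - {e}) \<subseteq> V"
    using T(1) unfolding connects_def by auto
  ultimately have "\<not> (\<forall>X\<subseteq>V. X \<noteq> {} \<longrightarrow> X \<noteq> V \<longrightarrow> (\<exists>e'\<in>T - {e}. crosses p q X e'))"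
    unfolding connects_def by simp
  then obtain X where X: "X \<subseteq> V" "X \<noteq> {}" "X \<noteq> V" "\<And>e'. e' \<in> T - {e} \<Longrightarrow> \<not> crosses p q X e'"
    by blast
  obtain e1 where "e1 \<in> T" "crosses p q X e1" using C(6)[OF X(1-3)] by blast
  moreover from this have "e1 = e" using X(4)[of e1] by blast
  ultimately have only: "crosses p q X e' \<longleftrightarrow> e' = e" if "e' \<in> T" for e'
    using X(4)[of e'] that by blast
  show ?thesis
  proof (cases "v0 \<in> X")
    case True
    have "crosses p q (V - X) e' \<longleftrightarrow> e' = e" if "e' \<in> T" for e'
      using only[OF that] C(4,5)[OF that] by (simp add: crosses_def)
    moreover have "V - X \<subseteq> V - {v0}" using True by blast
    ultimately show ?thesis by blast
  next
    case False
    then have "X \<subseteq> V - {v0}" using X(1) by blast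
    with only show ?thesis by blast
  qed
qed

text \<open>
  The potential is a combination of the indicator functions of the fundamental cuts.
\<close>

lemma spans_tree_potential:
  fixes c :: "'e \<Rightarrow> 'r::comm_ring_1"
  assumes "spans_tree T p q V" "v0 \<in> V"
  shows "\<exists>\<phi>. \<phi> v0 = 0 \<and> (\<forall>e\<in>T. \<phi> (p e) - \<phi> (q e) = c e)"
proof -
  have "\<exists>X. \<forall>e\<in>T. X e \<subseteq> V - {v0} \<and> (\<forall>e'\<in>T. crosses p q (X e) e' \<longleftrightarrow> e' = e)"
    using fundamental_cut[OF assms(1) _ assms(2)] by (intro bchoice) blast
  then obtain X where X: "\<And>e. e \<in> T \<Longrightarrow> X e \<subseteq> V - {v0}"
      "\<And>e e'. e \<in> T \<Longrightarrow> e' \<in> T \<Longrightarrow> crosses p q (X e) e' \<longleftrightarrow> e' = e"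
    by blast
  define s where "s e = (if p e \<in> X e then 1 else - 1 :: 'r)" for e
  define \<phi> where "\<phi> v = (\<Sum>e\<in>T. c e * s e * of_bool (v \<in> X e))" for v
  have fin: "finite T" using assms(1) by (auto simp: spans_tree_def connects_def)
  have "\<phi> (p e') - \<phi> (q e') = c e'" if "e' \<in> T" for e'
  proof -
    have "\<phi> (p e') - \<phi> (q e') = (\<Sum>e\<in>T. c e * s e * (of_bool (p e' \<in> X e) - of_bool (q e' \<in> X e)))"
      by (simp add: \<phi>_def sum_subtractf right_diff_distrib)
    also have "\<dots> = (\<Sum>e\<in>T. if e = e' then c e else 0)"
    proof (rule sum.cong[OF refl])
      fix e assume "e \<in> T"
      then show "c e * s e * (of_bool (p e' \<in> X e) - of_bool (q e' \<in> X e)) = (if e = e' then c e else 0)"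
        using X(2)[of e e'] that by (cases "p e' \<in> X e"; cases "q e' \<in> X e") (auto simp: s_def crosses_def)
    qed
    also have "\<dots> = c e'" using that fin by (simp add: sum.delta)
    finally show ?thesis .
  qed
  moreover have "\<phi> v0 = 0" unfolding \<phi>_def using X(1) by (intro sum.neutral) auto
  ultimately show ?thesis by blast
qed

lemma connects_constant:
  assumes "connects Z p q V" "\<And>e. e \<in> Z \<Longrightarrow> \<phi> (p e) = \<phi> (q e)" "v \<in> V" "w \<in> V"
  shows "\<phi> v = \<phi> w"
proof (rule ccontr)
  assume neq: "\<phi> v \<noteq> \<phi> w"
  let ?X = "{u \<in> V. \<phi> u = \<phi> v}"
  have "?X \<subseteq> V" "?X \<noteq> {}" "w \<notin> ?X" using assms(3,4) neq by auto
  then have "?X \<subseteq> V" "?X \<noteq> {}" "?X \<noteq> V" using assms(4) by blast+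
  from connectsD(6)[OF assms(1) this] obtain e where "e \<in> Z" "crosses p q ?X e" by blast
  then show False using connectsD(4,5)[OF assms(1), of e] assms(2) by (auto simp: crosses_def)
qed

text \<open>
  When the equations are summed over one side of the fundamental cut of \<open>e\<close>, only the term of \<open>e\<close>
  survives.
\<close>

lemma spans_tree_independent:
  fixes c :: "'e \<Rightarrow> 'r::comm_ring_1"
  assumes T: "spans_tree T p q V" "e \<in> T"
    and circ: "\<And>v. v \<in> V \<Longrightarrow> (\<Sum>e\<in>T. c e * incidence p q e v) = 0"
  shows "c e = 0"
proof -
  have "V \<noteq> {}" "finite V" "finite T" using T(1) by (auto simp: spans_tree_def connects_def)
  then obtain v0 where "v0 \<in> V" by blast
  from fundamental_cut[OF T this] obtain X
    where X: "X \<subseteq> V - {v0}" "\<And>e'. e' \<in> T \<Longrightarrow> crosses p q X e' \<longleftrightarrow> e' = e"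
    by auto
  have "finite X" using X(1) \<open>finite V\<close> by (rule finite_subset[OF _ finite_Diff])
  have "0 = (\<Sum>v\<in>X. \<Sum>e\<in>T. c e * incidence p q e v)" using X(1) circ by (intro sum.neutral[symmetric]) blast
  also have "\<dots> = (\<Sum>e\<in>T. c e * (\<Sum>v\<in>X. incidence p q e v))"
    unfolding sum_distrib_left by (rule sum.swap)
  also have "\<dots> = (\<Sum>e'\<in>T. c e' * (of_bool (p e' \<in> X) - of_bool (q e' \<in> X)))"
    by (simp add: sum_incidence \<open>finite X\<close>)
  also have "\<dots> = (\<Sum>e'\<in>T. if e' = e then c e * (of_bool (p e \<in> X) - of_bool (q e \<in> X)) else 0)"
    using X(2) by (intro sum.cong refl) (auto simp: crosses_def)
  also have "\<dots> = c e * (of_bool (p e \<in> X) - of_bool (q e \<in> X))"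
    using T(2) \<open>finite T\<close> by simp
  finally show ?thesis
    using X(2)[OF T(2)] unfolding crosses_def by (cases "p e \<in> X"; cases "q e \<in> X") auto
qed

text \<open>
  No edge leaves the set of those \<open>v\<close> for which such a combination exists.
\<close>

lemma connects_integer_combination:
  assumes "connects Z p q V" "v \<in> V" "w \<in> V"
  shows "\<exists>k :: 'e \<Rightarrow> int. \<forall>u. (\<Sum>e\<in>Z. k e * incidence p q e u) = of_bool (u = v) - of_bool (u = w)"
proof -
  note C = connectsD[OF assms(1)]
  let ?P = "\<lambda>v. \<exists>k :: 'e \<Rightarrow> int. \<forall>u. (\<Sum>e\<in>Z. k e * incidence p q e u) = of_bool (u = v) - of_bool (u = w)"
  have step: "?P v'" if P: "?P v" and e: "e \<in> Z" "{p e, q e} = {v, v'}" for v v' e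
  proof -
    obtain k where k: "\<And>u. (\<Sum>e\<in>Z. k e * incidence p q e u) = (of_bool (u = v) - of_bool (u = w) :: int)"
      using P by blast
    define s where "s = (if p e = v' then 1 else - 1 :: int)"
    have "(\<Sum>e'\<in>Z. (k e' + of_bool (e' = e) * s) * incidence p q e' u) =
        (of_bool (u = v) - of_bool (u = w)) + s * incidence p q e u" for u
    proof -
      have "(\<Sum>e'\<in>Z. (k e' + of_bool (e' = e) * s) * incidence p q e' u) =
          (\<Sum>e'\<in>Z. k e' * incidence p q e' u + (if e' = e then s * incidence p q e u else 0))"
        by (intro sum.cong refl) (simp add: distrib_right)
      then show ?thesis using e(1) C(1) k[of u] by (simp add: sum.distrib sum.delta)
    qed
    also have "\<dots> u = of_bool (u = v') - of_bool (u = w)" for u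
      using e(2) by (auto simp: s_def incidence_def doubleton_eq_iff)
    finally show ?thesis by (intro exI[of _ "\<lambda>e'. k e' + of_bool (e' = e) * s"]) blast
  qed
  let ?X = "{v \<in> V. ?P v}"
  have "?P w" by (intro exI[of _ "\<lambda>_. 0"]) simp
  then have "?X \<noteq> {}" using assms(3) by blast
  have "?X = V"
  proof (rule ccontr)
    assume "?X \<noteq> V"
    then obtain e where e: "e \<in> Z" "crosses p q ?X e"
      using C(6)[of ?X] \<open>?X \<noteq> {}\<close> by blast
    have "?P (q e)" if "?P (p e)" by (rule step[OF that e(1)]) simp
    moreover have "?P (p e)" if "?P (q e)" by (rule step[OF that e(1)]) (rule insert_commute)
    moreover have "p e \<in> V" "q e \<in> V" using C(4,5)[OF e(1)] .
    ultimately show False using e(2) unfolding mem_Collect_eq crosses_def by argo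
  qed
  then show ?thesis using assms(2) by blast
qed

text \<open>
  The integer combinations of \<open>connects_integer_combination\<close> are the rows of an inverse matrix.
\<close>

lemma spans_tree_unimodular:
  assumes "spans_tree T p q V" "v0 \<in> V"
  shows "idet T (V - {v0}) (incidence p q :: _ \<Rightarrow> _ \<Rightarrow> 'r::{idom,ring_char_0}) =\<^sub>\<plusminus> 1"
proof -
  note C = connectsD[OF spans_treeD(1)[OF assms(1)]]
  have card: "card (V - {v0}) = card T"
    using spans_treeD(2)[OF assms(1)] assms(2) C(2) by simp
  have "\<exists>k. \<forall>v\<in>V. \<forall>u. (\<Sum>e\<in>T. k v e * incidence p q e u) = (of_bool (u = v) - of_bool (u = v0) :: int)"
    using connects_integer_combination[OF spans_treeD(1)[OF assms(1)] _ assms(2)] by (intro bchoice) blast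
  then obtain k where k: "\<And>v u. v \<in> V \<Longrightarrow>
      (\<Sum>e\<in>T. k v e * incidence p q e u) = (of_bool (u = v) - of_bool (u = v0) :: int)"
    by blast
  have "idet (V - {v0}) T (\<lambda>v e. incidence p q e v :: int) =\<^sub>\<plusminus> 1"
  proof (rule idet_unimodular[where N = "\<lambda>e v. k v e"])
    fix v v' assume "v \<in> V - {v0}" "v' \<in> V - {v0}"
    then show "(\<Sum>e\<in>T. incidence p q e v * k v' e) = of_bool (v = v')"
      using k[of v' v] by (simp add: mult.commute)
  qed (use C(1,2) card in simp_all)
  then have "idet T (V - {v0}) (incidence p q :: _ \<Rightarrow> _ \<Rightarrow> int) =\<^sub>\<plusminus> 1"
    using idet_transpose[of "V - {v0}" T "\<lambda>v e. incidence p q e v :: int"] card by simp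
  moreover have "(incidence p q :: _ \<Rightarrow> _ \<Rightarrow> 'r) = (\<lambda>e v. of_int (incidence p q e v))"
    by (intro ext) (simp add: incidence_def)
  then have "idet T (V - {v0}) (incidence p q :: _ \<Rightarrow> _ \<Rightarrow> 'r) = of_int (idet T (V - {v0}) (incidence p q))"
    by (simp only: idet_of_int)
  ultimately show ?thesis unfolding pm_eq_def by (metis of_int_1 of_int_minus)
qed

text \<open>
  Planar duality without a plane: the coboundaries of each graph are circulations of the
  other one, and the count of vertices, as in Euler's formula, is such that there are no further
  circulations.
\<close>

locale dual_multigraphs =
  fixes E :: "'e set" and p q :: "'e \<Rightarrow> 'v" and V :: "'v set" and p' q' :: "'e \<Rightarrow> 'w" and W :: "'w set"
  assumes conn: "connects E p q V" and conn': "connects E p' q' W"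
    and orthogonal: "\<And>v w. v \<in> V \<Longrightarrow> w \<in> W \<Longrightarrow> (\<Sum>e\<in>E. incidence p q e v * incidence p' q' e w) = (0 :: int)"
    and euler_count: "card V + card W = card E + 2"
begin

lemma orthogonal_ring:
  assumes "v \<in> V" "w \<in> W"
  shows "(\<Sum>e\<in>E. incidence p q e v * incidence p' q' e w) = (0 :: 'r::comm_ring_1)"
proof -
  have "(\<Sum>e\<in>E. incidence p q e v * incidence p' q' e w :: 'r) =
      of_int (\<Sum>e\<in>E. incidence p q e v * incidence p' q' e w)"
    by (simp add: incidence_def)
  then show ?thesis using orthogonal[OF assms] by simp
qed

lemma coboundary_is_circulation:
  fixes \<phi> :: "'w \<Rightarrow> 'r::comm_ring_1"
  assumes "v \<in> V"
  shows "(\<Sum>e\<in>E. (\<phi> (p' e) - \<phi> (q' e)) * incidence p q e v) = 0"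
proof -
  note C' = connectsD[OF conn']
  have "(\<Sum>e\<in>E. (\<phi> (p' e) - \<phi> (q' e)) * incidence p q e v) =
      (\<Sum>e\<in>E. \<Sum>w\<in>W. \<phi> w * (incidence p q e v * incidence p' q' e w))"
  proof (rule sum.cong[OF refl])
    fix e assume "e \<in> E"
    then have "\<phi> (p' e) - \<phi> (q' e) = (\<Sum>w\<in>W. \<phi> w * incidence p' q' e w)"
      using C' by (intro sum_incidence_mult[symmetric]) auto
    then show "(\<phi> (p' e) - \<phi> (q' e)) * incidence p q e v =
        (\<Sum>w\<in>W. \<phi> w * (incidence p q e v * incidence p' q' e w))"
      by (simp add: sum_distrib_left sum_distrib_right mult_ac)
  qed
  also have "\<dots> = (\<Sum>w\<in>W. \<phi> w * (\<Sum>e\<in>E. incidence p q e v * incidence p' q' e w))"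
    unfolding sum_distrib_left by (rule sum.swap)
  also have "\<dots> = 0" using orthogonal_ring[OF assms, where 'r = 'r] by simp
  finally show ?thesis .
qed

text \<open>
  A cut of the dual graph that avoids \<open>E - T\<close> would be a non-zero circulation supported by the
  tree \<open>T\<close>.
\<close>

lemma complement_spanning_tree:
  assumes T: "spans_tree T p q V" "T \<subseteq> E"
  shows "spans_tree (E - T) p' q' W"
proof -
  note C = connectsD[OF conn] and C' = connectsD[OF conn']
  have "card (E - T) + 1 = card W"
    using spans_treeD(2)[OF T(1)] euler_count card_mono[OF C(1) T(2)] C(1) T(2)
    by (simp add: card_Diff_subset finite_subset)
  moreover have "\<exists>e\<in>E - T. crosses p' q' X e" if X: "X \<subseteq> W" "X \<noteq> {}" "X \<noteq> W" for X
  proof (rule ccontr)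
    assume "\<not> ?thesis"
    then have out: "\<not> crosses p' q' X e" if "e \<in> E - T" for e using that by blast
    define c :: "'e \<Rightarrow> int" where "c e = of_bool (p' e \<in> X) - of_bool (q' e \<in> X)" for e
    have "(\<Sum>e\<in>T. c e * incidence p q e v) = 0" if "v \<in> V" for v
    proof -
      have "(\<Sum>e\<in>T. c e * incidence p q e v) = (\<Sum>e\<in>E. c e * incidence p q e v)"
        using T(2) C(1) out by (intro sum.mono_neutral_left) (auto simp: c_def crosses_def)
      also have "\<dots> = 0"
        unfolding c_def by (rule coboundary_is_circulation[OF that])
      finally show ?thesis .
    qed
    then have "c e = 0" if "e \<in> T" for e using spans_tree_independent[OF T(1) that] by blast
    then have "\<not> crosses p' q' X e" if "e \<in> E" for e
      using out[of e] that unfolding c_def crosses_def of_bool_def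
      by (cases "e \<in> T"; cases "p' e \<in> X"; cases "q' e \<in> X") fastforce+
    then show False using C'(6)[OF X] by blast
  qed
  ultimately show ?thesis
    using C' by (auto simp: spans_tree_def connects_def)
qed

text \<open>
  On the complement of a spanning tree \<open>T\<close>, which is a tree of the dual graph, the circulation can be
  matched by a coboundary. Their difference is a circulation supported by \<open>T\<close>, hence zero.
\<close>

lemma circulation_is_coboundary:
  fixes c :: "'e \<Rightarrow> 'r::comm_ring_1"
  assumes circ: "\<And>v. v \<in> V \<Longrightarrow> (\<Sum>e\<in>E. c e * incidence p q e v) = 0" and "w0 \<in> W"
  shows "\<exists>\<phi>. \<phi> w0 = 0 \<and> (\<forall>e\<in>E. c e = \<phi> (p' e) - \<phi> (q' e))"
proof -
  obtain T where T: "T \<subseteq> E" "spans_tree T p q V" using spans_tree_exists[OF conn] by blast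
  obtain \<phi> where \<phi>: "\<phi> w0 = 0" "\<And>e. e \<in> E - T \<Longrightarrow> \<phi> (p' e) - \<phi> (q' e) = c e"
    using spans_tree_potential[OF complement_spanning_tree[OF T(2,1)] assms(2), of c] by blast
  define d where "d e = c e - (\<phi> (p' e) - \<phi> (q' e))" for e
  have "(\<Sum>e\<in>T. d e * incidence p q e v) = 0" if "v \<in> V" for v
  proof -
    have "(\<Sum>e\<in>T. d e * incidence p q e v) = (\<Sum>e\<in>E. d e * incidence p q e v)"
      using T(1) connectsD(1)[OF conn] \<phi>(2) by (intro sum.mono_neutral_left) (auto simp: d_def)
    also have "\<dots> = 0"
      using circ[OF that] coboundary_is_circulation[OF that, of \<phi>]
      by (simp add: d_def left_diff_distrib sum_subtractf)
    finally show ?thesis .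
  qed
  then have "d e = 0" if "e \<in> T" for e using spans_tree_independent[OF T(2) that] by blast
  then have "c e = \<phi> (p' e) - \<phi> (q' e)" if "e \<in> E" for e
    using \<phi>(2)[of e] that by (cases "e \<in> T") (auto simp: d_def)
  then show ?thesis using \<phi>(1) by blast
qed

end

section \<open>Plane hypermaps and the Laplacian of the dual\<close>

lemma idet_reindex_columns:
  assumes "finite I" "finite J" "card I = card J" "inj_on h J"
  shows "idet I (h ` J) M =\<^sub>\<plusminus> idet I J (\<lambda>i j. M i (h j))"
proof -
  note eI = bij_betw_from_nat_into_finite[OF assms(1)]
  note eJ = bij_betw_from_nat_into_finite[OF assms(2), folded assms(3)]
  have "bij_betw (h \<circ> from_nat_into J) {..<card I} (h ` J)"
    using eJ inj_on_imp_bij_betw[OF assms(4)] by (rule bij_betw_trans)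
  from det_enum_pm[OF eI this, of M] show ?thesis
    by (simp add: idet_def o_def pm_eq_sym)
qed

lemma idet_reindex_rows:
  assumes "finite I" "finite J" "card I = card J" "inj_on h I"
  shows "idet (h ` I) J M =\<^sub>\<plusminus> idet I J (\<lambda>i j. M (h i) j)"
  using idet_reindex_columns[of J I h "\<lambda>j i. M i j"] assms
  by (simp add: idet_transpose[of "h ` I" J M, symmetric] idet_transpose[of I J "\<lambda>i. M (h i)", symmetric] card_image)

text \<open>
  The data of a connected bipartite plane graph with edge set \<open>E\<close>: the edges after \<open>e\<close> in the
  counterclockwise order around its two ends \<open>a e\<close> and \<open>b e\<close> are \<open>\<alpha> e\<close> and \<open>\<beta> e\<close>, and the face to
  the right of \<open>e\<close>, directed from \<open>a e\<close> to \<open>b e\<close>, is \<open>R e\<close>. Connectedness is the transitivity of the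
  group generated by \<open>\<alpha>\<close> and \<open>\<beta>\<close>.
\<close>

locale plane_hypermap =
  fixes E :: "'e set" and \<alpha> \<beta> :: "'e \<Rightarrow> 'e" and a b :: "'e \<Rightarrow> 'v" and R :: "'e \<Rightarrow> 'f"
  assumes finite_E: "finite E" and nonempty: "E \<noteq> {}"
    and bij_\<alpha>: "bij_betw \<alpha> E E" and bij_\<beta>: "bij_betw \<beta> E E"
    and a_\<alpha>: "e \<in> E \<Longrightarrow> a (\<alpha> e) = a e"
    and b_\<beta>: "e \<in> E \<Longrightarrow> b (\<beta> e) = b e"
    and R_\<alpha>\<beta>: "e \<in> E \<Longrightarrow> R (\<alpha> (\<beta> e)) = R e"
    and transitive: "Y \<subseteq> E \<Longrightarrow> Y \<noteq> {} \<Longrightarrow> (\<And>e. e \<in> Y \<Longrightarrow> \<alpha> e \<in> Y) \<Longrightarrow> (\<And>e. e \<in> Y \<Longrightarrow> \<beta> e \<in> Y) \<Longrightarrow> Y = E"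
    and disjoint_sides: "a ` E \<inter> b ` E = {}"
    and euler: "card (a ` E) + card (b ` E) + card (R ` E) = card E + 2"
begin

definition L :: "'e \<Rightarrow> 'f" where "L e = R (\<alpha> e)"

abbreviation "VA \<equiv> a ` E"
abbreviation "VB \<equiv> b ` E"
abbreviation "F \<equiv> R ` E"
abbreviation "\<alpha>' \<equiv> inv_into E \<alpha>"

lemma \<alpha>_in: "e \<in> E \<Longrightarrow> \<alpha> e \<in> E" and \<beta>_in: "e \<in> E \<Longrightarrow> \<beta> e \<in> E"
  using bij_\<alpha> bij_\<beta> by (auto simp: bij_betw_def)

lemma L_\<beta>: "e \<in> E \<Longrightarrow> L (\<beta> e) = R e"
  by (simp add: L_def R_\<alpha>\<beta>)

lemma L_in: "e \<in> E \<Longrightarrow> L e \<in> F"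
  by (simp add: L_def \<alpha>_in)

lemma \<alpha>'_\<alpha>: "e \<in> E \<Longrightarrow> \<alpha>' (\<alpha> e) = e" and \<alpha>_\<alpha>': "e \<in> E \<Longrightarrow> \<alpha> (\<alpha>' e) = e" and \<alpha>'_in: "e \<in> E \<Longrightarrow> \<alpha>' e \<in> E"
  using bij_\<alpha> by (auto simp: bij_betw_def f_inv_into_f inv_into_into)

lemma sum_\<alpha>: "(\<Sum>e\<in>E. g (\<alpha> e)) = sum g E" and sum_\<beta>: "(\<Sum>e\<in>E. g (\<beta> e)) = sum g E"
  by (rule sum.reindex_bij_betw[OF bij_\<alpha>], rule sum.reindex_bij_betw[OF bij_\<beta>])

lemma sum_a_L: "(\<Sum>e\<in>E. of_bool (a e = v) * of_bool (L e = f)) = (\<Sum>e\<in>E. of_bool (a e = v) * of_bool (R e = f) :: 'r::comm_ring_1)"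
proof -
  have "(\<Sum>e\<in>E. of_bool (a e = v) * of_bool (L e = f) :: 'r) = (\<Sum>e\<in>E. of_bool (a (\<alpha> e) = v) * of_bool (R (\<alpha> e) = f))"
    by (intro sum.cong refl) (simp add: L_def a_\<alpha>)
  also have "\<dots> = (\<Sum>e\<in>E. of_bool (a e = v) * of_bool (R e = f))" by (rule sum_\<alpha>)
  finally show ?thesis .
qed

lemma sum_b_L: "(\<Sum>e\<in>E. of_bool (b e = v) * of_bool (L e = f)) = (\<Sum>e\<in>E. of_bool (b e = v) * of_bool (R e = f) :: 'r::comm_ring_1)"
proof -
  have "(\<Sum>e\<in>E. of_bool (b e = v) * of_bool (R e = f) :: 'r) = (\<Sum>e\<in>E. of_bool (b (\<beta> e) = v) * of_bool (L (\<beta> e) = f))"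
    by (intro sum.cong refl) (simp add: L_\<beta> b_\<beta>)
  also have "\<dots> = (\<Sum>e\<in>E. of_bool (b e = v) * of_bool (L e = f))" by (rule sum_\<beta>)
  finally show ?thesis by (rule sym)
qed

text \<open>
  If no edge crosses the cut \<open>X\<close>, then the edges with an end in \<open>X\<close> form a set that is closed
  under \<open>\<alpha>\<close> and \<open>\<beta>\<close>, so they are all or none.
\<close>

lemma connects_if_invariant:
  assumes V: "V = p ` E \<union> q ` E"
    and inv: "\<And>X e. (\<And>e. e \<in> E \<Longrightarrow> p e \<in> X \<longleftrightarrow> q e \<in> X) \<Longrightarrow> e \<in> E \<Longrightarrow> p e \<in> X \<Longrightarrow> p (\<alpha> e) \<in> X"
      "\<And>X e. (\<And>e. e \<in> E \<Longrightarrow> p e \<in> X \<longleftrightarrow> q e \<in> X) \<Longrightarrow> e \<in> E \<Longrightarrow> p e \<in> X \<Longrightarrow> p (\<beta> e) \<in> X"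
  shows "connects E p q V"
  unfolding connects_def
proof (intro conjI allI impI)
  fix X assume X: "X \<subseteq> V" "X \<noteq> {}" "X \<noteq> V"
  show "\<exists>e\<in>E. crosses p q X e"
  proof (rule ccontr)
    assume "\<not> (\<exists>e\<in>E. crosses p q X e)"
    then have eq: "p e \<in> X \<longleftrightarrow> q e \<in> X" if "e \<in> E" for e using that by (auto simp: crosses_def)
    let ?Y = "{e \<in> E. p e \<in> X}"
    have "?Y \<noteq> {}" using X(1,2) eq unfolding V by fastforce
    moreover have "\<alpha> e \<in> ?Y" if "e \<in> ?Y" for e using inv(1)[OF eq] that \<alpha>_in by simp
    moreover have "\<beta> e \<in> ?Y" if "e \<in> ?Y" for e using inv(2)[OF eq] that \<beta>_in by simp
    ultimately have "?Y = E" by (intro transitive) auto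
    then have "V \<subseteq> X" using eq unfolding V by blast
    then show False using X by blast
  qed
qed (use finite_E nonempty V in auto)

lemma connects_graph: "connects E a b (VA \<union> VB)"
proof (rule connects_if_invariant[OF refl])
  fix X e assume eq: "\<And>e. e \<in> E \<Longrightarrow> a e \<in> X \<longleftrightarrow> b e \<in> X" and e: "e \<in> E" "a e \<in> X"
  then show "a (\<alpha> e) \<in> X" "a (\<beta> e) \<in> X" by (simp_all add: a_\<alpha> b_\<beta> \<beta>_in)
qed

lemma connects_dual: "connects E L R F"
proof (rule connects_if_invariant)
  show "F = L ` E \<union> R ` E" using L_in by auto
  fix X e assume eq: "\<And>e. e \<in> E \<Longrightarrow> L e \<in> X \<longleftrightarrow> R e \<in> X" and e: "e \<in> E" "L e \<in> X"
  then show "L (\<alpha> e) \<in> X" "L (\<beta> e) \<in> X"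
    using eq[OF \<alpha>_in[OF e(1)]] eq[OF e(1)] by (simp_all add: L_\<beta>) (simp add: L_def)
qed

lemma connects_side_b: "connects E b (b \<circ> \<alpha>') VB"
proof (rule connects_if_invariant)
  show "VB = b ` E \<union> (b \<circ> \<alpha>') ` E" using \<alpha>'_in by auto
  fix X e assume eq: "\<And>e. e \<in> E \<Longrightarrow> b e \<in> X \<longleftrightarrow> (b \<circ> \<alpha>') e \<in> X" and e: "e \<in> E" "b e \<in> X"
  then show "b (\<alpha> e) \<in> X" "b (\<beta> e) \<in> X"
    using eq[OF \<alpha>_in[OF e(1)]] by (simp_all add: \<alpha>'_\<alpha> b_\<beta>)
qed

lemma connects_side_a: "connects E a (a \<circ> \<beta>) VA"
proof (rule connects_if_invariant)
  show "VA = a ` E \<union> (a \<circ> \<beta>) ` E" using \<beta>_in by auto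
  fix X e assume eq: "\<And>e. e \<in> E \<Longrightarrow> a e \<in> X \<longleftrightarrow> (a \<circ> \<beta>) e \<in> X" and e: "e \<in> E" "a e \<in> X"
  then show "a (\<alpha> e) \<in> X" "a (\<beta> e) \<in> X"
    using eq[OF e(1)] by (simp_all add: a_\<alpha>)
qed

lemma connects_face_a: "connects E (Inl \<circ> R) (Inr \<circ> a) (F <+> VA)"
proof (rule connects_if_invariant)
  show "F <+> VA = (Inl \<circ> R) ` E \<union> (Inr \<circ> a) ` E" by (auto simp: Plus_def image_comp[symmetric])
  fix X e assume eq: "\<And>e. e \<in> E \<Longrightarrow> (Inl \<circ> R) e \<in> X \<longleftrightarrow> (Inr \<circ> a) e \<in> X" and e: "e \<in> E" "(Inl \<circ> R) e \<in> X"
  then show "(Inl \<circ> R) (\<alpha> e) \<in> X" "(Inl \<circ> R) (\<beta> e) \<in> X"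
    using eq[OF e(1)] eq[OF \<alpha>_in[OF e(1)]] eq[OF \<beta>_in[OF e(1)]] eq[OF \<alpha>_in[OF \<beta>_in[OF e(1)]]]
    by (simp_all add: a_\<alpha> R_\<alpha>\<beta> \<beta>_in)
qed

lemma connects_face_b: "connects E (Inl \<circ> R) (Inr \<circ> b) (F <+> VB)"
proof (rule connects_if_invariant)
  show "F <+> VB = (Inl \<circ> R) ` E \<union> (Inr \<circ> b) ` E" by (auto simp: Plus_def image_comp[symmetric])
  fix X e assume eq: "\<And>e. e \<in> E \<Longrightarrow> (Inl \<circ> R) e \<in> X \<longleftrightarrow> (Inr \<circ> b) e \<in> X" and e: "e \<in> E" "(Inl \<circ> R) e \<in> X"
  then show "(Inl \<circ> R) (\<beta> e) \<in> X"
    using eq[OF e(1)] eq[OF \<beta>_in[OF e(1)]] by (simp add: b_\<beta>)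
  obtain e' where e': "e' \<in> E" "e = \<beta> e'" using bij_\<beta> e(1) by (auto simp: bij_betw_def)
  then show "(Inl \<circ> R) (\<alpha> e) \<in> X"
    using eq[OF e(1)] eq[OF e'(1)] e(2) by (simp add: b_\<beta> R_\<alpha>\<beta>)
qed

text \<open>
  The graph and its planar dual, whose edge across \<open>e\<close> runs from \<open>R e\<close> to \<open>L e\<close>. They are
  orthogonal because a face lies to the left of as many edges at a vertex as to the right.
\<close>

sublocale graph_dual: dual_multigraphs E a b "VA \<union> VB" L R F
proof (unfold_locales)
  show "connects E a b (VA \<union> VB)" "connects E L R F" by (rule connects_graph connects_dual)+
  show "(\<Sum>e\<in>E. incidence a b e v * incidence L R e f) = (0 :: int)" for v f
    by (simp add: incidence_def algebra_simps sum.distrib sum_subtractf sum_a_L sum_b_L)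
  show "card (VA \<union> VB) + card F = card E + 2"
    using euler disjoint_sides finite_E by (simp add: card_Un_disjoint)
qed

text \<open>
  The corners of the faces at the vertices on the side of \<open>a\<close> are also indexed by \<open>E\<close>: the
  corner before \<open>e\<close> lies in the face \<open>R e\<close>, at the vertex \<open>a e\<close>. These corners are the edges of a plane
  graph that joins faces and vertices. The dual edge of such a corner cuts it off, from \<open>b e\<close>
  to the end \<open>b (\<alpha>' e)\<close> of the preceding edge.
\<close>

sublocale side_b: dual_multigraphs E b "b \<circ> \<alpha>'" VB "Inl \<circ> R" "Inr \<circ> a" "F <+> VA"
proof (unfold_locales)
  show "connects E b (b \<circ> \<alpha>') VB" "connects E (Inl \<circ> R) (Inr \<circ> a) (F <+> VA)"
    by (rule connects_side_b connects_face_a)+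
  have 1: "(\<Sum>e\<in>E. of_bool (b (\<alpha>' e) = v) * g e) = (\<Sum>e\<in>E. of_bool (b e = v) * g (\<alpha> e) :: int)" for v g
    using sum_\<alpha>[of "\<lambda>e. of_bool (b (\<alpha>' e) = v) * g e"] by (simp add: \<alpha>'_\<alpha> cong: sum.cong)
  show "(\<Sum>e\<in>E. incidence b (b \<circ> \<alpha>') e v * incidence (Inl \<circ> R) (Inr \<circ> a) e w) = (0 :: int)" for v w
  proof (cases w)
    case (Inl f)
    then show ?thesis
      using sum_b_L[of v f, where 'r = int] by (simp add: incidence_def left_diff_distrib sum_subtractf 1 L_def)
  next
    case (Inr u)
    then show ?thesis
      by (simp add: incidence_def left_diff_distrib sum_subtractf sum_negf 1 a_\<alpha> cong: sum.cong)
  qed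
  show "card VB + card (F <+> VA) = card E + 2"
    using euler finite_E by (simp add: card_Plus)
qed

text \<open>
  The analogous pair for the corners at the vertices on the side of \<open>b\<close>: the corner in the face
  \<open>R e\<close> at \<open>b e\<close> lies between \<open>e\<close> and \<open>\<beta> e\<close>.
\<close>

sublocale side_a: dual_multigraphs E a "a \<circ> \<beta>" VA "Inl \<circ> R" "Inr \<circ> b" "F <+> VB"
proof (unfold_locales)
  show "connects E a (a \<circ> \<beta>) VA" "connects E (Inl \<circ> R) (Inr \<circ> b) (F <+> VB)"
    by (rule connects_side_a connects_face_b)+
  have 1: "(\<Sum>e\<in>E. of_bool (a (\<beta> e) = v) * of_bool (R e = f)) = (\<Sum>e\<in>E. of_bool (a e = v) * of_bool (R e = f) :: int)" for v f
  proof -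
    have "(\<Sum>e\<in>E. of_bool (a (\<beta> e) = v) * of_bool (R e = f) :: int) = (\<Sum>e\<in>E. of_bool (a (\<beta> e) = v) * of_bool (L (\<beta> e) = f))"
      by (intro sum.cong refl) (simp add: L_\<beta>)
    also have "\<dots> = (\<Sum>e\<in>E. of_bool (a e = v) * of_bool (L e = f))" by (rule sum_\<beta>)
    also have "\<dots> = (\<Sum>e\<in>E. of_bool (a e = v) * of_bool (R e = f))" by (rule sum_a_L)
    finally show ?thesis .
  qed
  have 2: "(\<Sum>e\<in>E. of_bool (a (\<beta> e) = v) * of_bool (b e = u)) = (\<Sum>e\<in>E. of_bool (a e = v) * of_bool (b e = u) :: int)" for v u
    using sum_\<beta>[of "\<lambda>e. of_bool (a e = v) * of_bool (b e = u) :: int"] by (simp add: b_\<beta> cong: sum.cong)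
  show "(\<Sum>e\<in>E. incidence a (a \<circ> \<beta>) e v * incidence (Inl \<circ> R) (Inr \<circ> b) e w) = (0 :: int)" for v w
    by (cases w) (simp_all add: incidence_def left_diff_distrib sum_subtractf sum_negf 1 2)
  show "card VA + card (F <+> VB) = card E + 2"
    using euler finite_E by (simp add: card_Plus)
qed

end

text \<open>
  The stars of all but one vertex of the second graph together with the unit vectors of the tree
  \<open>T\<close> of the first graph form a basis of the lattice of functions on \<open>E\<close>: modulo the unit vectors,
  what is left is the reduced incidence matrix of the complementary tree.
\<close>

lemma (in dual_multigraphs) idet_extended_incidence:
  assumes T: "spans_tree T p q V" "T \<subseteq> E" and "w0 \<in> W"
  shows "idet E (Inl ` (W - {w0}) \<union> Inr ` T)
    (\<lambda>e j. case j of Inl w \<Rightarrow> incidence p' q' e w | Inr e' \<Rightarrow> of_bool (e = e')) =\<^sub>\<plusminus> (1 :: 'r::{idom,ring_char_0})"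
    (is "idet E ?J ?M =\<^sub>\<plusminus> 1")
proof -
  note tree = complement_spanning_tree[OF T]
  have fin: "finite E" "finite T" "finite W" using connectsD(1,2)[OF conn'] connectsD(1)[OF conn] T(2) by (auto intro: finite_subset)
  have card: "card (E - T) = card (W - {w0})"
    using spans_treeD(2)[OF tree] assms(3) fin by simp
  have E: "E = (E - T) \<union> T" using T(2) by blast
  have block: "idet ((E - T) \<union> T) ?J ?M =\<^sub>\<plusminus> idet (E - T) (Inl ` (W - {w0})) ?M * idet T (Inr ` T) ?M"
    using fin card by (intro idet_block) (auto simp: card_image)
  have "idet (E - T) (Inl ` (W - {w0})) ?M =\<^sub>\<plusminus> idet (E - T) (W - {w0}) (incidence p' q')"
    using idet_reindex_columns[of "E - T" "W - {w0}" Inl ?M] fin card by simp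
  also have "\<dots> =\<^sub>\<plusminus> 1"
    by (rule spans_tree_unimodular[OF tree assms(3)])
  finally have 1: "idet (E - T) (Inl ` (W - {w0})) ?M =\<^sub>\<plusminus> 1" .
  have 2: "idet T (Inr ` T) ?M =\<^sub>\<plusminus> 1"
    using idet_reindex_columns[of T T Inr ?M] fin by (simp add: idet_id)
  show ?thesis
    using pm_eq_trans[OF block pm_eq_mult[OF 1 2]] by (subst E) simp
qed

context plane_hypermap
begin

text \<open>
  At every edge one hops to \<open>\<beta> e\<close> with weight 1 or to \<open>\<alpha> e\<close> with weight \<open>\<tau>\<close>. The matrix without its
  last term annihilates constants from both sides; with the last term, its determinant is
  the minor omitting row and column \<open>e0\<close>.
\<close>

definition hop :: "'r::comm_ring_1 \<Rightarrow> 'e \<Rightarrow> 'e \<Rightarrow> 'e \<Rightarrow> 'r" where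
  "hop \<tau> e0 e e' = (1 + \<tau>) * of_bool (e = e') - of_bool (\<beta> e = e') - \<tau> * of_bool (\<alpha> e = e')
     + of_bool (e = e0) * of_bool (e' = e0)"

text \<open>
  The Laplacian of the dual, where the edge from \<open>R e\<close> to \<open>L e\<close> has weight \<open>\<tau>\<close> in this direction and
  weight 1 in the opposite one, grounded at \<open>f0\<close>. The diagonal can be written with right faces
  alone since the dual is alternating: a face is on the left of as many edges as on the right.
\<close>

definition dual_laplacian :: "'r::comm_ring_1 \<Rightarrow> 'f \<Rightarrow> 'f \<Rightarrow> 'f \<Rightarrow> 'r" where
  "dual_laplacian \<tau> f0 f g =
     (\<Sum>e\<in>E. of_bool (R e = f) * ((1 + \<tau>) * of_bool (R e = g) - \<tau> * of_bool (L e = g))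
       - of_bool (L e = f) * of_bool (R e = g)) + of_bool (f = f0) * of_bool (g = f0)"

lemma hop_apply:
  assumes "e0 \<in> E" "e \<in> E"
  shows "(\<Sum>e'\<in>E. hop \<tau> e0 e e' * y e') = (1 + \<tau>) * y e - y (\<beta> e) - \<tau> * y (\<alpha> e) + of_bool (e = e0) * y e0"
proof -
  have 1: "(\<Sum>e'\<in>E. c * of_bool (x = e') * y e') = c * y x" "(\<Sum>e'\<in>E. c * of_bool (e' = x) * y e') = c * y x" if "x \<in> E" for x c
    using that finite_E by (simp_all add: of_bool_def if_distrib[of "\<lambda>z. _ * z"] if_distrib[of "\<lambda>z. z * _"] sum.delta cong: if_cong)
  show ?thesis
    using assms 1[of _ 1] 1[of e0 "of_bool (e = e0)"] \<alpha>_in \<beta>_in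
    by (simp add: hop_def left_diff_distrib distrib_right sum.distrib sum_subtractf 1 del: sum_mult_of_bool_eq sum_of_bool_mult_eq)
qed

text \<open>
  \<open>P\<close> is the matrix of \<open>hop\<close> with respect to two unimodular systems of functions on \<open>E\<close>: the columns
  \<open>Yr\<close> are functions of the right face, functions of the \<open>a\<close>-end and unit vectors; the rows \<open>Yl\<close>
  are functions of the right face, functions of the \<open>b\<close>-end and unit vectors. On functions of
  \<open>a e\<close> the hops to \<open>\<alpha> e\<close> have no effect, and tested against functions of \<open>b e\<close> the hops to \<open>\<beta> e\<close>
  have none. By the orthogonality relations of the dualities this makes \<open>P\<close> block triangular, and
  on the functions of the right face the Laplacian of the dual appears.
\<close>

theorem idet_hop:
  fixes \<tau> :: "'r::{idom,ring_char_0}"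
  assumes e0: "e0 \<in> E"
  shows "idet E E (hop \<tau> e0) =\<^sub>\<plusminus> \<tau> ^ (card VB - 1) * idet F F (dual_laplacian \<tau> (R e0))"
proof -
  obtain Z where Z: "Z \<subseteq> E" "spans_tree Z b (b \<circ> \<alpha>') VB"
    using spans_tree_exists[OF connects_side_b] by blast
  obtain Z' where Z': "Z' \<subseteq> E" "spans_tree Z' a (a \<circ> \<beta>) VA"
    using spans_tree_exists[OF connects_side_a] by blast
  have fin: "finite Z" "finite Z'" using Z Z' finite_E finite_subset by blast+
  have cardZ: "card Z = card VB - 1" "card Z' = card VA - 1" "card (VB - {b e0}) = card Z" "card (VA - {a e0}) = card Z'"
    using spans_treeD(2)[OF Z(2)] spans_treeD(2)[OF Z'(2)] e0 finite_E by simp_all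
  define Yr :: "'e \<Rightarrow> ('f + 'v) + 'e \<Rightarrow> 'r" where
    "Yr e j = (case j of Inl w \<Rightarrow> incidence (Inl \<circ> R) (Inr \<circ> a) e w | Inr e' \<Rightarrow> of_bool (e = e'))" for e j
  define Yl :: "'e \<Rightarrow> ('f + 'v) + 'e \<Rightarrow> 'r" where
    "Yl e j = (case j of Inl w \<Rightarrow> incidence (Inl \<circ> R) (Inr \<circ> b) e w | Inr e' \<Rightarrow> of_bool (e = e'))" for e j
  let ?Jr = "Inl ` ((F <+> VA) - {Inr (a e0)}) \<union> Inr ` Z"
  let ?Jl = "Inl ` ((F <+> VB) - {Inr (b e0)}) \<union> Inr ` Z'"
  define P where "P i j = (\<Sum>e\<in>E. Yl e i * (\<Sum>e'\<in>E. hop \<tau> e0 e e' * Yr e' j))" for i j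
  have Yr: "idet E ?Jr Yr =\<^sub>\<plusminus> 1"
    unfolding Yr_def[abs_def] by (rule side_b.idet_extended_incidence[OF Z(2,1)]) (use e0 in auto)
  have Yl: "idet E ?Jl Yl =\<^sub>\<plusminus> 1"
    unfolding Yl_def[abs_def] by (rule side_a.idet_extended_incidence[OF Z'(2,1)]) (use e0 in auto)
  have Jr: "?Jr = (Inl ` Inl ` F \<union> Inl ` Inr ` (VA - {a e0})) \<union> Inr ` Z"
    by (auto simp: Plus_def)
  have Jl: "?Jl = Inl ` Inr ` (VB - {b e0}) \<union> (Inl ` Inl ` F \<union> Inr ` Z')"
    by (auto simp: Plus_def)
  have card_Jr: "card ?Jr = card E"
  proof -
    have "card ?Jr = card F + card (VA - {a e0}) + card Z"
      unfolding Jr using fin finite_E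
      by (subst card_Un_disjoint; force?) (subst card_Un_disjoint; force simp: card_image)+
    also have "\<dots> = card E"
      using euler spans_treeD(2)[OF Z(2)] spans_treeD(2)[OF Z'(2)] cardZ by simp
    finally show ?thesis .
  qed
  have card_Jl: "card ?Jl = card E"
  proof -
    have "card ?Jl = card (VB - {b e0}) + (card F + card Z')"
      unfolding Jl using fin finite_E
      by (subst card_Un_disjoint; force?) (subst card_Un_disjoint; force simp: card_image)+
    also have "\<dots> = card E"
      using euler spans_treeD(2)[OF Z(2)] spans_treeD(2)[OF Z'(2)] cardZ by simp
    finally show ?thesis .
  qed
  have "idet ?Jl ?Jr P = idet ?Jl E (\<lambda>i e. Yl e i) * (idet E E (hop \<tau> e0) * idet E ?Jr Yr)"
    unfolding P_def using finite_E card_Jr card_Jl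
    by (subst idet_mult, simp_all, subst idet_mult, simp_all)
  also have "idet ?Jl E (\<lambda>i e. Yl e i) = idet E ?Jl Yl"
    using idet_transpose[of E ?Jl Yl] card_Jl by simp
  finally have 1: "idet ?Jl ?Jr P =\<^sub>\<plusminus> idet E E (hop \<tau> e0)"
    using Yl Yr by (auto simp: pm_eq_def)
  have apply_hop: "P i j = (\<Sum>e\<in>E. Yl e i * ((1 + \<tau>) * Yr e j - Yr (\<beta> e) j - \<tau> * Yr (\<alpha> e) j + of_bool (e = e0) * Yr e0 j))" for i j
    unfolding P_def using e0 by (intro sum.cong refl) (simp add: hop_apply)
  \<comment> \<open>the hops to \<open>\<beta> e\<close> drop out of the rows of the \<open>b\<close>-ends\<close>
  have P_b: "P (Inl (Inr v)) j = - (\<tau> * (\<Sum>e\<in>E. of_bool (b e = v) * (Yr e j - Yr (\<alpha> e) j)))"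
    if v: "v \<noteq> b e0" for v j
  proof -
    have \<beta>: "(\<Sum>e\<in>E. of_bool (b e = v) * Yr (\<beta> e) j) = (\<Sum>e\<in>E. of_bool (b e = v) * Yr e j)"
      using sum_\<beta>[of "\<lambda>e. of_bool (b e = v) * Yr e j"] by (simp add: b_\<beta> cong: sum.cong)
    have "P (Inl (Inr v)) j = (\<Sum>e\<in>E. of_bool (b e = v) * Yr (\<beta> e) j - of_bool (b e = v) * Yr e j
        - \<tau> * (of_bool (b e = v) * (Yr e j - Yr (\<alpha> e) j)))"
      unfolding apply_hop using v by (intro sum.cong refl) (auto simp: Yl_def incidence_def algebra_simps)
    then show ?thesis using \<beta> by (simp add: sum_subtractf sum_distrib_left)
  qed
  \<comment> \<open>the hops to \<open>\<alpha> e\<close> drop out of the columns of the \<open>a\<close>-ends\<close>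
  have col_a: "(1 + \<tau>) * Yr e (Inl (Inr u)) - Yr (\<beta> e) (Inl (Inr u)) - \<tau> * Yr (\<alpha> e) (Inl (Inr u))
      + of_bool (e = e0) * Yr e0 (Inl (Inr u)) = - incidence a (a \<circ> \<beta>) e u"
    if "u \<noteq> a e0" "e \<in> E" for u e
    using that by (simp add: Yr_def incidence_def a_\<alpha> algebra_simps)
  have P_a0: "P (Inl w) (Inl (Inr u)) = 0" if u: "u \<in> VA - {a e0}" and w: "w \<in> F <+> VB" for w u
  proof -
    have "P (Inl w) (Inl (Inr u)) = - (\<Sum>e\<in>E. incidence a (a \<circ> \<beta>) e u * incidence (Inl \<circ> R) (Inr \<circ> b) e w)"
      unfolding apply_hop using u by (simp add: col_a Yl_def sum_negf mult.commute)
    then show ?thesis using side_a.orthogonal_ring[of u w, where 'r = 'r] u w by simp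
  qed
  have P_af: "P (Inl (Inr v)) (Inl (Inl g)) = 0" if "v \<noteq> b e0" for v g
    using sum_b_L[of v g, where 'r = 'r]
    by (simp add: P_b[OF that] Yr_def incidence_def right_diff_distrib sum_subtractf L_def[symmetric])
  have P_bz: "P (Inl (Inr v)) (Inr z) = (- \<tau>) * incidence b (b \<circ> \<alpha>') z v" if v: "v \<noteq> b e0" and z: "z \<in> Z" for v z
  proof -
    have zE: "z \<in> E" using z Z(1) by blast
    have \<alpha>z: "\<alpha> e = z \<longleftrightarrow> e = \<alpha>' z" if "e \<in> E" for e using \<alpha>'_\<alpha>[OF that] \<alpha>_\<alpha>'[OF zE] by metis
    have "(\<Sum>e\<in>E. of_bool (b e = v) * (Yr e (Inr z) - Yr (\<alpha> e) (Inr z))) =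
        (\<Sum>e\<in>E. (if e = z then of_bool (b z = v) else 0) - (if e = \<alpha>' z then of_bool (b (\<alpha>' z) = v) else 0))"
      by (intro sum.cong refl) (auto simp: Yr_def \<alpha>z)
    also have "\<dots> = incidence b (b \<circ> \<alpha>') z v"
      using zE \<alpha>'_in[OF zE] finite_E by (simp add: sum_subtractf incidence_def)
    finally show ?thesis by (simp add: P_b[OF v])
  qed
  have P_wa: "P (Inr w) (Inl (Inr u)) = - incidence a (a \<circ> \<beta>) w u" if u: "u \<noteq> a e0" and w: "w \<in> Z'" for w u
  proof -
    have "P (Inr w) (Inl (Inr u)) = (\<Sum>e\<in>E. if e = w then - incidence a (a \<circ> \<beta>) w u else 0)"
      unfolding apply_hop using col_a[OF u] by (intro sum.cong refl) (auto simp: Yl_def)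
    then show ?thesis using w Z'(1) finite_E by (auto simp: sum.delta)
  qed
  have P_ff: "P (Inl (Inl f)) (Inl (Inl g)) = dual_laplacian \<tau> (R e0) f g" for f g
  proof -
    have "(\<Sum>e\<in>E. of_bool (R e = f) * of_bool (R (\<beta> e) = g) :: 'r) = (\<Sum>e\<in>E. of_bool (L (\<beta> e) = f) * of_bool (R (\<beta> e) = g))"
      by (intro sum.cong refl) (simp add: L_\<beta>)
    also have "\<dots> = (\<Sum>e\<in>E. of_bool (L e = f) * of_bool (R e = g))" by (rule sum_\<beta>)
    finally have \<beta>: "(\<Sum>e\<in>E. of_bool (R e = f) * of_bool (R (\<beta> e) = g) :: 'r) = (\<Sum>e\<in>E. of_bool (L e = f) * of_bool (R e = g))" .
    have "P (Inl (Inl f)) (Inl (Inl g)) = (\<Sum>e\<in>E.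
        of_bool (R e = f) * ((1 + \<tau>) * of_bool (R e = g) - \<tau> * of_bool (L e = g))
        - of_bool (R e = f) * of_bool (R (\<beta> e) = g) + (if e = e0 then of_bool (R e0 = f) * of_bool (R e0 = g) else 0))"
      unfolding apply_hop by (intro sum.cong refl) (auto simp: Yl_def Yr_def incidence_def L_def algebra_simps)
    also have "\<dots> = dual_laplacian \<tau> (R e0) f g"
      using e0 finite_E \<beta> by (simp add: dual_laplacian_def sum.distrib sum_subtractf eq_commute)
    finally show ?thesis .
  qed
  have finP: "finite (VB - {b e0})" "finite (VA - {a e0})" "finite F" using finite_E by auto
  have "idet ?Jl ?Jr P =\<^sub>\<plusminus> idet (Inl ` Inr ` (VB - {b e0})) (Inr ` Z) P *
      idet (Inl ` Inl ` F \<union> Inr ` Z') (Inl ` Inl ` F \<union> Inl ` Inr ` (VA - {a e0})) P"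
    unfolding Jl Jr Un_commute[of "Inl ` Inl ` F \<union> Inl ` Inr ` (VA - {a e0})" "Inr ` Z"]
  proof (rule idet_block)
    show "card (Inl ` Inl ` F \<union> Inr ` Z') = card (Inl ` Inl ` F \<union> Inl ` Inr ` (VA - {a e0}))"
      using fin finP cardZ by (subst (1 2) card_Un_disjoint) (auto simp: card_image inj_on_def)
    show "P i j = 0" if "i \<in> Inl ` Inr ` (VB - {b e0})" "j \<in> Inl ` Inl ` F \<union> Inl ` Inr ` (VA - {a e0})" for i j
      using that P_a0 P_af by auto
  qed (use fin finP cardZ in \<open>auto simp: card_image inj_on_def\<close>)
  moreover have "idet (Inl ` Inl ` F \<union> Inr ` Z') (Inl ` Inl ` F \<union> Inl ` Inr ` (VA - {a e0})) P =\<^sub>\<plusminus>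
      idet (Inl ` Inl ` F) (Inl ` Inl ` F) P * idet (Inr ` Z') (Inl ` Inr ` (VA - {a e0})) P"
  proof (rule idet_block)
    show "P i j = 0" if "i \<in> Inl ` Inl ` F" "j \<in> Inl ` Inr ` (VA - {a e0})" for i j
      using that P_a0 by auto
  qed (use fin finP cardZ in \<open>auto simp: card_image inj_on_def\<close>)
  moreover have "idet (Inl ` Inr ` (VB - {b e0})) (Inr ` Z) P =\<^sub>\<plusminus> \<tau> ^ (card VB - 1)"
  proof -
    have "idet ((Inl \<circ> Inr) ` (VB - {b e0})) (Inr ` Z) P =\<^sub>\<plusminus> idet (VB - {b e0}) (Inr ` Z) (\<lambda>v. P ((Inl \<circ> Inr) v))"
      using fin finP cardZ by (intro idet_reindex_rows) (auto simp: card_image inj_on_def)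
    also have "\<dots> =\<^sub>\<plusminus> idet (VB - {b e0}) Z (\<lambda>v z. P ((Inl \<circ> Inr) v) (Inr z))"
      using fin finP cardZ by (intro idet_reindex_columns) (auto simp: card_image inj_on_def)
    also have "\<dots> = idet (VB - {b e0}) Z (\<lambda>v z. (- \<tau>) * incidence b (b \<circ> \<alpha>') z v)"
      using fin finP cardZ by (intro idet_cong) (simp_all add: P_bz)
    also have "\<dots> = (- \<tau>) ^ card Z * idet (VB - {b e0}) Z (\<lambda>v z. incidence b (b \<circ> \<alpha>') z v)"
      unfolding idet_scale cardZ(3) ..
    also have "idet (VB - {b e0}) Z (\<lambda>v z. incidence b (b \<circ> \<alpha>') z v :: 'r) = idet Z (VB - {b e0}) (incidence b (b \<circ> \<alpha>'))"
      using cardZ by (intro idet_transpose) simp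
    also have "(- \<tau>) ^ card Z * idet Z (VB - {b e0}) (incidence b (b \<circ> \<alpha>')) =\<^sub>\<plusminus> \<tau> ^ card Z * 1"
      using e0 by (intro pm_eq_mult spans_tree_unimodular[OF Z(2)])
        (auto simp: pm_eq_def power_minus[of \<tau>] minus_one_power_iff)
    finally show ?thesis using cardZ by (simp add: image_comp)
  qed
  moreover have "idet (Inl ` Inl ` F) (Inl ` Inl ` F) P =\<^sub>\<plusminus> idet F F (dual_laplacian \<tau> (R e0))"
  proof -
    have "idet ((Inl \<circ> Inl) ` F) ((Inl \<circ> Inl) ` F) P =\<^sub>\<plusminus> idet F ((Inl \<circ> Inl) ` F) (\<lambda>v. P ((Inl \<circ> Inl) v))"
      using fin finP by (intro idet_reindex_rows) (auto simp: card_image inj_on_def)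
    also have "\<dots> =\<^sub>\<plusminus> idet F F (\<lambda>v z. P ((Inl \<circ> Inl) v) ((Inl \<circ> Inl) z))"
      using fin finP by (intro idet_reindex_columns) (auto simp: card_image inj_on_def)
    also have "\<dots> = idet F F (dual_laplacian \<tau> (R e0))"
      using fin finP by (intro idet_cong) (simp_all add: P_ff)
    finally show ?thesis by (simp add: image_comp)
  qed
  moreover have "idet (Inr ` Z') (Inl ` Inr ` (VA - {a e0})) P =\<^sub>\<plusminus> 1"
  proof -
    have "idet (Inr ` Z') ((Inl \<circ> Inr) ` (VA - {a e0})) P =\<^sub>\<plusminus> idet Z' ((Inl \<circ> Inr) ` (VA - {a e0})) (\<lambda>w. P (Inr w))"
      using fin finP cardZ by (intro idet_reindex_rows) (auto simp: card_image inj_on_def)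
    also have "\<dots> =\<^sub>\<plusminus> idet Z' (VA - {a e0}) (\<lambda>w u. P (Inr w) ((Inl \<circ> Inr) u))"
      using fin finP cardZ by (intro idet_reindex_columns) (auto simp: card_image inj_on_def)
    also have "\<dots> = idet Z' (VA - {a e0}) (\<lambda>w u. (- 1) * incidence a (a \<circ> \<beta>) w u)"
      using fin finP cardZ by (intro idet_cong) (simp_all add: P_wa)
    also have "\<dots> = (- 1) ^ card Z' * idet Z' (VA - {a e0}) (incidence a (a \<circ> \<beta>))"
      by (rule idet_scale)
    also have "\<dots> =\<^sub>\<plusminus> 1 * 1"
      using e0 by (intro pm_eq_mult spans_tree_unimodular[OF Z'(2)])
        (auto simp: pm_eq_def minus_one_power_iff)
    finally show ?thesis by (simp add: image_comp)
  qed
  ultimately have "idet ?Jl ?Jr P =\<^sub>\<plusminus> \<tau> ^ (card VB - 1) * (idet F F (dual_laplacian \<tau> (R e0)) * 1)"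
    by (meson pm_eq_mult pm_eq_trans)
  then show ?thesis using pm_eq_trans[OF pm_eq_sym[OF 1]] by simp
qed

end

section \<open>The matrix-tree theorem for the dual\<close>

text \<open>
  If all walks along \<open>g\<close> stop, their lengths are a rank with respect to which the matrix is
  triangular. Otherwise the indicator function of the set of all points with an infinite walk lies
  in the kernel.
\<close>

lemma idet_functional_graph:
  fixes g :: "'f \<Rightarrow> 'f option"
  assumes fin: "finite F" and closed: "\<And>f h. f \<in> F \<Longrightarrow> g f = Some h \<Longrightarrow> h \<in> F"
  shows "idet F F (\<lambda>f h. of_bool (f = h) - of_bool (g f = Some h)) =
    (of_bool (\<exists>r :: 'f \<Rightarrow> nat. \<forall>f\<in>F. \<forall>h. g f = Some h \<longrightarrow> r h < r f) :: 'r::idom)"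
proof (cases "\<exists>r :: 'f \<Rightarrow> nat. \<forall>f\<in>F. \<forall>h. g f = Some h \<longrightarrow> r h < r f")
  case True
  then obtain r :: "'f \<Rightarrow> nat" where r: "\<And>f h. f \<in> F \<Longrightarrow> g f = Some h \<Longrightarrow> r h < r f" by blast
  have "idet F F (\<lambda>f h. of_bool (f = h) - of_bool (g f = Some h)) = (1 :: 'r)"
  proof (rule idet_rank_triangular[where r = r])
    fix f h assume "f \<in> F" "h \<in> F"
    show "of_bool (f = f) - of_bool (g f = Some f) = (1 :: 'r)"
      using r[OF \<open>f \<in> F\<close>, of f] by auto
    show "r h < r f" if "f \<noteq> h" "of_bool (f = h) - of_bool (g f = Some h) \<noteq> (0 :: 'r)"
      using that r[OF \<open>f \<in> F\<close>, of h] by (auto split: if_splits)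
  qed (rule fin)
  then show ?thesis using True by simp
next
  case False
  \<comment> \<open>\<open>ends n f\<close>: the walk from \<open>f\<close> stops after exactly \<open>n\<close> steps\<close>
  define ends :: "nat \<Rightarrow> 'f \<Rightarrow> bool" where
    "ends = rec_nat (\<lambda>f. g f = None) (\<lambda>_ P f. \<exists>h. g f = Some h \<and> P h)"
  have ends: "ends 0 f \<longleftrightarrow> g f = None" "ends (Suc n) f \<longleftrightarrow> (\<exists>h. g f = Some h \<and> ends n h)" for n f
    by (simp_all add: ends_def)
  have unique: "ends n f \<Longrightarrow> ends m f \<Longrightarrow> n = m" for n m f
  proof (induction n arbitrary: m f)
    case 0 then show ?case by (cases m) (auto simp: ends)
  next
    case (Suc n) then show ?case by (cases m) (auto simp: ends)
  qed
  define X where "X = {f \<in> F. \<nexists>n. ends n f}"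
  have "X \<noteq> {}"
  proof
    assume "X = {}"
    then have ex: "\<exists>n. ends n f" if "f \<in> F" for f using that by (auto simp: X_def)
    define r where "r f = (SOME n. ends n f)" for f
    have r: "r f = n" if "ends n f" for n f
      unfolding r_def using someI[of "\<lambda>n. ends n f", OF that] unique that by blast
    have "r h < r f" if f: "f \<in> F" "g f = Some h" for f h
    proof -
      obtain n where n: "ends n h" using ex closed[OF f] by blast
      then have "ends (Suc n) f" using f(2) by (simp add: ends)
      from r[OF this] r[OF n] show ?thesis by simp
    qed
    then show False using False by blast
  qed
  then obtain x where x: "x \<in> X" by blast
  have in_X: "h \<in> X \<longleftrightarrow> f \<in> X" if "f \<in> F" "g f = Some h" for f h
  proof -
    have "(\<exists>n. ends n f) \<longleftrightarrow> (\<exists>n. ends n h)"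
    proof
      assume "\<exists>n. ends n f"
      then obtain n where "ends n f" by blast
      then show "\<exists>n. ends n h" using that by (cases n) (auto simp: ends)
    next
      assume "\<exists>n. ends n h"
      then obtain n where "ends n h" by blast
      then have "ends (Suc n) f" using that by (simp add: ends)
      then show "\<exists>n. ends n f" by blast
    qed
    then show ?thesis using closed[OF that] that(1) unfolding X_def mem_Collect_eq by blast
  qed
  have none: "f \<notin> X" if "g f = None" for f using ends(1)[of f] that by (auto simp: X_def)
  have "idet F F (\<lambda>f h. of_bool (f = h) - of_bool (g f = Some h)) = (0 :: 'r)"
  proof (rule idet_zero_if_kernel_vector[where j = x and v = "\<lambda>h. of_bool (h \<in> X)"])
    fix f assume f: "f \<in> F"
    have "(\<Sum>h\<in>F. (of_bool (f = h) - of_bool (g f = Some h)) * of_bool (h \<in> X) :: 'r) =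
       (\<Sum>h\<in>F. if h = f then of_bool (f \<in> X) else 0) - (\<Sum>h\<in>F. if g f = Some h then of_bool (h \<in> X) else 0)"
      unfolding sum_subtractf[symmetric] by (intro sum.cong refl) auto
    also have "(\<Sum>h\<in>F. if g f = Some h then of_bool (h \<in> X) else 0) = (of_bool (f \<in> X) :: 'r)"
    proof (cases "g f")
      case None then show ?thesis using none by simp
    next
      case (Some h)
      then have "(\<Sum>h\<in>F. if g f = Some h then of_bool (h \<in> X) else (0 :: 'r)) = (\<Sum>h'\<in>F. if h = h' then of_bool (h' \<in> X) else 0)"
        by simp
      then show ?thesis using Some closed[OF f] in_X[OF f] fin by (simp add: sum.delta)
    qed
    finally show "(\<Sum>h\<in>F. (of_bool (f = h) - of_bool (g f = Some h)) * of_bool (h \<in> X) :: 'r) = 0"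
      using f fin by simp
  qed (use fin x in \<open>auto simp: X_def\<close>)
  then show ?thesis using False by simp
qed

context plane_hypermap
begin

text \<open>
  A step away from a face: \<open>Some (e, True)\<close> follows the dual edge across \<open>e\<close>, \<open>Some (e, False)\<close> goes
  against it, and \<open>None\<close> stops, which is possible at the root \<open>f0\<close> only. The flag is part of the
  step because the two sides of an edge may belong to the same face.
\<close>

definition dest :: "('e \<times> bool) option \<Rightarrow> 'f option" where
  "dest d = (case d of None \<Rightarrow> None | Some (e, x) \<Rightarrow> Some (if x then L e else R e))"

definition hops :: "'f \<Rightarrow> 'f \<Rightarrow> ('e \<times> bool) option set" where
  "hops f0 f = (\<lambda>e. Some (e, True)) ` {e \<in> E. R e = f} \<union> (\<lambda>e. Some (e, False)) ` {e \<in> E. L e = f} \<union>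
     (if f = f0 then {None} else {})"

definition hop_weight :: "'r::comm_ring_1 \<Rightarrow> ('e \<times> bool) option \<Rightarrow> 'r" where
  "hop_weight \<tau> d = (case d of Some (e, True) \<Rightarrow> \<tau> | _ \<Rightarrow> 1)"

lemma finite_hops: "finite (hops f0 f)"
  using finite_E by (simp add: hops_def)

lemma dual_laplacian_hops:
  fixes \<tau> :: "'r::comm_ring_1"
  assumes "f0 \<in> F"
  shows "dual_laplacian \<tau> f0 f g =
    (\<Sum>d\<in>hops f0 f. hop_weight \<tau> d * (of_bool (f = g) - of_bool (dest d = Some g)))"
proof -
  let ?t = "\<lambda>d. hop_weight \<tau> d * (of_bool (f = g) - of_bool (dest d = Some g)) :: 'r"
  have "(\<Sum>d\<in>hops f0 f. ?t d) =
      (\<Sum>d\<in>(\<lambda>e. Some (e, True)) ` {e \<in> E. R e = f}. ?t d) +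
      (\<Sum>d\<in>(\<lambda>e. Some (e, False)) ` {e \<in> E. L e = f}. ?t d) + (\<Sum>d\<in>(if f = f0 then {None} else {}). ?t d)"
    unfolding hops_def using finite_E
    by (subst sum.union_disjoint; force?) (subst sum.union_disjoint; force)
  also have "\<dots> = (\<Sum>e | e \<in> E \<and> R e = f. \<tau> * (of_bool (f = g) - of_bool (L e = g))) +
      (\<Sum>e | e \<in> E \<and> L e = f. of_bool (f = g) - of_bool (R e = g)) + of_bool (f = f0) * of_bool (g = f0)"
    by (auto simp: sum.reindex inj_on_def hop_weight_def dest_def)
  also have "(\<Sum>e | e \<in> E \<and> R e = f. \<tau> * (of_bool (f = g) - of_bool (L e = g))) =
      (\<Sum>e\<in>E. of_bool (R e = f) * (\<tau> * (of_bool (R e = g) - of_bool (L e = g))))"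
    using finite_E by (intro sum.mono_neutral_cong_left) auto
  also have "(\<Sum>e | e \<in> E \<and> L e = f. of_bool (f = g) - of_bool (R e = g) :: 'r) =
      (\<Sum>e\<in>E. of_bool (L e = f) * (of_bool (L e = g) - of_bool (R e = g)))"
    using finite_E by (intro sum.mono_neutral_cong_left) auto
  also have "\<dots> = (\<Sum>e\<in>E. of_bool (R e = f) * of_bool (R e = g)) - (\<Sum>e\<in>E. of_bool (L e = f) * of_bool (R e = g))"
    using sum_\<beta>[of "\<lambda>e. of_bool (L e = f) * of_bool (L e = g) :: 'r"]
    by (simp add: L_\<beta> right_diff_distrib sum_subtractf cong: sum.cong)
  finally show ?thesis
    by (simp add: dual_laplacian_def algebra_simps sum.distrib sum_subtractf sum_distrib_left)
qed

text \<open>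
  One step is chosen at every face, and the rank shows that walks along these steps do not run in
  circles. Hence they all stop at \<open>f0\<close>.
\<close>

definition arborescence :: "'f \<Rightarrow> ('f \<Rightarrow> ('e \<times> bool) option) \<Rightarrow> ('f \<Rightarrow> nat) \<Rightarrow> bool" where
  "arborescence f0 k r \<longleftrightarrow> k \<in> Pi\<^sub>E F (hops f0) \<and> (\<forall>f\<in>F. \<forall>h. dest (k f) = Some h \<longrightarrow> r h < r f)"

definition arborescences :: "'f \<Rightarrow> ('f \<Rightarrow> ('e \<times> bool) option) set" where
  "arborescences f0 = {k. \<exists>r. arborescence f0 k r}"

lemma hops_dest_in: "d \<in> hops f0 f \<Longrightarrow> dest d = Some h \<Longrightarrow> h \<in> F"
  using L_in by (auto simp: hops_def dest_def split: if_splits)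

lemma idet_dual_laplacian_arborescences:
  fixes \<tau> :: "'r::idom"
  assumes f0: "f0 \<in> F"
  shows "idet F F (dual_laplacian \<tau> f0) = (\<Sum>k\<in>arborescences f0. \<Prod>f\<in>F. hop_weight \<tau> (k f))"
proof -
  have fin: "finite F" using finite_E by simp
  have "idet F F (dual_laplacian \<tau> f0) =
      idet F F (\<lambda>f g. \<Sum>d\<in>hops f0 f. hop_weight \<tau> d * (of_bool (f = g) - of_bool (dest d = Some g)))"
    using fin by (intro idet_cong) (simp_all add: dual_laplacian_hops[OF f0])
  also have "\<dots> = (\<Sum>k\<in>Pi\<^sub>E F (hops f0). (\<Prod>f\<in>F. hop_weight \<tau> (k f)) *
      idet F F (\<lambda>f g. of_bool (f = g) - of_bool (dest (k f) = Some g)))"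
    using fin finite_hops by (intro idet_Leibniz_expand_rows) auto
  also have "\<dots> = (\<Sum>k\<in>Pi\<^sub>E F (hops f0). if k \<in> arborescences f0 then (\<Prod>f\<in>F. hop_weight \<tau> (k f)) else 0)"
  proof (rule sum.cong[OF refl])
    fix k assume k: "k \<in> Pi\<^sub>E F (hops f0)"
    have "idet F F (\<lambda>f g. of_bool (f = g) - of_bool (dest (k f) = Some g)) =
       (of_bool (\<exists>r :: 'f \<Rightarrow> nat. \<forall>f\<in>F. \<forall>h. dest (k f) = Some h \<longrightarrow> r h < r f) :: 'r)"
      using fin by (rule idet_functional_graph) (rule hops_dest_in[OF PiE_mem[OF k]])
    then show "(\<Prod>f\<in>F. hop_weight \<tau> (k f)) * idet F F (\<lambda>f g. of_bool (f = g) - of_bool (dest (k f) = Some g)) =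
        (if k \<in> arborescences f0 then (\<Prod>f\<in>F. hop_weight \<tau> (k f)) else 0)"
      using k by (simp add: arborescences_def arborescence_def)
  qed
  also have "\<dots> = (\<Sum>k\<in>arborescences f0. \<Prod>f\<in>F. hop_weight \<tau> (k f))"
    using fin finite_hops
    by (subst sum.inter_restrict[symmetric])
      (auto intro!: finite_PiE sum.cong simp: arborescences_def arborescence_def)
  finally show ?thesis .
qed

definition arb_edges :: "'f \<Rightarrow> ('f \<Rightarrow> ('e \<times> bool) option) \<Rightarrow> 'e set" where
  "arb_edges f0 k = (\<lambda>f. fst (the (k f))) ` (F - {f0})"

definition dual_trees :: "'e set set" where
  "dual_trees = {T. T \<subseteq> E \<and> spans_tree T L R F}"

text \<open>
  The edges of the tree that point towards \<open>f0\<close>: the tail \<open>R e\<close> of the dual edge lies on the side of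
  the fundamental cut without \<open>f0\<close>.
\<close>

definition towards :: "'f \<Rightarrow> 'e set \<Rightarrow> 'e set" where
  "towards f0 T = {e \<in> T. \<exists>X\<subseteq>F - {f0}. R e \<in> X \<and> L e \<notin> X \<and> (\<forall>e'\<in>T. crosses L R X e' \<longleftrightarrow> e' = e)}"

lemma arborescence_root:
  assumes "arborescence f0 k r" "f0 \<in> F"
  shows "k f0 = None"
proof -
  have k: "k f \<in> hops f0 f" if "f \<in> F" for f using assms(1) that by (auto simp: arborescence_def)
  obtain f where f: "f \<in> F" "\<And>g. g \<in> F \<Longrightarrow> r f \<le> r g"
    using ex_has_least_nat[of "\<lambda>f. f \<in> F" f0 r] assms(2) by blast
  have "dest (k f) \<noteq> Some h" for h
    using f hops_dest_in[OF k[OF f(1)], of h] assms(1) by (fastforce simp: arborescence_def)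
  then have "k f = None" by (cases "k f") (auto simp: dest_def)
  moreover from this have "f = f0" using k[OF f(1)] by (auto simp: hops_def split: if_splits)
  ultimately show ?thesis by simp
qed

lemma arborescence_step:
  assumes "arborescence f0 k r" "f \<in> F" "f \<noteq> f0"
  obtains e h where "k f = Some (e, R e = f)" "e \<in> E" "dest (k f) = Some h" "h \<in> F" "r h < r f"
    "R e = f \<and> L e = h \<or> L e = f \<and> R e = h"
proof -
  have k: "k f \<in> hops f0 f" using assms by (auto simp: arborescence_def)
  have r: "r h < r f" if "dest (k f) = Some h" for h using assms(1,2) that by (auto simp: arborescence_def)
  from k assms(3) consider (1) e where "e \<in> E" "R e = f" "k f = Some (e, True)"
    | (2) e where "e \<in> E" "L e = f" "k f = Some (e, False)"
    by (auto simp: hops_def)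
  then show ?thesis
  proof cases
    case 1
    with r[of "L e"] L_in that[of e "L e"] show ?thesis by (auto simp: dest_def)
  next
    case 2
    with r[of "R e"] have "R e \<noteq> f" by (auto simp: dest_def)
    with 2 r[of "R e"] that[of e "R e"] show ?thesis by (auto simp: dest_def)
  qed
qed

text \<open>
  The step at a face of least rank in \<open>Y\<close> leads out of \<open>Y\<close>.
\<close>

lemma arborescence_exits:
  assumes "arborescence f0 k r" "f0 \<in> F" "Y \<subseteq> F" "f \<in> Y" "f0 \<notin> Y"
  shows "\<exists>g\<in>Y. \<exists>e h. k g = Some (e, R e = g) \<and> e \<in> E \<and> h \<in> F - Y \<and> dest (k g) = Some h \<and>
    (R e = g \<and> L e = h \<or> L e = g \<and> R e = h) \<and> r g \<le> r f"
proof -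
  obtain g where g: "g \<in> Y" "\<And>h. h \<in> Y \<Longrightarrow> r g \<le> r h"
    using ex_has_least_nat[of "\<lambda>f. f \<in> Y" f r] assms(4) by blast
  have "g \<in> F" "g \<noteq> f0" using g(1) assms by auto
  from arborescence_step[OF assms(1) this] obtain e h where eh: "k g = Some (e, R e = g)" "e \<in> E"
    "dest (k g) = Some h" "h \<in> F" "r h < r g" "R e = g \<and> L e = h \<or> L e = g \<and> R e = h" by blast
  moreover have "h \<notin> Y" using g(2)[of h] eh(5) by auto
  moreover have "r g \<le> r f" using g(2) assms(4) .
  ultimately show ?thesis using g(1) by blast
qed

lemma arb_edges_inj:
  assumes arb: "arborescence f0 k r"
  shows "inj_on (\<lambda>f. fst (the (k f))) (F - {f0})"
proof (rule inj_onI)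
  fix f f' assume f: "f \<in> F - {f0}" "f' \<in> F - {f0}" and eq: "fst (the (k f)) = fst (the (k f'))"
  obtain e h where 1: "k f = Some (e, R e = f)" "r h < r f" "R e = f \<and> L e = h \<or> L e = f \<and> R e = h"
    using arborescence_step[OF arb, of f] f(1) by blast
  obtain e' h' where 2: "k f' = Some (e', R e' = f')" "r h' < r f'" "R e' = f' \<and> L e' = h' \<or> L e' = f' \<and> R e' = h'"
    using arborescence_step[OF arb, of f'] f(2) by blast
  have "e = e'" using eq 1 2 by simp
  then show "f = f'" using 1 2 by auto
qed

lemma arb_edges_spanning_tree:
  assumes arb: "arborescence f0 k r" and f0: "f0 \<in> F"
  shows "arb_edges f0 k \<in> dual_trees"
proof -
  let ?T = "arb_edges f0 k"
  have sub: "?T \<subseteq> E"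
  proof
    fix e assume "e \<in> ?T"
    then obtain f where "f \<in> F - {f0}" "e = fst (the (k f))" by (auto simp: arb_edges_def)
    then show "e \<in> E" using arborescence_step[OF arb, of f] by (metis DiffD1 DiffD2 fst_conv option.sel singletonI)
  qed
  have "card ?T = card (F - {f0})"
    unfolding arb_edges_def using arb_edges_inj[OF arb] by (rule card_image)
  then have card: "card ?T + 1 = card F"
    using f0 finite_E card_Suc_Diff1[of F f0] by simp
  have exits: "\<exists>e\<in>?T. crosses L R Y e" if Y: "Y \<subseteq> F" "Y \<noteq> {}" "f0 \<notin> Y" for Y
  proof -
    obtain f where "f \<in> Y" using Y by blast
    from arborescence_exits[OF arb f0 Y(1) this Y(3)] obtain g e h where
      g: "g \<in> Y" "k g = Some (e, R e = g)" "h \<in> F - Y" "R e = g \<and> L e = h \<or> L e = g \<and> R e = h" by blast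
    have "e \<in> ?T" unfolding arb_edges_def using g Y by (intro image_eqI[of _ _ g]) auto
    moreover have "crosses L R Y e" using g by (auto simp: crosses_def)
    ultimately show ?thesis by blast
  qed
  have "\<exists>e\<in>?T. crosses L R X e" if X: "X \<subseteq> F" "X \<noteq> {}" "X \<noteq> F" for X
  proof (cases "f0 \<in> X")
    case True
    have "F - X \<noteq> {}" using X by blast
    with exits[of "F - X"] True obtain e where e: "e \<in> ?T" "crosses L R (F - X) e" by blast
    then have "crosses L R X e" using sub L_in by (auto simp: crosses_def)
    with e show ?thesis by blast
  qed (use exits X in blast)
  moreover have "finite ?T" using sub finite_E by (rule finite_subset)
  ultimately show ?thesis
    using sub card finite_E nonempty L_in by (auto simp: dual_trees_def spans_tree_def connects_def)
qed

text \<open>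
  The faces whose walks pass through \<open>f\<close> are one side of the fundamental cut of the edge
  chosen at \<open>f\<close>.
\<close>

lemma arb_descendants:
  assumes arb: "arborescence f0 k r" and f0: "f0 \<in> F" and f: "f \<in> F" "f \<noteq> f0"
  obtains X where "X \<subseteq> F - {f0}" "f \<in> X" "\<And>h. dest (k f) = Some h \<Longrightarrow> h \<notin> X"
    "\<And>e'. e' \<in> arb_edges f0 k \<Longrightarrow> crosses L R X e' \<longleftrightarrow> e' = fst (the (k f))"
proof -
  let ?S = "{(g, h). g \<in> F \<and> dest (k g) = Some h}"
  define X where "X = {g \<in> F. (g, f) \<in> ?S\<^sup>*}"
  have decr: "r f \<le> r g" if "(g, f) \<in> ?S\<^sup>*" for g
    using that
  proof (induction rule: converse_rtrancl_induct)
    case (step y z)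
    then show ?case using arb by (force simp: arborescence_def)
  qed simp
  have "f0 \<notin> X"
  proof
    assume "f0 \<in> X"
    then have "(f0, f) \<in> ?S\<^sup>*" by (simp add: X_def)
    then show False using f(2) arborescence_root[OF arb f0]
      by (cases rule: converse_rtranclE) (auto simp: dest_def)
  qed
  then have 1: "X \<subseteq> F - {f0}" by (auto simp: X_def)
  have 2: "f \<in> X" using f by (simp add: X_def)
  have 3: "h \<notin> X" if "dest (k f) = Some h" for h
    using decr[of h] arb f(1) that by (fastforce simp: X_def arborescence_def)
  have 4: "crosses L R X e' \<longleftrightarrow> e' = fst (the (k f))" if e': "e' \<in> arb_edges f0 k" for e'
  proof -
    obtain g where g: "g \<in> F" "g \<noteq> f0" "e' = fst (the (k g))" using e' by (auto simp: arb_edges_def)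
    obtain h where h: "k g = Some (e', R e' = g)" "dest (k g) = Some h" "h \<in> F"
        "R e' = g \<and> L e' = h \<or> L e' = g \<and> R e' = h"
      using arborescence_step[OF arb g(1,2)] g(3) by (metis fst_conv option.sel)
    have same: "g \<in> X \<longleftrightarrow> h \<in> X" if "g \<noteq> f"
    proof
      assume "g \<in> X"
      then have "(g, f) \<in> ?S\<^sup>*" by (simp add: X_def)
      then show "h \<in> X" using that h(2,3) by (cases rule: converse_rtranclE) (auto simp: X_def)
    next
      assume "h \<in> X"
      then show "g \<in> X" using g(1) h(2) by (auto simp: X_def intro: converse_rtrancl_into_rtrancl)
    qed
    show ?thesis
    proof (cases "g = f")
      case True
      then show ?thesis using 2 3[of h] h g(3) by (auto simp: crosses_def)
    next
      case False
      then have "e' \<noteq> fst (the (k f))"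
        using inj_onD[OF arb_edges_inj[OF arb], of g f] g f by auto
      moreover have "\<not> crosses L R X e'" using same[OF False] h(4) by (auto simp: crosses_def)
      ultimately show ?thesis by blast
    qed
  qed
  show ?thesis using that[OF 1 2 3 4] .
qed

lemma arb_towards:
  assumes arb: "arborescence f0 k r" and f0: "f0 \<in> F" and f: "f \<in> F" "f \<noteq> f0" and k: "k f = Some (e, x)"
  shows "e \<in> towards f0 (arb_edges f0 k) \<longleftrightarrow> x"
proof -
  obtain h where h: "k f = Some (e, R e = f)" "dest (k f) = Some h" "h \<in> F" "r h < r f"
      "R e = f \<and> L e = h \<or> L e = f \<and> R e = h"
    using arborescence_step[OF arb f] k by (metis fst_conv option.sel)
  have eT: "e \<in> arb_edges f0 k" using k f by (force simp: arb_edges_def)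
  obtain X where X: "X \<subseteq> F - {f0}" "f \<in> X" "h \<notin> X"
    "\<And>e'. e' \<in> arb_edges f0 k \<Longrightarrow> crosses L R X e' \<longleftrightarrow> e' = e"
    using arb_descendants[OF arb f0 f] h(2) k by (metis fst_conv option.sel)
  show ?thesis
  proof
    assume x
    then have "R e = f" "L e = h" using h k by auto
    then show "e \<in> towards f0 (arb_edges f0 k)"
      using X eT unfolding towards_def by blast
  next
    assume "e \<in> towards f0 (arb_edges f0 k)"
    then obtain X' where X': "X' \<subseteq> F - {f0}" "R e \<in> X'" "L e \<notin> X'"
      "\<And>e'. e' \<in> arb_edges f0 k \<Longrightarrow> crosses L R X' e' \<longleftrightarrow> e' = e"
      unfolding towards_def by blast
    show x
    proof (rule ccontr)
      assume "\<not> x"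
      then have "L e = f" "R e = h" using h k by auto
      with X' have X'_h: "h \<in> X'" "f \<notin> X'" by auto
      have "X' \<subseteq> F" "f0 \<notin> X'" using X'(1) by auto
      from arborescence_exits[OF arb f0 this(1) X'_h(1) this(2)] obtain g e' h' where
        g: "g \<in> X'" "k g = Some (e', R e' = g)" "h' \<in> F - X'" "R e' = g \<and> L e' = h' \<or> L e' = g \<and> R e' = h'" by blast
      have "g \<in> F - {f0}" using g X'(1) by auto
      then have e': "e' \<in> arb_edges f0 k" using g(2) by (force simp: arb_edges_def)
      have "crosses L R X' e'" using g by (auto simp: crosses_def)
      then have "e' = e" using X'(4) e' by blast
      then have "g = f" 
        using inj_onD[OF arb_edges_inj[OF arb], of g f] \<open>g \<in> F - {f0}\<close> f k g(2) by simp
      then show False using g X'_h by blast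
    qed
  qed
qed

lemma arb_edges_inj_on:
  assumes f0: "f0 \<in> F"
  shows "inj_on (arb_edges f0) (arborescences f0)"
proof (rule inj_onI)
  fix k k' assume "k \<in> arborescences f0" "k' \<in> arborescences f0" and eq: "arb_edges f0 k = arb_edges f0 k'"
  then obtain r r' where arb: "arborescence f0 k r" and arb': "arborescence f0 k' r'"
    by (auto simp: arborescences_def)
  have "k f = k' f" if f: "f \<in> F" for f
  proof (cases "f = f0")
    case True
    then show ?thesis using arborescence_root[OF arb f0] arborescence_root[OF arb' f0] by simp
  next
    case False
    obtain e h where h: "k f = Some (e, R e = f)" "dest (k f) = Some h" "h \<in> F"
      "R e = f \<and> L e = h \<or> L e = f \<and> R e = h"
      by (rule arborescence_step[OF arb f False])
    obtain X where X: "X \<subseteq> F - {f0}" "f \<in> X" "h \<notin> X"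
      "\<And>e'. e' \<in> arb_edges f0 k \<Longrightarrow> crosses L R X e' \<longleftrightarrow> e' = e"
      using arb_descendants[OF arb f0 f False] h(1,2) by (metis fst_conv option.sel)
    have "X \<subseteq> F" "f0 \<notin> X" using X(1) by auto
    from arborescence_exits[OF arb' f0 this(1) X(2) this(2)] obtain g e' h' where
      g: "g \<in> X" "k' g = Some (e', R e' = g)" "h' \<in> F - X" "R e' = g \<and> L e' = h' \<or> L e' = g \<and> R e' = h'" by blast
    have "g \<in> F - {f0}" using g X(1) by auto
    then have "e' \<in> arb_edges f0 k" unfolding eq using g(2) by (force simp: arb_edges_def)
    moreover have "crosses L R X e'" using g by (auto simp: crosses_def)
    ultimately have "e' = e" using X(4) by blast
    then have "g = f" using g h X by auto
    then show ?thesis using g h \<open>e' = e\<close> by simp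
  qed
  moreover have "k \<in> Pi\<^sub>E F (hops f0)" "k' \<in> Pi\<^sub>E F (hops f0)" using arb arb' by (auto simp: arborescence_def)
  ultimately show "k = k'" by (metis PiE_ext)
qed

text \<open>
  Starting from \<open>f0\<close>, a set of faces is grown along the edges of \<open>T\<close>. At a new face, the step along
  the new edge leads back to the set.
\<close>

lemma arborescence_of_tree:
  assumes T: "T \<in> dual_trees" and f0: "f0 \<in> F"
  shows "\<exists>k\<in>arborescences f0. arb_edges f0 k = T"
proof -
  have T: "T \<subseteq> E" "spans_tree T L R F" using T by (auto simp: dual_trees_def)
  note C = connectsD[OF spans_treeD(1)[OF T(2)]]
  let ?good = "\<lambda>X k r. f0 \<in> X \<and> X \<subseteq> F \<and> k f0 = None \<and> (\<forall>f\<in>X. r f < card X) \<and>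
     (\<forall>f\<in>X - {f0}. k f \<in> hops f0 f \<and> fst (the (k f)) \<in> T \<and> (\<exists>h\<in>X. dest (k f) = Some h \<and> r h < (r f :: nat)))"
  have grow: "\<exists>X k r. card X = Suc n \<and> ?good X k r" if "Suc n \<le> card F" for n
    using that
  proof (induction n)
    case 0
    show ?case using f0 by (intro exI[of _ "{f0}"] exI[of _ "\<lambda>_. None"] exI[of _ "\<lambda>_. 0"]) auto
  next
    case (Suc n)
    then obtain X k r where X: "card X = Suc n" "?good X k r" by auto
    have "X \<noteq> F" using X(1) Suc.prems by auto
    then obtain e where e: "e \<in> T" "crosses L R X e" using C(6)[of X] X(2) by blast
    define w where "w = (if R e \<in> X then L e else R e)"
    define h where "h = (if R e \<in> X then R e else L e)"
    have w: "w \<notin> X" "w \<in> F" "h \<in> X" "w \<noteq> f0" "e \<in> E"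
      using e X(2) C(4,5)[OF e(1)] T(1) by (auto simp: w_def h_def crosses_def)
    define k' where "k' = k(w := Some (e, R e = w))"
    define r' where "r' = r(w := card X)"
    have finX: "finite X" using X(2) finite_E by (auto intro: finite_subset)
    have card: "card (insert w X) = Suc (Suc n)" using finX w X(1) by simp
    have kw: "k' w \<in> hops f0 w" "dest (k' w) = Some h"
      using w e(2) by (auto simp: k'_def hops_def dest_def w_def h_def crosses_def)
    have "?good (insert w X) k' r'"
    proof (intro conjI ballI)
      show "f0 \<in> insert w X" "insert w X \<subseteq> F" "k' f0 = None" using X(2) w by (auto simp: k'_def)
      show "r' f < card (insert w X)" if "f \<in> insert w X" for f
        using that X card by (auto simp: r'_def less_Suc_eq)
      fix f assume f: "f \<in> insert w X - {f0}"
      show "k' f \<in> hops f0 f" using f kw X(2) by (cases "f = w") (auto simp: k'_def)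
      show "fst (the (k' f)) \<in> T" using f X(2) e(1) by (cases "f = w") (auto simp: k'_def)
      show "\<exists>h\<in>insert w X. dest (k' f) = Some h \<and> r' h < r' f"
      proof (cases "f = w")
        case True
        then show ?thesis using kw w X(2) by (intro bexI[of _ h]) (auto simp: r'_def)
      next
        case False
        then obtain h' where "h' \<in> X" "dest (k f) = Some h'" "r h' < r f" using f X(2) by blast
        then show ?thesis using False w by (intro bexI[of _ h']) (auto simp: k'_def r'_def)
      qed
    qed
    with card show ?case by blast
  qed
  have pos: "card F > 0" using f0 finite_E by (simp add: card_gt_0_iff) blast
  obtain X k r where X: "card X = card F" "?good X k r" using grow[of "card F - 1"] pos by auto
  then have XF: "X = F" using finite_E by (intro card_subset_eq) auto
  have arb: "arborescence f0 (restrict k F) r"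
    unfolding arborescence_def
  proof (intro conjI ballI allI impI)
    show "restrict k F \<in> Pi\<^sub>E F (hops f0)"
    proof (rule restrict_PiE_iff[THEN iffD2], rule ballI)
      fix f assume "f \<in> F"
      then show "k f \<in> hops f0 f" using X(2) XF by (cases "f = f0") (auto simp: hops_def)
    qed
    fix f h assume f: "f \<in> F" "dest (restrict k F f) = Some h"
    then have "dest (k f) = Some h" by simp
    moreover from this have "f \<noteq> f0" using X(2) by (auto simp: dest_def)
    moreover have "f \<in> X - {f0}" using f(1) XF calculation(2) by blast
    ultimately obtain h' where "dest (k f) = Some h'" "r h' < r f" using X(2) by blast
    then show "r h < r f" using \<open>dest (k f) = Some h\<close> by simp
  qed
  have "arb_edges f0 (restrict k F) \<subseteq> T" using X(2) XF by (auto simp: arb_edges_def)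
  moreover have "card (arb_edges f0 (restrict k F)) = card T"
    using arb_edges_spanning_tree[OF arb f0] spans_treeD(2)[OF T(2)]
    by (auto simp: dual_trees_def spans_tree_def)
  ultimately have "arb_edges f0 (restrict k F) = T" using C(1) by (intro card_subset_eq) auto
  then show ?thesis using arb by (auto simp: arborescences_def)
qed

text \<open>
  The matrix-tree theorem in its directed form. An arborescence is determined by its set of
  edges, and a step has weight \<open>\<tau>\<close> exactly when the direction of its edge is towards \<open>f0\<close>.
\<close>

theorem idet_dual_laplacian_trees:
  fixes \<tau> :: "'r::idom"
  assumes f0: "f0 \<in> F"
  shows "idet F F (dual_laplacian \<tau> f0) = (\<Sum>T\<in>dual_trees. \<tau> ^ card (towards f0 T))"
proof -
  have "bij_betw (arb_edges f0) (arborescences f0) dual_trees"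
    unfolding bij_betw_def using arb_edges_inj_on[OF f0] arborescence_of_tree[OF _ f0] arb_edges_spanning_tree[OF _ f0]
    by (auto simp: arborescences_def) blast
  moreover have "(\<Prod>f\<in>F. hop_weight \<tau> (k f)) = \<tau> ^ card (towards f0 (arb_edges f0 k))" if k: "k \<in> arborescences f0" for k
  proof -
    obtain r where arb: "arborescence f0 k r" using k by (auto simp: arborescences_def)
    let ?P = "{f \<in> F - {f0}. fst (the (k f)) \<in> towards f0 (arb_edges f0 k)}"
    have w: "hop_weight \<tau> (k f) = (if f \<in> ?P then \<tau> else 1)" if f: "f \<in> F" for f
    proof (cases "f = f0")
      case True then show ?thesis using arborescence_root[OF arb f0] by (simp add: hop_weight_def)
    next
      case False
      then obtain e where e: "k f = Some (e, R e = f)" using arborescence_step[OF arb f] by blast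
      show ?thesis using arb_towards[OF arb f0 f False e] e f False by (auto simp: hop_weight_def)
    qed
    have "(\<Prod>f\<in>F. hop_weight \<tau> (k f)) = (\<Prod>f\<in>F. if f \<in> ?P then \<tau> else 1)"
      by (intro prod.cong refl w)
    also have "\<dots> = (\<Prod>f\<in>?P. \<tau>)"
      using finite_E by (intro prod.mono_neutral_cong_right) auto
    also have "\<dots> = \<tau> ^ card ?P" by simp
    also have "card ?P = card ((\<lambda>f. fst (the (k f))) ` ?P)"
      by (rule card_image[symmetric]) (rule inj_on_subset[OF arb_edges_inj[OF arb]], auto)
    also have "(\<lambda>f. fst (the (k f))) ` ?P = towards f0 (arb_edges f0 k)"
      by (auto simp: towards_def arb_edges_def)
    finally show ?thesis .
  qed
  ultimately show ?thesis
    unfolding idet_dual_laplacian_arborescences[OF f0]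
    using sum.reindex_bij_betw[of "arb_edges f0" "arborescences f0" dual_trees "\<lambda>T. \<tau> ^ card (towards f0 T)"]
    by simp
qed

text \<open>
  The trees that contribute to the power of \<open>\<tau> - 1\<close> indexed by \<open>S\<close>.
\<close>

definition trees_over :: "'f \<Rightarrow> 'e set \<Rightarrow> 'e set set" where
  "trees_over f0 S = {T \<in> dual_trees. S \<subseteq> T \<and> T - S \<subseteq> towards f0 T}"

lemma sum_Pow_power:
  assumes "finite A"
  shows "(\<Sum>X\<in>Pow A. y ^ card X) = (1 + y :: 'r::comm_ring_1) ^ card A"
  using assms
proof (induction A rule: finite_induct)
  case (insert x A)
  have "(\<Sum>X\<in>Pow (insert x A). y ^ card X) = (\<Sum>X\<in>Pow A. y ^ card X) + (\<Sum>X\<in>insert x ` Pow A. y ^ card X)"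
    unfolding Pow_insert using insert by (intro sum.union_disjoint) auto
  also have "(\<Sum>X\<in>insert x ` Pow A. y ^ card X) = (\<Sum>X\<in>Pow A. y ^ card (insert x X))"
    using insert by (subst sum.reindex) (auto simp: inj_on_def)
  also have "\<dots> = (\<Sum>X\<in>Pow A. y * y ^ card X)"
    using insert by (intro sum.cong refl) (auto simp: finite_subset card_insert_if)
  finally show ?case using insert by (simp add: sum_distrib_left[symmetric] algebra_simps)
qed simp

text \<open>
  Each \<open>\<tau> ^ card (towards f0 T)\<close> is the sum of \<open>(\<tau> - 1) ^ card X\<close> over all \<open>X \<subseteq> towards f0 T\<close>; the
  terms are collected according to \<open>S = T - X\<close>.
\<close>

theorem idet_dual_laplacian_expansion:
  fixes \<tau> :: "'r::idom"
  assumes f0: "f0 \<in> F"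
  shows "idet F F (dual_laplacian \<tau> f0) =
    (\<Sum>S\<in>Pow E. of_nat (card (trees_over f0 S)) * (\<tau> - 1) ^ (card F - 1 - card S))"
proof -
  have fin: "finite T" "card T = card F - 1" "towards f0 T \<subseteq> T" if "T \<in> dual_trees" for T
    using that finite_E by (auto simp: dual_trees_def towards_def spans_tree_def intro: finite_subset)
  have finD: "finite dual_trees" using finite_E by (auto simp: dual_trees_def intro: finite_subset[of _ "Pow E"])
  have "idet F F (dual_laplacian \<tau> f0) = (\<Sum>T\<in>dual_trees. \<Sum>X\<in>Pow (towards f0 T). (\<tau> - 1) ^ card X)"
    unfolding idet_dual_laplacian_trees[OF f0]
    using sum_Pow_power[OF finite_subset[OF fin(3,1)], where y = "\<tau> - 1"] by (intro sum.cong refl) simp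
  also have "\<dots> = (\<Sum>T\<in>dual_trees. \<Sum>S\<in>{S \<in> Pow E. S \<subseteq> T \<and> T - S \<subseteq> towards f0 T}. (\<tau> - 1) ^ (card F - 1 - card S))"
  proof (rule sum.cong[OF refl])
    fix T assume T: "T \<in> dual_trees"
    show "(\<Sum>X\<in>Pow (towards f0 T). (\<tau> - 1) ^ card X) =
        (\<Sum>S\<in>{S \<in> Pow E. S \<subseteq> T \<and> T - S \<subseteq> towards f0 T}. (\<tau> - 1) ^ (card F - 1 - card S))"
    proof (rule sum.reindex_bij_witness[where i = "\<lambda>S. T - S" and j = "\<lambda>X. T - X"])
      fix X assume X: "X \<in> Pow (towards f0 T)"
      then have XT: "X \<subseteq> T" using fin(3)[OF T] by blast
      then have "card (T - X) = card F - 1 - card X" "card X \<le> card F - 1"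
        using fin(1,2)[OF T] card_mono[OF fin(1)[OF T] XT] by (simp_all add: card_Diff_subset finite_subset)
      then have "card F - 1 - card (T - X) = card X" by linarith
      then show "(\<tau> - 1) ^ (card F - 1 - card (T - X)) = (\<tau> - 1) ^ card X" by simp
      show "T - (T - X) = X" using XT by blast
      show "T - X \<in> {S \<in> Pow E. S \<subseteq> T \<and> T - S \<subseteq> towards f0 T}"
        using T X by (auto simp: dual_trees_def)
    qed auto
  qed
  also have "\<dots> = (\<Sum>T\<in>dual_trees. \<Sum>S\<in>Pow E. if T \<in> trees_over f0 S then (\<tau> - 1) ^ (card F - 1 - card S) else 0)"
    using finite_E by (intro sum.cong refl sum.mono_neutral_cong_left) (auto simp: trees_over_def)
  also have "\<dots> = (\<Sum>S\<in>Pow E. \<Sum>T\<in>dual_trees. if T \<in> trees_over f0 S then (\<tau> - 1) ^ (card F - 1 - card S) else 0)"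
    by (rule sum.swap)
  also have "\<dots> = (\<Sum>S\<in>Pow E. of_nat (card (trees_over f0 S)) * (\<tau> - 1) ^ (card F - 1 - card S))"
  proof (rule sum.cong[OF refl])
    fix S
    have "dual_trees \<inter> {T. T \<in> trees_over f0 S} = trees_over f0 S" by (auto simp: trees_over_def)
    then show "(\<Sum>T\<in>dual_trees. if T \<in> trees_over f0 S then (\<tau> - 1) ^ (card F - 1 - card S) else 0) =
        of_nat (card (trees_over f0 S)) * (\<tau> - 1) ^ (card F - 1 - card S)"
      using finD by (simp add: sum.If_cases)
  qed
  finally show ?thesis .
qed

end

section \<open>Volume in unimodular coordinates\<close>

no_notation Matrix.vec_index (infixl \<open>$\<close> 100)

lemma emeasure_lborel_box_vec:
  fixes A :: "'n::finite \<Rightarrow> real set"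
  assumes [measurable]: "\<And>k. A k \<in> sets borel"
  shows "emeasure lborel {y :: real^'n. \<forall>k. y $ k \<in> A k} = (\<Prod>k\<in>UNIV. emeasure lborel (A k))"
proof -
  define idx :: "real^'n \<Rightarrow> 'n" where "idx b = (THE k. b = axis k 1)" for b
  have idx: "idx (axis k 1) = k" for k by (auto simp: idx_def axis_eq_axis)
  have inj: "inj (\<lambda>k::'n. axis k (1::real))" by (auto simp: inj_on_def axis_eq_axis)
  have B: "(Basis :: (real^'n) set) = range (\<lambda>k. axis k 1)" by (auto simp: Basis_vec_def)
  have P: "(\<Prod>b\<in>Basis. g b) = (\<Prod>k\<in>UNIV. g (axis k 1))" for g :: "real^'n \<Rightarrow> ennreal"
    unfolding B by (subst prod.reindex[OF inj]) simp
  have meas: "{y :: real^'n. \<forall>k. y $ k \<in> A k} \<in> sets borel"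
  proof -
    have "{y :: real^'n. \<forall>k. y $ k \<in> A k} = (\<Inter>k. (\<lambda>y. y $ k) -` A k)" by auto
    moreover have "(\<lambda>y :: real^'n. y $ k) -` A k \<in> sets borel" for k
      by (intro measurable_sets_borel[of _ borel, OF borel_measurable_continuous_onI] continuous_intros) auto
    ultimately show ?thesis by (auto intro: sets.finite_INT)
  qed
  have "emeasure lborel {y :: real^'n. \<forall>k. y $ k \<in> A k} = (\<integral>\<^sup>+y. indicator {y. \<forall>k. y $ k \<in> A k} y \<partial>lborel)"
    using meas by simp
  also have "\<dots> = (\<integral>\<^sup>+y. (\<Prod>b\<in>Basis. indicator (A (idx b)) (y \<bullet> b)) \<partial>lborel)"
    by (intro nn_integral_cong) (auto simp: P idx inner_axis indicator_def prod_zero_iff)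
  also have "\<dots> = (\<Prod>b\<in>Basis. (\<integral>\<^sup>+x. indicator (A (idx b)) x \<partial>lborel))"
    by (rule nn_integral_lborel_prod) auto
  also have "\<dots> = (\<Prod>k\<in>UNIV. emeasure lborel (A k))"
    by (simp add: P idx)
  finally show ?thesis .
qed

text \<open>
  Multiplication with unit intervals in the unused coordinates turns a measure on few coordinates
  into Lebesgue measure on the whole space, where linear maps act by their determinants.
\<close>

lemma emeasure_PiM_lborel_padded:
  fixes \<eta> :: "'i \<Rightarrow> 'n::finite"
  assumes I: "finite I" "inj_on \<eta> I" and Y: "Y \<in> sets (Pi\<^sub>M I (\<lambda>_. lborel :: real measure))"
  shows "emeasure (Pi\<^sub>M I (\<lambda>_. lborel)) Y =
    emeasure lborel {y :: real^'n. (\<lambda>i\<in>I. y $ \<eta> i) \<in> Y \<and> (\<forall>k. k \<notin> \<eta> ` I \<longrightarrow> y $ k \<in> {0..1})}"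
proof -
  let ?M = "Pi\<^sub>M I (\<lambda>_. lborel :: real measure)"
  interpret product_sigma_finite "\<lambda>_ :: 'i. lborel :: real measure" by standard
  let ?C = "{y :: real^'n. \<forall>k. k \<notin> \<eta> ` I \<longrightarrow> y $ k \<in> {0..1}}"
  let ?r = "\<lambda>y :: real^'n. \<lambda>i\<in>I. y $ \<eta> i"
  have C: "?C \<in> sets borel"
  proof -
    have "?C = (\<Inter>k\<in>- \<eta> ` I. {y. 0 \<le> y $ k} \<inter> {y. y $ k \<le> 1})" by auto
    also have "closed \<dots>"
      by (intro closed_INT ballI closed_Int closed_Collect_le continuous_intros)
    finally show ?thesis by (rule borel_closed)
  qed
  have r: "?r \<in> measurable lborel ?M"
    by (intro measurable_restrict) (auto intro!: borel_measurable_continuous_onI continuous_intros)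
  have vim: "?r -` Y' \<in> sets borel" if "Y' \<in> sets ?M" for Y'
    using measurable_sets[OF r that] by simp
  define P where "P = distr (density lborel (indicator ?C)) ?M ?r"
  have r': "?r \<in> measurable (density lborel (indicator ?C)) ?M" using r by simp
  have emP: "emeasure P Y' = emeasure lborel {y. ?r y \<in> Y' \<and> (\<forall>k. k \<notin> \<eta> ` I \<longrightarrow> y $ k \<in> {0..1})}"
    if Y': "Y' \<in> sets ?M" for Y'
  proof -
    have "emeasure P Y' = emeasure (density lborel (indicator ?C)) (?r -` Y')"
      unfolding P_def by (subst emeasure_distr[OF r' Y']) simp
    also have "\<dots> = (\<integral>\<^sup>+y. indicator ?C y * indicator (?r -` Y') y \<partial>lborel)"
      using C vim[OF Y'] by (intro emeasure_density) auto
    also have "\<dots> = (\<integral>\<^sup>+y. indicator (?C \<inter> ?r -` Y') y \<partial>lborel)"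
      by (intro nn_integral_cong) (simp add: indicator_inter_arith)
    also have "\<dots> = emeasure lborel (?C \<inter> ?r -` Y')"
      using C vim[OF Y'] by simp
    also have "?C \<inter> ?r -` Y' = {y. ?r y \<in> Y' \<and> (\<forall>k. k \<notin> \<eta> ` I \<longrightarrow> y $ k \<in> {0..1})}" by auto
    finally show ?thesis .
  qed
  have "P = ?M"
  proof (rule PiM_eqI[OF I(1)])
    show "sets P = sets ?M" by (simp add: P_def)
    fix A :: "'i \<Rightarrow> real set" assume A: "\<And>i. i \<in> I \<Longrightarrow> A i \<in> sets lborel"
    define A' where "A' k = (if k \<in> \<eta> ` I then A (inv_into I \<eta> k) else {0..1})" for k
    have A': "A' k \<in> sets borel" for k
      using A I(2) by (auto simp: A'_def inv_into_f_f)
    have "emeasure P (Pi\<^sub>E I A) = emeasure lborel {y :: real^'n. \<forall>k. y $ k \<in> A' k}"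
    proof (subst emP)
      show "Pi\<^sub>E I A \<in> sets ?M" using A I(1) by (intro sets_PiM_I_finite) auto
      have "(?r y \<in> Pi\<^sub>E I A \<and> (\<forall>k. k \<notin> \<eta> ` I \<longrightarrow> y $ k \<in> {0..1})) \<longleftrightarrow> (\<forall>k. y $ k \<in> A' k)" for y :: "real^'n"
      proof -
        have "?r y \<in> Pi\<^sub>E I A \<longleftrightarrow> (\<forall>i\<in>I. y $ \<eta> i \<in> A' (\<eta> i))"
          using I(2) by (simp add: A'_def inv_into_f_f PiE_iff)
        then show ?thesis by (auto simp: A'_def)
      qed
      then show "emeasure lborel {y. ?r y \<in> Pi\<^sub>E I A \<and> (\<forall>k. k \<notin> \<eta> ` I \<longrightarrow> y $ k \<in> {0..1})} =
          emeasure lborel {y. \<forall>k. y $ k \<in> A' k}" by simp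
    qed
    also have "\<dots> = (\<Prod>k\<in>UNIV. emeasure lborel (A' k))"
      by (rule emeasure_lborel_box_vec[OF A'])
    also have "\<dots> = (\<Prod>k\<in>\<eta> ` I. emeasure lborel (A' k))"
      by (rule prod.mono_neutral_right) (auto simp: A'_def)
    also have "\<dots> = (\<Prod>i\<in>I. emeasure lborel (A i))"
      using I(2) by (subst prod.reindex) (auto simp: A'_def inv_into_f_f intro!: prod.cong)
    finally show "emeasure P (Pi\<^sub>E I A) = (\<Prod>i\<in>I. emeasure lborel (A i))" .
  qed
  then show ?thesis using emP[OF Y] by simp
qed

lemma det_Ints:
  fixes A :: "real^'n^'n"
  assumes "\<And>i j. A $ i $ j \<in> \<int>"
  shows "Determinants.det A \<in> \<int>"
  unfolding Determinants.det_def using assms by (intro Ints_sum Ints_mult Ints_prod) auto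

lemma abs_det_integer_inverse:
  fixes A B :: "real^'n^'n"
  assumes "\<And>i j. A $ i $ j \<in> \<int>" "\<And>i j. B $ i $ j \<in> \<int>" "A ** B = Finite_Cartesian_Product.mat 1"
  shows "\<bar>Determinants.det A\<bar> = 1"
proof -
  obtain x y :: int where xy: "Determinants.det A = of_int x" "Determinants.det B = of_int y"
    using det_Ints[OF assms(1)] det_Ints[OF assms(2)] by (auto elim!: Ints_cases)
  have "Determinants.det A * Determinants.det B = 1" using assms(3) by (metis det_mul det_I)
  then have "of_int (x * y) = (1 :: real)" using xy by simp
  then have "x * y = 1" by linarith
  then have "\<bar>x\<bar> = 1" by (metis dvd_triv_left zdvd1_eq)
  then show ?thesis using xy by simp
qed

definition coordinate_prism :: "'n::finite set \<Rightarrow> (real^'n) set \<Rightarrow> (real^'n) set" where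
  "coordinate_prism K X = {q + (\<Sum>k\<in>K. u k *\<^sub>R axis k 1) | q u. q \<in> X \<and> (\<forall>k\<in>K. u k \<in> {0..1})}"

lemma compact_coordinate_prism:
  assumes "compact X"
  shows "compact (coordinate_prism K X)"
proof -
  have "coordinate_prism K X = (\<lambda>(q, y). q + (\<Sum>k\<in>K. (y $ k) *\<^sub>R axis k 1)) ` (X \<times> cbox 0 1)"
  proof (intro Set.set_eqI iffI)
    fix x assume "x \<in> coordinate_prism K X"
    then obtain q u where "x = q + (\<Sum>k\<in>K. u k *\<^sub>R axis k 1)" "q \<in> X" "\<forall>k\<in>K. u k \<in> {0..1}"
      by (auto simp: coordinate_prism_def)
    then show "x \<in> (\<lambda>(q, y). q + (\<Sum>k\<in>K. (y $ k) *\<^sub>R axis k 1)) ` (X \<times> cbox 0 1)"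
      by (intro image_eqI[of _ _ "(q, \<chi> k. if k \<in> K then u k else 0)"]) (auto simp: mem_box_cart)
  next
    fix x assume "x \<in> (\<lambda>(q, y). q + (\<Sum>k\<in>K. (y $ k) *\<^sub>R axis k 1)) ` (X \<times> cbox 0 1)"
    then obtain q y where "x = q + (\<Sum>k\<in>K. (y $ k) *\<^sub>R axis k 1)" "q \<in> X" "y \<in> cbox 0 1" by auto
    then show "x \<in> coordinate_prism K X" unfolding coordinate_prism_def by (auto simp: mem_box_cart)
  qed
  moreover have "compact \<dots>"
    by (intro compact_continuous_image compact_Times assms compact_cbox)
      (auto simp: case_prod_unfold intro!: continuous_intros)
  ultimately show ?thesis by simp
qed

text \<open>
  The points \<open>vec s\<close> are affinely independent, and the differences \<open>vec s - vec s0\<close> together with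
  the coordinate directions in \<open>K\<close> form a basis of the integer lattice. The index type is
  well-ordered because this is the setting of the change of variables formula for linear maps.
\<close>

locale unimodular_frame =
  fixes S :: "'i set" and s0 :: 'i and vec :: "'i \<Rightarrow> real^'n::{finite,wellorder}" and K :: "'n set"
  assumes finite_S: "finite S" and s0: "s0 \<in> S" and card_K: "card (S - {s0}) + card K = CARD('n)"
    and inj_vec: "inj_on vec S"
    and integral: "\<And>s k. s \<in> S \<Longrightarrow> vec s $ k \<in> \<int>"
    and spans: "\<And>k. \<exists>c u. (\<forall>s\<in>S. c s \<in> \<int>) \<and> (\<forall>j\<in>K. u j \<in> \<int>) \<and>
       axis k 1 = (\<Sum>s\<in>S - {s0}. c s *\<^sub>R (vec s - vec s0)) + (\<Sum>j\<in>K. u j *\<^sub>R axis j 1)"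
begin

definition param :: "('i \<Rightarrow> real) \<Rightarrow> real^'n::{finite,wellorder}" where
  "param c = vec s0 + (\<Sum>s\<in>S - {s0}. c s *\<^sub>R (vec s - vec s0))"

text \<open>
  An arbitrary labelling of the affine coordinates by the coordinate directions outside \<open>K\<close>, which
  makes the linear part of the frame an endomorphism of the whole space.
\<close>

definition \<eta> :: "'i \<Rightarrow> 'n" where
  "\<eta> = (SOME \<eta>. bij_betw \<eta> (S - {s0}) (- K))"

lemma \<eta>: "bij_betw \<eta> (S - {s0}) (- K)"
proof -
  have "card (- K) = card (S - {s0})"
    using card_K card_Diff_subset[of K "UNIV :: 'n set"] by (simp add: Compl_eq_Diff_UNIV)
  then have "\<exists>\<eta>. bij_betw \<eta> (S - {s0}) (- K)"
    using finite_S by (intro finite_same_card_bij) auto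
  then show ?thesis unfolding \<eta>_def by (rule someI_ex)
qed

lemma \<eta>_image: "\<eta> ` (S - {s0}) = - K" and \<eta>_inj: "inj_on \<eta> (S - {s0})"
  using \<eta> by (auto simp: bij_betw_def)

definition lin :: "real^'n::{finite,wellorder} \<Rightarrow> real^'n::{finite,wellorder}" where
  "lin y = (\<Sum>s\<in>S - {s0}. (y $ \<eta> s) *\<^sub>R (vec s - vec s0)) + (\<Sum>k\<in>K. (y $ k) *\<^sub>R axis k 1)"

lemma linear_lin: "linear lin"
  by (rule linearI) (simp_all add: lin_def scaleR_add_left scaleR_add_right sum.distrib scaleR_sum_right)

lemma lin_surj_vec:
  obtains y where "\<And>s. s \<in> S - {s0} \<Longrightarrow> y $ \<eta> s = c s" "\<And>k. k \<in> K \<Longrightarrow> y $ k = u k"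
    "lin y = (\<Sum>s\<in>S - {s0}. c s *\<^sub>R (vec s - vec s0)) + (\<Sum>k\<in>K. u k *\<^sub>R axis k 1)"
    "\<And>k. y $ k = u k \<or> (\<exists>s\<in>S. y $ k = c s)"
proof -
  define y :: "real^'n::{finite,wellorder}" where "y = (\<chi> k. if k \<in> K then u k else c (inv_into (S - {s0}) \<eta> k))"
  have 1: "y $ \<eta> s = c s" if s: "s \<in> S - {s0}" for s
  proof -
    have "\<eta> s \<notin> K" using \<eta>_image s by blast
    then show ?thesis using \<eta>_inj s by (simp add: y_def inv_into_f_f)
  qed
  have 2: "y $ k = u k" if "k \<in> K" for k using that by (simp add: y_def)
  have 3: "y $ k = u k \<or> (\<exists>s\<in>S. y $ k = c s)" for k
  proof (cases "k \<in> K")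
    case False
    then obtain s where "s \<in> S - {s0}" "k = \<eta> s" using \<eta>_image by blast
    with 1 show ?thesis by blast
  qed (use 2 in simp)
  have 4: "lin y = (\<Sum>s\<in>S - {s0}. c s *\<^sub>R (vec s - vec s0)) + (\<Sum>k\<in>K. u k *\<^sub>R axis k 1)"
    unfolding lin_def using 1 2 by (intro arg_cong2[of _ _ _ _ "(+)"] sum.cong) auto
  show ?thesis by (rule that[OF 1 2 4 3])
qed

lemma abs_det_lin: "\<bar>Determinants.det (matrix lin)\<bar> = 1"
proof -
  have "\<exists>y. (\<forall>j. y $ j \<in> \<int>) \<and> lin y = axis k 1" for k
  proof -
    obtain c u where cu: "\<forall>s\<in>S. c s \<in> \<int>" "\<forall>j\<in>K. u j \<in> \<int>"
       "axis k 1 = (\<Sum>s\<in>S - {s0}. c s *\<^sub>R (vec s - vec s0)) + (\<Sum>j\<in>K. u j *\<^sub>R axis j 1)" using spans by blast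
    let ?u = "\<lambda>j. if j \<in> K then u j else 0"
    obtain y where y: "lin y = (\<Sum>s\<in>S - {s0}. c s *\<^sub>R (vec s - vec s0)) + (\<Sum>k\<in>K. ?u k *\<^sub>R axis k 1)"
      "\<And>k. y $ k = ?u k \<or> (\<exists>s\<in>S. y $ k = c s)" by (rule lin_surj_vec[of c ?u]) blast
    have "y $ j \<in> \<int>" for j using y(2)[of j] cu(1,2) by auto
    moreover have "lin y = axis k 1" using y(1) cu(3) by simp
    ultimately show ?thesis by blast
  qed
  then obtain Y where Y: "\<And>k j. Y k $ j \<in> \<int>" "\<And>k. lin (Y k) = axis k 1" by metis
  define B :: "((real,'n) Finite_Cartesian_Product.vec)^'n::{finite,wellorder}" where "B = (\<chi> i j. Y j $ i)"
  have col: "column j B = Y j" for j by (simp add: B_def column_def vec_eq_iff)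
  have "matrix lin ** B = Finite_Cartesian_Product.mat 1"
  proof -
    have "column j (matrix lin ** B) = axis j 1" for j
    proof -
      have "column j (matrix lin ** B) = matrix lin *v column j B"
        by (simp add: vec_eq_iff column_def matrix_matrix_mult_def matrix_vector_mult_def)
      also have "\<dots> = lin (Y j)" by (simp add: col matrix_works linear_lin)
      finally show ?thesis using Y(2) by simp
    qed
    then have "(matrix lin ** B) $ i $ j = axis j 1 $ i" for i j
      by (metis column_def vec_lambda_beta)
    then show ?thesis by (simp add: Finite_Cartesian_Product.vec_eq_iff Finite_Cartesian_Product.mat_def axis_def)
  qed
  moreover have "matrix lin $ i $ j \<in> \<int>" for i j
  proof -
    have "(axis j (1::real) :: real^'n::{finite,wellorder}) $ k \<in> \<int>" for j k by (simp add: axis_def)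
    then show ?thesis
      unfolding matrix_def lin_def using integral s0
      by (auto intro!: Ints_add Ints_sum Ints_mult Ints_diff)
  qed
  moreover have "B $ i $ j \<in> \<int>" for i j using Y(1) by (simp add: B_def)
  ultimately show ?thesis by (intro abs_det_integer_inverse[of "matrix lin" B]) auto
qed

lemma inj_lin: "inj lin"
proof -
  have "Determinants.det (matrix lin) \<noteq> 0" using abs_det_lin by auto
  then show ?thesis using det_nz_iff_inj[OF linear_lin] by simp
qed

lemma param_eqD:
  assumes "param c = param c'" "s \<in> S - {s0}"
  shows "c s = c' s"
proof -
  obtain y where y: "\<And>s. s \<in> S - {s0} \<Longrightarrow> y $ \<eta> s = c s"
    "lin y = (\<Sum>s\<in>S - {s0}. c s *\<^sub>R (vec s - vec s0)) + (\<Sum>k\<in>K. 0 *\<^sub>R axis k 1)" by (rule lin_surj_vec[of c "\<lambda>_. 0"]) blast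
  obtain y' where y': "\<And>s. s \<in> S - {s0} \<Longrightarrow> y' $ \<eta> s = c' s"
    "lin y' = (\<Sum>s\<in>S - {s0}. c' s *\<^sub>R (vec s - vec s0)) + (\<Sum>k\<in>K. 0 *\<^sub>R axis k 1)" by (rule lin_surj_vec[of c' "\<lambda>_. 0"]) blast
  have "lin y = lin y'" using y(2) y'(2) assms(1) by (simp add: param_def)
  then have "y = y'" using inj_lin by (simp add: inj_eq)
  then show ?thesis using y(1)[OF assms(2)] y'(1)[OF assms(2)] by simp
qed

abbreviation "param_space \<equiv> Pi\<^sub>M (S - {s0}) (\<lambda>_. lborel :: real measure)"

lemma param_measurable: "param \<in> borel_measurable param_space"
  unfolding param_def
  by (intro borel_measurable_add borel_measurable_const borel_measurable_sum borel_measurable_scaleR) auto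

lemma param_vimage_sets:
  "X \<in> sets borel \<Longrightarrow> {c \<in> space param_space. param c \<in> X} \<in> sets param_space"
  using measurable_sets[OF param_measurable, of X] by (simp add: vimage_def Int_def conj_commute)

text \<open>
  The right-hand side mentions only \<open>K\<close> and not the frame. Therefore all unimodular frames with the
  same \<open>K\<close> measure volume in the same way.
\<close>

lemma emeasure_param:
  assumes X: "compact X" "X \<subseteq> range (param)"
  shows "emeasure param_space {c \<in> space param_space. param c \<in> X} =
    ennreal (measure lebesgue (coordinate_prism K X))"
proof -
  let ?Y = "{c \<in> space param_space. param c \<in> X}"
  let ?U = "{y :: real^'n::{finite,wellorder}. (\<lambda>s\<in>S - {s0}. y $ \<eta> s) \<in> ?Y \<and> (\<forall>k. k \<notin> \<eta> ` (S - {s0}) \<longrightarrow> y $ k \<in> {0..1})}"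
  have Y: "?Y \<in> sets param_space" using X(1) by (intro param_vimage_sets borel_closed compact_imp_closed)
  have ap: "param (\<lambda>s\<in>S - {s0}. y $ \<eta> s) = vec s0 + (\<Sum>s\<in>S - {s0}. (y $ \<eta> s) *\<^sub>R (vec s - vec s0))" for y
    by (simp add: param_def)
  have U: "y \<in> ?U \<longleftrightarrow> param (\<lambda>s\<in>S - {s0}. y $ \<eta> s) \<in> X \<and> (\<forall>k\<in>K. y $ k \<in> {0..1})" for y
    by (auto simp: \<eta>_image space_PiM)
  have im: "(+) (vec s0) ` lin ` ?U = coordinate_prism K X"
  proof (intro Set.set_eqI iffI)
    fix x assume "x \<in> (+) (vec s0) ` lin ` ?U"
    then obtain y where y: "y \<in> ?U" "x = vec s0 + lin y" by blast
    then show "x \<in> coordinate_prism K X"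
      unfolding coordinate_prism_def U
      by (auto simp: ap lin_def add.assoc intro!: exI[of _ "vec s0 + (\<Sum>s\<in>S - {s0}. (y $ \<eta> s) *\<^sub>R (vec s - vec s0))"] exI[of _ "\<lambda>k. y $ k"])
  next
    fix x assume "x \<in> coordinate_prism K X"
    then obtain q u where q: "x = q + (\<Sum>k\<in>K. u k *\<^sub>R axis k 1)" "q \<in> X" "\<forall>k\<in>K. u k \<in> {0..1}"
      by (auto simp: coordinate_prism_def)
    then obtain c where c: "q = param c" using X(2) by blast
    obtain y where y: "\<And>s. s \<in> S - {s0} \<Longrightarrow> y $ \<eta> s = c s" "\<And>k. k \<in> K \<Longrightarrow> y $ k = u k"
      "lin y = (\<Sum>s\<in>S - {s0}. c s *\<^sub>R (vec s - vec s0)) + (\<Sum>k\<in>K. u k *\<^sub>R axis k 1)" by (rule lin_surj_vec[of c u]) blast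
    have "param (\<lambda>s\<in>S - {s0}. y $ \<eta> s) = q"
      unfolding ap c param_def using y(1) by simp
    then have "y \<in> ?U" unfolding U using q y(2) by simp
    moreover have "x = vec s0 + lin y" using q(1) c y(3) by (simp add: param_def add.assoc)
    ultimately show "x \<in> (+) (vec s0) ` lin ` ?U" by blast
  qed
  obtain lin' where lin': "linear lin'" "\<And>x. lin' (lin x) = x"
    using linear_injective_isomorphism[OF linear_lin inj_lin] by blast
  have "?U = lin' ` (\<lambda>x. x - vec s0) ` coordinate_prism K X"
    unfolding im[symmetric] image_image by (simp add: lin'(2))
  moreover have "compact \<dots>"
    using compact_coordinate_prism[OF X(1), of K] lin'(1)
    by (intro compact_continuous_image continuous_intros linear_continuous_on linear_conv_bounded_linear[THEN iffD1])
  ultimately have cU: "compact ?U" by simp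
  then have Um: "?U \<in> lmeasurable" by (rule lmeasurable_compact)
  have "measure lebesgue (coordinate_prism K X) = measure lebesgue (lin ` ?U)"
    unfolding im[symmetric] by (rule measure_translation)
  also have "\<dots> = \<bar>Determinants.det (matrix lin)\<bar> * measure lebesgue ?U"
    by (rule measure_linear_image[OF linear_lin Um])
  finally have m: "measure lebesgue (coordinate_prism K X) = measure lebesgue ?U"
    by (simp add: abs_det_lin)
  have "emeasure param_space ?Y = emeasure lborel ?U"
    by (rule emeasure_PiM_lborel_padded[OF _ \<eta>_inj Y]) (use finite_S in simp)
  also have "\<dots> = emeasure lebesgue ?U"
    using borel_closed[OF compact_imp_closed[OF cU]] by (simp add: emeasure_completion)
  also have "\<dots> = ennreal (measure lebesgue ?U)"
    using Um by (intro emeasure_eq_measure2 fmeasurableD2) 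
  finally show ?thesis unfolding m .
qed

lemma null_set_param:
  fixes w :: "real^'n::{finite,wellorder}"
  assumes "s \<in> S" "w \<bullet> vec s \<noteq> 0"
  shows "{c \<in> space param_space. w \<bullet> param c = 0} \<in> null_sets param_space"
proof -
  let ?Y = "{c \<in> space param_space. w \<bullet> param c = 0}"
  let ?U = "{y :: real^'n::{finite,wellorder}. (\<lambda>s\<in>S - {s0}. y $ \<eta> s) \<in> ?Y \<and> (\<forall>k. k \<notin> \<eta> ` (S - {s0}) \<longrightarrow> y $ k \<in> {0..1})}"
  have "{x. w \<bullet> x = 0} \<in> sets borel" by (intro borel_closed closed_hyperplane)
  from param_vimage_sets[OF this] have Y: "?Y \<in> sets param_space" by simp
  obtain v where v: "\<And>s. s \<in> S - {s0} \<Longrightarrow> v $ \<eta> s = w \<bullet> (vec s - vec s0)" "\<And>k. k \<in> K \<Longrightarrow> v $ k = 0"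
    by (rule lin_surj_vec[of "\<lambda>s. w \<bullet> (vec s - vec s0)" "\<lambda>_. 0"]) blast
  have inner: "v \<bullet> y = (\<Sum>s\<in>S - {s0}. (y $ \<eta> s) * (w \<bullet> (vec s - vec s0)))" for y
  proof -
    have "v \<bullet> y = (\<Sum>k\<in>- K. v $ k * y $ k)"
      unfolding inner_vec_def inner_real_def by (rule sum.mono_neutral_right) (auto simp: v(2))
    also have "\<dots> = (\<Sum>s\<in>S - {s0}. v $ \<eta> s * y $ \<eta> s)"
      using sum.reindex_bij_betw[OF \<eta>, of "\<lambda>k. v $ k * y $ k"] by simp
    finally show ?thesis by (simp add: v(1) mult.commute)
  qed
  have "v \<noteq> 0 \<or> - (w \<bullet> vec s0) \<noteq> 0"
  proof (rule ccontr)
    assume c: "\<not> ?thesis"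
    then have "s \<in> S - {s0}" using assms by auto
    then have "w \<bullet> (vec s - vec s0) = 0" using v(1)[of s] c by simp
    then show False using c assms(2) by (simp add: inner_diff_right)
  qed
  then have "negligible {y. v \<bullet> y = - (w \<bullet> vec s0)}" by (rule negligible_hyperplane)
  moreover have "?U \<subseteq> {y. v \<bullet> y = - (w \<bullet> vec s0)}"
    by (auto simp: inner param_def inner_add_right inner_sum_right)
  ultimately have "negligible ?U" by (rule negligible_subset)
  then have "emeasure lebesgue ?U = 0" by (auto simp: negligible_iff_null_sets null_sets_def)
  moreover have "?U \<in> sets lborel"
  proof -
    let ?r = "\<lambda>y :: real^'n::{finite,wellorder}. \<lambda>s\<in>S - {s0}. y $ \<eta> s"
    have r: "?r \<in> measurable lborel param_space"
      by (intro measurable_restrict) (auto intro!: borel_measurable_continuous_onI continuous_intros)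
    have eq: "?U = ?r -` ?Y \<inter> (\<Inter>k\<in>- \<eta> ` (S - {s0}). {y. 0 \<le> y $ k} \<inter> {y. y $ k \<le> 1})" by auto
    have v: "?r -` ?Y \<in> sets lborel" using measurable_sets[OF r Y] by simp
    have c: "closed (\<Inter>k\<in>- \<eta> ` (S - {s0}). {y :: real^'n::{finite,wellorder}. 0 \<le> y $ k} \<inter> {y. y $ k \<le> 1})"
      by (intro closed_INT ballI closed_Int closed_Collect_le continuous_intros)
    show ?thesis unfolding eq by (rule sets.Int[OF v]) (simp only: sets_lborel borel_closed[OF c])
  qed
  ultimately have "emeasure lborel ?U = 0" by (simp add: emeasure_completion)
  then have "emeasure param_space ?Y = 0"
    using emeasure_PiM_lborel_padded[OF _ \<eta>_inj Y] finite_S by simp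
  then show ?thesis using Y by (intro null_setsI)
qed

lemma convex_hull_in_range: "convex hull (vec ` S) \<subseteq> range (param)"
  and param_in_convex_hull_iff:
    "param c \<in> convex hull (vec ` S) \<longleftrightarrow> (\<forall>s\<in>S - {s0}. 0 \<le> c s) \<and> sum c (S - {s0}) \<le> 1"
proof -
  have hull: "x \<in> convex hull (vec ` S) \<longleftrightarrow> (\<exists>u. (\<forall>s\<in>S. 0 \<le> u s) \<and> sum u S = 1 \<and> (\<Sum>s\<in>S. u s *\<^sub>R vec s) = x)" for x
  proof
    assume "x \<in> convex hull (vec ` S)"
    then obtain u where "\<forall>y\<in>vec ` S. 0 \<le> u y" "sum u (vec ` S) = 1" "(\<Sum>y\<in>vec ` S. u y *\<^sub>R y) = x"
      using finite_S by (auto simp: convex_hull_finite)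
    then show "\<exists>u. (\<forall>s\<in>S. 0 \<le> u s) \<and> sum u S = 1 \<and> (\<Sum>s\<in>S. u s *\<^sub>R vec s) = x"
      using inj_vec by (intro exI[of _ "u \<circ> vec"]) (simp add: sum.reindex o_def)
  next
    assume "\<exists>u. (\<forall>s\<in>S. 0 \<le> u s) \<and> sum u S = 1 \<and> (\<Sum>s\<in>S. u s *\<^sub>R vec s) = x"
    then obtain u where u: "\<forall>s\<in>S. 0 \<le> u s" "sum u S = 1" "(\<Sum>s\<in>S. u s *\<^sub>R vec s) = x" by blast
    show "x \<in> convex hull (vec ` S)"
      unfolding u(3)[symmetric] using u(1,2) finite_S by (intro convex_sum convex_convex_hull) (auto intro: hull_inc)
  qed
  have conv: "(\<Sum>s\<in>S. u s *\<^sub>R vec s) = param u" if "sum u S = 1" for u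
  proof -
    have "u s0 = 1 - sum u (S - {s0})" using that finite_S s0 by (simp add: sum.remove)
    then have "(\<Sum>s\<in>S. u s *\<^sub>R vec s) = (1 - sum u (S - {s0})) *\<^sub>R vec s0 + (\<Sum>s\<in>S - {s0}. u s *\<^sub>R vec s)"
      using finite_S s0 by (simp add: sum.remove)
    then show ?thesis
      by (simp add: param_def algebra_simps sum_subtractf scaleR_sum_left)
  qed
  show "convex hull (vec ` S) \<subseteq> range (param)"
    using conv by (auto simp: hull)
  show "param c \<in> convex hull (vec ` S) \<longleftrightarrow> (\<forall>s\<in>S - {s0}. 0 \<le> c s) \<and> sum c (S - {s0}) \<le> 1"
  proof
    assume "param c \<in> convex hull (vec ` S)"
    then obtain u where u: "\<forall>s\<in>S. 0 \<le> u s" "sum u S = 1" "param u = param c"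
      using conv by (auto simp: hull)
    have eq: "c s = u s" if "s \<in> S - {s0}" for s using param_eqD[OF u(3) that] by simp
    have "sum u (S - {s0}) = 1 - u s0" using u(2) finite_S s0 by (simp add: sum.remove)
    then show "(\<forall>s\<in>S - {s0}. 0 \<le> c s) \<and> sum c (S - {s0}) \<le> 1" using u(1) eq s0 by auto
  next
    assume c: "(\<forall>s\<in>S - {s0}. 0 \<le> c s) \<and> sum c (S - {s0}) \<le> 1"
    define u where "u = c(s0 := 1 - sum c (S - {s0}))"
    have u': "sum u (S - {s0}) = sum c (S - {s0})" by (intro sum.cong) (auto simp: u_def)
    have 1: "sum u S = 1" using finite_S s0 u' by (simp add: sum.remove u_def)
    have "param u = param c"
      unfolding param_def by (intro arg_cong2[of _ _ _ _ "(+)"] sum.cong) (auto simp: u_def)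
    moreover have "\<forall>s\<in>S. 0 \<le> u s" using c by (auto simp: u_def)
    ultimately show "param c \<in> convex hull (vec ` S)"
      using conv[OF 1] 1 by (auto simp: hull)
  qed
qed

lemma emeasure_simplex:
  "emeasure param_space {c \<in> space param_space. param c \<in> convex hull (vec ` S)} = ennreal (1 / fact (card (S - {s0})))"
proof -
  have "{c \<in> space param_space. param c \<in> convex hull (vec ` S)} =
      {x. (\<forall>i\<in>S - {s0}. 0 \<le> x i) \<and> sum x (S - {s0}) \<le> 1} \<inter> space param_space"
    by (auto simp: param_in_convex_hull_iff)
  then show ?thesis
    using emeasure_std_simplex_aux[of "S - {s0}" 1] finite_S by simp
qed

lemma measure_prism_simplex:
  "measure lebesgue (coordinate_prism K (convex hull (vec ` S))) = 1 / fact (card (S - {s0}))"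
proof -
  have "compact (convex hull (vec ` S))" using finite_S by (intro compact_convex_hull finite_imp_compact finite_imageI)
  from emeasure_param[OF this convex_hull_in_range]
  show ?thesis by (simp add: emeasure_simplex)
qed

end

section \<open>Representations of a generic point by spanning trees\<close>

context plane_hypermap
begin

abbreviation "V \<equiv> VA \<union> VB"

text \<open>
  The vector \<open>x\<close> is a non-negative combination of the edges outside \<open>S\<close>. Coefficients are
  extended by zero so that they are determined by their values on \<open>E - S\<close>.
\<close>

definition represents :: "'e set \<Rightarrow> ('v \<Rightarrow> real) \<Rightarrow> ('e \<Rightarrow> real) \<Rightarrow> bool" where
  "represents S x c \<longleftrightarrow> (\<forall>e. 0 \<le> c e) \<and> (\<forall>e. e \<in> S \<or> e \<notin> E \<longrightarrow> c e = 0) \<and>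
     (\<forall>v\<in>V. (\<Sum>e\<in>E. c e * incidence a b e v) = x v)"

text \<open>
  The faces of all simplices spanned by trees lie in the hyperplanes that are excluded here, since
  the edges of a proper face do not connect the graph.
\<close>

definition generic :: "('v \<Rightarrow> real) \<Rightarrow> bool" where
  "generic x \<longleftrightarrow> (\<forall>X\<subseteq>V. X \<noteq> {} \<longrightarrow> X \<noteq> V \<longrightarrow> (\<Sum>v\<in>X. x v) \<noteq> 0)"

definition support :: "('e \<Rightarrow> real) \<Rightarrow> 'e set" where
  "support c = {e \<in> E. c e \<noteq> 0}"

text \<open>
  A cut of the dual, seen as a circulation of the graph; adding a multiple of it to a representation
  does not change the represented point.
\<close>

definition cut_vector :: "'f set \<Rightarrow> 'e \<Rightarrow> real" where
  "cut_vector X e = of_bool (L e \<in> X) - of_bool (R e \<in> X)"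

lemma representsD:
  assumes "represents S x c"
  shows "0 \<le> c e" "e \<in> S \<Longrightarrow> c e = 0" "e \<notin> E \<Longrightarrow> c e = 0"
    "v \<in> V \<Longrightarrow> (\<Sum>e\<in>E. c e * incidence a b e v) = x v"
  using assms by (auto simp: represents_def)

lemma finite_support: "finite (support c)"
  using finite_E by (simp add: support_def)

lemma support_connects:
  assumes "generic x" "represents S x c"
  shows "connects (support c) a b V"
  unfolding connects_def
proof (intro conjI allI impI)
  show "finite (support c)" by (rule finite_support)
  show "finite V" "V \<noteq> {}" "a ` support c \<subseteq> V" "b ` support c \<subseteq> V"
    using finite_E nonempty by (auto simp: support_def)
  fix X assume X: "X \<subseteq> V" "X \<noteq> {}" "X \<noteq> V"
  show "\<exists>e\<in>support c. crosses a b X e"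
  proof (rule ccontr)
    assume no: "\<not> (\<exists>e\<in>support c. crosses a b X e)"
    have finX: "finite X" using X(1) finite_E by (auto intro: finite_subset)
    have "(\<Sum>v\<in>X. x v) = (\<Sum>v\<in>X. \<Sum>e\<in>E. c e * incidence a b e v)"
      using X(1) representsD(4)[OF assms(2)] by (intro sum.cong) auto
    also have "\<dots> = (\<Sum>e\<in>E. c e * (\<Sum>v\<in>X. incidence a b e v))"
      unfolding sum_distrib_left by (rule sum.swap)
    also have "\<dots> = 0"
      using no by (intro sum.neutral) (auto simp: sum_incidence[OF finX] support_def crosses_def)
    finally show False using assms(1) X by (auto simp: generic_def)
  qed
qed

lemma cut_vector_circulation:
  assumes "v \<in> V"
  shows "(\<Sum>e\<in>E. cut_vector X e * incidence a b e v) = 0"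
  unfolding cut_vector_def by (rule graph_dual.coboundary_is_circulation[OF assms])

lemma sum_cut_vector: "(\<Sum>e\<in>E. cut_vector X e) = 0"
  using sum_\<alpha>[of "\<lambda>e. of_bool (R e \<in> X) :: real"] by (simp add: cut_vector_def sum_subtractf L_def)

text \<open>
  A pivot step: the coefficients move along the circulation until the first of them vanishes.
\<close>

lemma represents_move:
  assumes c: "represents S x c"
    and d: "\<And>e. e \<in> S \<Longrightarrow> e \<in> E \<Longrightarrow> cut_vector X e = 0" "\<And>e. e \<in> E \<Longrightarrow> cut_vector X e < 0 \<Longrightarrow> c e \<noteq> 0"
    and neg: "\<exists>e\<in>E. cut_vector X e < 0"
  shows "\<exists>t>0. represents S x (\<lambda>e. if e \<in> E then c e + t * cut_vector X e else 0) \<and>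
    (\<exists>e\<in>E. c e \<noteq> 0 \<and> cut_vector X e < 0 \<and> c e + t * cut_vector X e = 0)"
proof -
  let ?d = "cut_vector X"
  let ?N = "{e \<in> E. ?d e < 0}"
  define t where "t = Min ((\<lambda>e. c e / - ?d e) ` ?N)"
  have N: "finite ?N" "?N \<noteq> {}" using finite_E neg by auto
  then have "t \<in> (\<lambda>e. c e / - ?d e) ` ?N" unfolding t_def by (intro Min_in) auto
  then obtain e0 where e0: "e0 \<in> E" "?d e0 < 0" "t = c e0 / - ?d e0" by auto
  have c0: "c e0 > 0" using d(2)[OF e0(1,2)] representsD(1)[OF c, of e0] by simp
  have t: "t > 0" unfolding e0(3) using c0 e0(2) by (intro divide_pos_pos) auto
  have le: "t \<le> c e / - ?d e" if "e \<in> E" "?d e < 0" for e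
    unfolding t_def using N that by (intro Min_le) auto
  have nonneg: "0 \<le> c e + t * ?d e" if "e \<in> E" for e
  proof (cases "?d e < 0")
    case True
    then have "t * - ?d e \<le> c e" using le[OF that True] by (simp only: pos_le_divide_eq neg_0_less_iff_less)
    then show ?thesis by simp
  next
    case False
    then show ?thesis using t representsD(1)[OF c, of e] by simp
  qed
  have "represents S x (\<lambda>e. if e \<in> E then c e + t * ?d e else 0)"
    unfolding represents_def
  proof (intro conjI allI ballI impI)
    fix v assume v: "v \<in> V"
    have "(\<Sum>e\<in>E. (if e \<in> E then c e + t * ?d e else 0) * incidence a b e v) =
        (\<Sum>e\<in>E. c e * incidence a b e v + t * (?d e * incidence a b e v))"
      by (intro sum.cong refl) (simp add: algebra_simps)
    also have "\<dots> = (\<Sum>e\<in>E. c e * incidence a b e v) + t * (\<Sum>e\<in>E. ?d e * incidence a b e v)"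
      by (simp only: sum.distrib sum_distrib_left)
    also have "\<dots> = x v"
      using representsD(4)[OF c v] cut_vector_circulation[OF v, of X] by simp
    finally show "(\<Sum>e\<in>E. (if e \<in> E then c e + t * ?d e else 0) * incidence a b e v) = x v" .
  next
    fix e show "0 \<le> (if e \<in> E then c e + t * ?d e else 0)" using nonneg by simp
    assume "e \<in> S \<or> e \<notin> E"
    then show "(if e \<in> E then c e + t * ?d e else 0) = 0" using d(1) representsD(2)[OF c] by auto
  qed
  moreover have "c e0 + t * ?d e0 = 0" unfolding e0(3) using e0(2) by (simp add: field_simps)
  moreover have "c e0 \<noteq> 0" using c0 by simp
  ultimately show ?thesis using t e0(1,2) by blast
qed

lemma cut_vector_negative:
  assumes "e \<in> E" "cut_vector X e \<noteq> 0"
  shows "\<exists>e\<in>E. cut_vector X e < 0"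
proof (rule ccontr)
  assume "\<not> ?thesis"
  then have "0 \<le> cut_vector X e" if "e \<in> E" for e using that by (meson not_less)
  then show False
    using sum_cut_vector[of X] sum_nonneg_eq_0_iff[OF finite_E, of "cut_vector X"] assms by blast
qed

text \<open>
  A representation of minimal support is supported by a tree. Otherwise an edge \<open>e1\<close> of the
  support closes a cycle with a spanning tree within the support, and moving along this cycle
  makes the support smaller.
\<close>

lemma represents_tree_exists:
  assumes gen: "generic x" and c0: "represents S x c0"
  shows "\<exists>c. represents S x c \<and> spans_tree (support c) a b V"
proof -
  obtain c where c: "represents S x c" and least: "\<And>c'. represents S x c' \<Longrightarrow> card (support c) \<le> card (support c')"
    using ex_has_least_nat[of "represents S x" c0 "\<lambda>c. card (support c)"] c0 by blast
  obtain T where T: "T \<subseteq> support c" "spans_tree T a b V"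
    using spans_tree_exists[OF support_connects[OF gen c]] by blast
  have "T = support c"
  proof (rule ccontr)
    assume "T \<noteq> support c"
    then obtain e1 where e1: "e1 \<in> support c" "e1 \<notin> T" using T(1) by blast
    have TE: "T \<subseteq> E" using T(1) by (auto simp: support_def)
    have "e1 \<in> E - T" using e1 by (auto simp: support_def)
    obtain f where "f \<in> F" using nonempty by blast
    from fundamental_cut[OF graph_dual.complement_spanning_tree[OF T(2) TE] \<open>e1 \<in> E - T\<close> this]
    obtain X where X: "\<And>e'. e' \<in> E - T \<Longrightarrow> crosses L R X e' \<longleftrightarrow> e' = e1" by blast
    have zero: "cut_vector X e = 0" if "e \<in> E" "c e = 0" for e
    proof -
      have "e \<in> E - T" "e \<noteq> e1" using that T(1) e1(1) by (auto simp: support_def)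
      then have "\<not> crosses L R X e" using X by blast
      then show ?thesis by (auto simp: cut_vector_def crosses_def)
    qed
    have "crosses L R X e1" using X \<open>e1 \<in> E - T\<close> by blast
    then have "cut_vector X e1 \<noteq> 0" by (auto simp: cut_vector_def crosses_def)
    then have neg: "\<exists>e\<in>E. cut_vector X e < 0"
      using \<open>e1 \<in> E - T\<close> by (intro cut_vector_negative) auto
    have cutS: "cut_vector X e = 0" if "e \<in> S" "e \<in> E" for e
      using zero representsD(2)[OF c that(1)] that(2) by blast
    obtain t where t: "t > 0" "represents S x (\<lambda>e. if e \<in> E then c e + t * cut_vector X e else 0)"
      "\<exists>e\<in>E. c e \<noteq> 0 \<and> cut_vector X e < 0 \<and> c e + t * cut_vector X e = 0"
      using represents_move[OF c cutS _ neg] zero by fastforce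
    let ?c = "\<lambda>e. if e \<in> E then c e + t * cut_vector X e else 0"
    have "support ?c \<subset> support c" using t(3) zero by (auto simp: support_def)
    then have "card (support ?c) < card (support c)" by (intro psubset_card_mono finite_support)
    then show False using least[OF t(2)] by simp
  qed
  then show ?thesis using c T(2) by blast
qed

lemma represents_tree_unique:
  assumes "represents S x c" "represents S' x c'" "support c = support c'" "spans_tree (support c) a b V"
  shows "c = c'"
proof
  fix e
  have "(\<Sum>e\<in>support c. (c e - c' e) * incidence a b e v) = 0" if "v \<in> V" for v
  proof -
    have "(\<Sum>e\<in>support c. (c e - c' e) * incidence a b e v) = (\<Sum>e\<in>E. (c e - c' e) * incidence a b e v)"
      using finite_E assms(3) by (intro sum.mono_neutral_left) (auto simp: support_def)
    then show ?thesis
      using representsD(4)[OF assms(1) that] representsD(4)[OF assms(2) that]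
      by (simp add: left_diff_distrib sum_subtractf)
  qed
  then have "c e - c' e = 0" if "e \<in> support c" for e
    using spans_tree_independent[OF assms(4) that, of "\<lambda>e. c e - c' e"] by simp
  moreover have "c e = 0 \<and> c' e = 0" if "e \<notin> support c"
    using that representsD(3)[OF assms(1), of e] representsD(3)[OF assms(2), of e] assms(3) by (auto simp: support_def)
  ultimately show "c e = c' e" by fastforce
qed

text \<open>
  Two representations of the same point differ by a circulation, which is the coboundary of a
  function on the faces; it is normalised at \<open>f0\<close>.
\<close>

definition potential :: "'f \<Rightarrow> ('e \<Rightarrow> real) \<Rightarrow> ('e \<Rightarrow> real) \<Rightarrow> ('f \<Rightarrow> real) \<Rightarrow> bool" where
  "potential f0 c0 c \<phi> \<longleftrightarrow> \<phi> f0 = 0 \<and> (\<forall>e\<in>E. c e - c0 e = \<phi> (L e) - \<phi> (R e))"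

lemma potential_exists:
  assumes "represents S x c0" "represents S' x c" "f0 \<in> F"
  shows "\<exists>\<phi>. potential f0 c0 c \<phi>"
proof -
  have "(\<Sum>e\<in>E. (c e - c0 e) * incidence a b e v) = 0" if "v \<in> V" for v
    using representsD(4)[OF assms(1) that] representsD(4)[OF assms(2) that]
    by (simp add: left_diff_distrib sum_subtractf)
  from graph_dual.circulation_is_coboundary[OF this assms(3)] show ?thesis
    by (auto simp: potential_def)
qed

lemma potential_unique:
  assumes "potential f0 c0 c \<phi>" "potential f0 c0 c \<phi>'" "f0 \<in> F" "f \<in> F"
  shows "\<phi> f = \<phi>' f"
proof -
  have "\<phi> f - \<phi>' f = \<phi> f0 - \<phi>' f0"
  proof (rule connects_constant[OF connects_dual, where \<phi> = "\<lambda>f. \<phi> f - \<phi>' f"])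
    fix e assume "e \<in> E"
    then have "c e - c0 e = \<phi> (L e) - \<phi> (R e)" "c e - c0 e = \<phi>' (L e) - \<phi>' (R e)"
      using assms(1,2) by (auto simp: potential_def)
    then show "\<phi> (L e) - \<phi>' (L e) = \<phi> (R e) - \<phi>' (R e)" by linarith
  qed (use assms in auto)
  then show ?thesis using assms by (simp add: potential_def)
qed

text \<open>
  Among the tree representations of \<open>x\<close>, choose one for which the sum of the potentials is
  maximal. If some edge \<open>e\<close> of its dual tree, not in \<open>S\<close>, pointed away from \<open>f0\<close>, a pivot step along
  the fundamental cut of \<open>e\<close> would add a positive amount to the potentials of all faces on the
  side without \<open>f0\<close>.
\<close>

lemma dissection_exists:
  assumes gen: "generic x" and c0: "represents S x c0" and f0: "f0 \<in> F" and S: "S \<subseteq> E"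
  shows "\<exists>T\<in>trees_over f0 S. \<exists>c. represents T x c"
proof -
  let ?C = "{c. represents S x c \<and> spans_tree (support c) a b V}"
  have "inj_on support ?C" using represents_tree_unique by (intro inj_onI) blast
  moreover have "support ` ?C \<subseteq> Pow E" by (auto simp: support_def)
  ultimately have "finite ?C" using finite_E by (meson finite_Pow_iff finite_imageD finite_subset)
  moreover have "?C \<noteq> {}" using represents_tree_exists[OF gen c0] by blast
  \<comment> \<open>by \<open>potential_unique\<close> the value does not depend on the choice of the potential\<close>
  moreover define val where "val c = (\<Sum>f\<in>F. (SOME \<phi>. potential f0 c0 c \<phi>) f)" for c
  ultimately have M: "Max (val ` ?C) \<in> val ` ?C" "\<And>c. c \<in> ?C \<Longrightarrow> val c \<le> Max (val ` ?C)"
    by (auto intro!: Max_in Max_ge)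
  then obtain c where "c \<in> ?C" "Max (val ` ?C) = val c" by blast
  with M(2) have c: "represents S x c" "spans_tree (support c) a b V"
    and max: "\<And>c'. c' \<in> ?C \<Longrightarrow> val c' \<le> val c" by auto
  have val: "val c' = (\<Sum>f\<in>F. \<phi> f)" if "represents S x c'" "potential f0 c0 c' \<phi>" for c' \<phi>
    unfolding val_def using potential_unique[OF someI_ex[OF potential_exists[OF c0 that(1) f0]] that(2) f0]
    by (intro sum.cong) auto
  let ?T = "E - support c"
  have sub: "support c \<subseteq> E" by (auto simp: support_def)
  note tree = graph_dual.complement_spanning_tree[OF c(2) sub]
  have ST: "S \<subseteq> ?T" using S representsD(2)[OF c(1)] by (auto simp: support_def)
  have tow: "e \<in> towards f0 ?T" if e: "e \<in> ?T - S" for e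
  proof -
    have eT: "e \<in> ?T" using e by blast
    from fundamental_cut[OF tree this f0] obtain X where
      X: "X \<subseteq> F - {f0}" "\<And>e'. e' \<in> ?T \<Longrightarrow> crosses L R X e' \<longleftrightarrow> e' = e" by blast
    have "crosses L R X e" using X(2) eT by blast
    then consider "R e \<in> X" "L e \<notin> X" | "L e \<in> X" "R e \<notin> X" by (auto simp: crosses_def)
    then show ?thesis
    proof cases
      case 1
      then show ?thesis using X eT unfolding towards_def by blast
    next
      case 2
      then have de: "cut_vector X e = 1" by (simp add: cut_vector_def)
      have zero: "cut_vector X e' = 0" if "e' \<in> ?T" "e' \<noteq> e" for e'
        using X(2)[OF that(1)] that(2) by (auto simp: cut_vector_def crosses_def)
      have neg: "\<exists>e\<in>E. cut_vector X e < 0"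
        using de eT by (intro cut_vector_negative[of e]) auto
      have "cut_vector X e' = 0" if "e' \<in> S" "e' \<in> E" for e' using zero[of e'] ST e that by blast
      moreover have "c e' \<noteq> 0" if "e' \<in> E" "cut_vector X e' < 0" for e'
        using zero[of e'] that de by (cases "e' = e") (auto simp: support_def)
      ultimately obtain t where t: "t > 0"
        "represents S x (\<lambda>e. if e \<in> E then c e + t * cut_vector X e else 0)"
        "\<exists>e\<in>E. c e \<noteq> 0 \<and> cut_vector X e < 0 \<and> c e + t * cut_vector X e = 0"
        using represents_move[OF c(1) _ _ neg] by blast
      define c' where "c' = (\<lambda>e. if e \<in> E then c e + t * cut_vector X e else 0)"
      \<comment> \<open>the edge \<open>e\<close> enters the support and \<open>e1\<close> leaves it\<close>
      obtain e1 where e1: "e1 \<in> E" "c e1 \<noteq> 0" "c' e1 = 0" using t(3) by (auto simp: c'_def)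
      have "support c' \<subseteq> insert e (support c - {e1})"
        using zero e1(3) by (auto simp: support_def c'_def)
      then have "card (support c') \<le> card (insert e (support c - {e1}))"
        by (intro card_mono) (auto simp: finite_support)
      also have "\<dots> \<le> Suc (card (support c - {e1}))"
        by (rule card_insert_le_m1) auto
      also have "\<dots> = card (support c)"
        using e1 by (intro card_Suc_Diff1 finite_support) (simp add: support_def)
      finally have "card (support c') + 1 \<le> card V" using spans_treeD(2)[OF c(2)] by simp
      moreover have conn: "connects (support c') a b V"
        using support_connects[OF gen t(2)] by (simp add: c'_def)
      ultimately have "spans_tree (support c') a b V"
        using connects_card_le[OF conn] by (simp add: spans_tree_def)
      then have "val c' \<le> val c" using t(2) by (intro max) (simp add: c'_def)
      moreover obtain \<phi> where \<phi>: "potential f0 c0 c \<phi>" using potential_exists[OF c0 c(1) f0] by blast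
      moreover have "potential f0 c0 c' (\<lambda>f. \<phi> f + t * of_bool (f \<in> X))"
        using \<phi> X(1) by (auto simp: potential_def c'_def cut_vector_def algebra_simps)
      ultimately have "(\<Sum>f\<in>F. \<phi> f + t * of_bool (f \<in> X)) \<le> (\<Sum>f\<in>F. \<phi> f)"
        using val[OF c(1) \<phi>] val[of c'] t(2) by (simp add: c'_def)
      then have "t * (\<Sum>f\<in>F. of_bool (f \<in> X)) \<le> 0" by (simp add: sum.distrib sum_distrib_left)
      moreover have "(\<Sum>f\<in>F. of_bool (f \<in> X) :: real) > 0"
        using 2(1) X(1) finite_E by (intro sum_pos2[of F "L e"]) auto
      ultimately show ?thesis using t(1) by (simp add: mult_le_0_iff)
    qed
  qed
  have "?T \<in> trees_over f0 S"
    using tree ST tow by (auto simp: trees_over_def dual_trees_def)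
  moreover have "represents ?T x c"
    using c(1) by (auto simp: represents_def support_def)
  ultimately show ?thesis by blast
qed

text \<open>
  Walking along the tree from a face to \<open>f0\<close>, the potential never decreases: an edge of \<open>S\<close> does not
  change it, and an edge that points towards \<open>f0\<close> is followed in its direction, from \<open>R e\<close> to \<open>L e\<close>.
\<close>

lemma potential_sign:
  assumes T: "T \<in> trees_over f0 S" and f0: "f0 \<in> F"
    and \<phi>: "\<phi> f0 = (0 :: real)" "\<And>e. e \<in> T \<Longrightarrow> \<phi> (R e) \<le> \<phi> (L e)" "\<And>e. e \<in> S \<Longrightarrow> \<phi> (R e) = \<phi> (L e)"
    and f: "f \<in> F"
  shows "\<phi> f \<le> 0"
proof -
  have "T \<in> dual_trees" using T by (simp add: trees_over_def)
  then obtain k r where arb: "arborescence f0 k r" and kT: "arb_edges f0 k = T"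
    using arborescence_of_tree[OF _ f0, of T] unfolding arborescences_def by blast
  show ?thesis using f
  proof (induction "r f" arbitrary: f rule: less_induct)
    case less
    show ?case
    proof (cases "f = f0")
      case False
      obtain e h where h: "k f = Some (e, R e = f)" "h \<in> F" "r h < r f" "R e = f \<and> L e = h \<or> L e = f \<and> R e = h"
        by (rule arborescence_step[OF arb less.prems False])
      have eT: "e \<in> T" unfolding kT[symmetric] arb_edges_def using less.prems False h(1) by force
      have "\<phi> f \<le> \<phi> h"
      proof (cases "e \<in> S")
        case True
        then show ?thesis using \<phi>(3) h(4) by auto
      next
        case False
        then have "e \<in> towards f0 T" using T eT by (auto simp: trees_over_def)
        then have "R e = f" using arb_towards[OF arb f0 less.prems \<open>f \<noteq> f0\<close> h(1)] kT by simp
        then show ?thesis using \<phi>(2)[OF eT] h(3,4) by auto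
      qed
      then show ?thesis using less.hyps[OF h(3,2)] by linarith
    qed (simp add: \<phi>)
  qed
qed

text \<open>
  By genericity the support connects the graph, so it cannot be smaller than a spanning tree.
\<close>

lemma tree_support:
  assumes gen: "generic x" and T: "T \<in> dual_trees" and c: "represents T x c"
  shows "support c = E - T"
proof (rule card_subset_eq)
  have T': "T \<subseteq> E" "card T + 1 = card F" using T by (auto simp: dual_trees_def spans_tree_def)
  show "finite (E - T)" using finite_E by simp
  show sub: "support c \<subseteq> E - T" using representsD(2)[OF c] by (auto simp: support_def)
  have "card (E - T) + 1 = card V"
    using T' graph_dual.euler_count card_mono[OF finite_E T'(1)] finite_subset[OF T'(1) finite_E]
    by (simp add: card_Diff_subset)
  then show "card (support c) = card (E - T)"
    using connects_card_le[OF support_connects[OF gen c]] card_mono[OF _ sub] finite_E by simp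
qed

text \<open>
  Outside its own support, a representation has coefficient zero and the other one is non-negative.
  So \<open>potential_sign\<close> applies to the potential between the two representations as well as to its
  negative, and both representations coincide.
\<close>

lemma dissection_unique:
  assumes gen: "generic x" and f0: "f0 \<in> F"
    and T: "T \<in> trees_over f0 S" "represents T x c" and T': "T' \<in> trees_over f0 S" "represents T' x c'"
  shows "T = T'"
proof -
  have D: "T \<in> dual_trees" "T' \<in> dual_trees" "S \<subseteq> T" "S \<subseteq> T'" "T \<subseteq> E" "T' \<subseteq> E"
    using T(1) T'(1) by (auto simp: trees_over_def dual_trees_def)
  obtain \<phi> where \<phi>: "potential f0 c c' \<phi>" using potential_exists[OF T(2) T'(2) f0] by blast
  have d: "c' e - c e = \<phi> (L e) - \<phi> (R e)" if "e \<in> E" for e using \<phi> that by (simp add: potential_def)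
  have S_eq: "\<phi> (R e) = \<phi> (L e)" if "e \<in> S" for e
  proof -
    have "e \<in> T" "e \<in> T'" "e \<in> E" using D that by blast+
    then show ?thesis using d[of e] representsD(2)[OF T(2), of e] representsD(2)[OF T'(2), of e] by simp
  qed
  have le: "\<phi> f \<le> 0" if "f \<in> F" for f
  proof (rule potential_sign[OF T(1) f0 _ _ _ that])
    show "\<phi> (R e) \<le> \<phi> (L e)" if "e \<in> T" for e
      using d[of e] representsD(2)[OF T(2) that] representsD(1)[OF T'(2), of e] D(5) that by auto
    show "\<phi> (R e) = \<phi> (L e)" if "e \<in> S" for e
      by (rule S_eq[OF that])
  qed (use \<phi> in \<open>simp add: potential_def\<close>)
  have ge: "- \<phi> f \<le> 0" if "f \<in> F" for f
  proof (rule potential_sign[OF T'(1) f0 _ _ _ that])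
    show "- \<phi> (R e) \<le> - \<phi> (L e)" if "e \<in> T'" for e
      using d[of e] representsD(2)[OF T'(2) that] representsD(1)[OF T(2), of e] D(6) that by auto
    show "- \<phi> (R e) = - \<phi> (L e)" if "e \<in> S" for e
      using S_eq[OF that] by simp
  qed (use \<phi> in \<open>simp add: potential_def\<close>)
  have "c e = c' e" if "e \<in> E" for e
    using d[OF that] le[of "L e"] ge[of "L e"] le[of "R e"] ge[of "R e"] L_in[OF that] that by auto
  then have "support c = support c'" by (auto simp: support_def)
  then have "E - T = E - T'" using tree_support[OF gen D(1) T(2)] tree_support[OF gen D(2) T'(2)] by simp
  then show ?thesis using D(5,6) by blast
qed

end

section \<open>The volume of a root polytope\<close>

locale plane_hypermap_points =
  plane_hypermap E \<alpha> \<beta> a b R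
  for E :: "'e set" and \<alpha> \<beta> :: "'e \<Rightarrow> 'e" and a b :: "'e \<Rightarrow> 'n::{finite,wellorder}" and R :: "'e \<Rightarrow> 'f"
begin

definition pt :: "'e \<Rightarrow> real^'n::{finite,wellorder}" where
  "pt e = axis (a e) 1 - axis (b e) 1"

lemma pt_nth: "pt e $ v = incidence a b e v"
  by (simp add: pt_def incidence_def axis_def)

lemma sum_pt_nth: "(\<Sum>e\<in>T. c e *\<^sub>R pt e) $ v = (\<Sum>e\<in>T. c e * incidence a b e v)"
  by (simp add: pt_nth)

lemma pt_independent:
  assumes "spans_tree T a b V" "(\<Sum>e\<in>T. c e *\<^sub>R pt e) = 0" "e \<in> T"
  shows "c e = 0"
proof (rule spans_tree_independent[OF assms(1,3)])
  fix v show "(\<Sum>e\<in>T. c e * incidence a b e v) = 0"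
    unfolding sum_pt_nth[symmetric] assms(2) by simp
qed

lemma pt_inj_on_tree:
  assumes "spans_tree T a b V"
  shows "inj_on pt T"
proof (rule inj_onI, rule ccontr)
  fix e e' assume e: "e \<in> T" "e' \<in> T" "pt e = pt e'" "e \<noteq> e'"
  have fin: "finite T" using spans_treeD(1)[OF assms] by (rule connectsD)
  define c :: "'e \<Rightarrow> real" where "c x = (if x = e then 1 else if x = e' then - 1 else 0)" for x
  have "(\<Sum>x\<in>T. c x *\<^sub>R pt x) = (\<Sum>x\<in>T. (if x = e then pt e else 0) - (if x = e' then pt e' else 0))"
    using e by (intro sum.cong) (auto simp: c_def)
  also have "\<dots> = 0" using e fin by (simp add: sum_subtractf)
  finally have "c e = 0" using pt_independent[OF assms _ e(1)] by blast
  then show False by (simp add: c_def)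
qed

text \<open>
  The differences of edge points have coordinate sum zero on each side of the graph. To complete
  them to a basis of the integer lattice, one reference vertex on each side is needed in addition to
  the coordinates that are not vertices.
\<close>

definition outside :: "'e \<Rightarrow> 'n set" where
  "outside e0 = - (V - {a e0, b e0})"

lemma ab_neq: "e \<in> E \<Longrightarrow> e' \<in> E \<Longrightarrow> a e \<noteq> b e'"
  using disjoint_sides by blast

text \<open>
  For a vertex \<open>k\<close> and the reference vertex \<open>k0\<close> on the same side, the difference of the unit vectors
  is an integer combination of tree edges. The coefficients add up to zero, as one sees by summing
  coordinates over one side, so it is a combination of differences of edge points.
\<close>

lemma tree_frame:
  assumes T: "spans_tree T a b V" "T \<subseteq> E" and emb: "\<And>e. e \<in> T \<Longrightarrow> emb (P e) = pt e"
    and e0: "e0 \<in> E" and s0: "s0 \<in> P ` T"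
  shows "unimodular_frame (P ` T) s0 emb (outside e0)"
proof -
  note conn = spans_treeD(1)[OF T(1)]
  have fin: "finite T" using conn by (rule connectsD)
  have injP: "inj_on P T" using pt_inj_on_tree[OF T(1)] emb by (metis inj_on_def)
  obtain t0 where t0: "t0 \<in> T" "s0 = P t0" using s0 by blast
  have abV: "a e0 \<in> V" "b e0 \<in> V" using e0 by auto
  have span: "\<exists>c u. (\<forall>s\<in>P ` T. c s \<in> \<int>) \<and> (\<forall>j\<in>outside e0. u j \<in> \<int>) \<and>
       axis k 1 = (\<Sum>s\<in>P ` T - {s0}. c s *\<^sub>R (emb s - emb s0)) + (\<Sum>j\<in>outside e0. u j *\<^sub>R axis j 1)" for k
  proof (cases "k \<in> outside e0")
    case True
    then have "axis k 1 = (\<Sum>j\<in>outside e0. of_bool (j = k) *\<^sub>R axis j (1::real))"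
      by (simp add: of_bool_def if_distrib[of "\<lambda>x. x *\<^sub>R _"] sum.delta' cong: if_cong)
    then show ?thesis by (intro exI[of _ "\<lambda>_. 0"] exI[of _ "\<lambda>j. of_bool (j = k)"]) auto
  next
    case False
    then have kV: "k \<in> V" by (auto simp: outside_def)
    define k0 where "k0 = (if k \<in> VA then a e0 else b e0)"
    have k0V: "k0 \<in> V" using abV by (auto simp: k0_def)
    have same: "k \<in> VA \<longleftrightarrow> k0 \<in> VA" using e0 disjoint_sides by (auto simp: k0_def)
    obtain m :: "'e \<Rightarrow> int" where m: "\<And>u. (\<Sum>e\<in>T. m e * incidence a b e u) = of_bool (u = k) - of_bool (u = k0)"
      using connects_integer_combination[OF conn kV k0V] by blast
    have mr: "(\<Sum>e\<in>T. of_int (m e) * incidence a b e u) = (of_bool (u = k) - of_bool (u = k0) :: real)" for u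
    proof -
      have "(\<Sum>e\<in>T. of_int (m e) * incidence a b e u :: real) = of_int (\<Sum>e\<in>T. m e * incidence a b e u)"
        by (simp add: incidence_def)
      then show ?thesis unfolding m by simp
    qed
    have eq: "(\<Sum>e\<in>T. of_int (m e) *\<^sub>R pt e) = axis k 1 - axis k0 1"
      by (simp add: Finite_Cartesian_Product.vec_eq_iff pt_nth mr axis_def)
    have "0 = (\<Sum>u\<in>VA. of_bool (u = k) - of_bool (u = k0) :: real)"
      using same finite_E by (auto simp: sum_subtractf of_bool_def sum.delta)
    also have "\<dots> = (\<Sum>e\<in>T. \<Sum>u\<in>VA. of_int (m e) * incidence a b e u)"
      unfolding mr[symmetric] by (rule sum.swap)
    also have "\<dots> = (\<Sum>e\<in>T. of_int (m e))"
      unfolding sum_distrib_left[symmetric]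
    proof (rule sum.cong[OF refl])
      fix e assume "e \<in> T"
      then have "a e \<in> VA" "b e \<notin> VA" using T(2) disjoint_sides by blast+
      then show "of_int (m e) * (\<Sum>u\<in>VA. incidence a b e u) = (of_int (m e) :: real)"
        using finite_E by (simp add: sum_incidence)
    qed
    finally have zero: "(\<Sum>e\<in>T. of_int (m e) :: real) = 0" by simp
    define c :: "_ \<Rightarrow> real" where "c s = of_int (m (inv_into T P s))" for s
    have c: "c (P e) = of_int (m e)" if "e \<in> T" for e using that injP by (simp add: c_def)
    have "(\<Sum>s\<in>P ` T - {s0}. c s *\<^sub>R (emb s - emb s0)) = (\<Sum>s\<in>P ` T. c s *\<^sub>R (emb s - emb s0))"
      using fin by (intro sum.mono_neutral_left) auto
    also have "\<dots> = (\<Sum>e\<in>T. of_int (m e) *\<^sub>R (pt e - pt t0))"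
      using injP t0 c emb by (simp add: sum.reindex)
    also have "\<dots> = axis k 1 - axis k0 1"
      using eq zero by (simp add: scaleR_diff_right sum_subtractf flip: scaleR_sum_left)
    finally have 1: "axis k 1 = (\<Sum>s\<in>P ` T - {s0}. c s *\<^sub>R (emb s - emb s0)) + axis k0 1" by simp
    have "k0 \<in> outside e0" by (auto simp: outside_def k0_def)
    then have 2: "axis k0 1 = (\<Sum>j\<in>outside e0. of_bool (j = k0) *\<^sub>R axis j (1::real))"
      by (simp add: of_bool_def if_distrib[of "\<lambda>x. x *\<^sub>R _"] sum.delta' cong: if_cong)
    show ?thesis
      by (intro exI[of _ c] exI[of _ "\<lambda>j. of_bool (j = k0)"] conjI) (use 1 2 in \<open>auto simp: c_def\<close>)
  qed
  show ?thesis
  proof (unfold_locales)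
    show "finite (P ` T)" "s0 \<in> P ` T" using fin s0 by auto
    have "card (P ` T - {s0}) = card T - 1" using fin injP t0 by (simp add: card_image)
    moreover have "card (V - {a e0, b e0}) = card V - 2"
      using abV ab_neq[OF e0 e0] finite_E by (subst card_Diff_subset) auto
    moreover have "card (outside e0) = CARD('n) - card (V - {a e0, b e0})"
      unfolding outside_def by (simp add: card_Diff_subset Compl_eq_Diff_UNIV)
    moreover have "card (V - {a e0, b e0}) \<le> CARD('n)" by (intro card_mono) auto
    ultimately show "card (P ` T - {s0}) + card (outside e0) = CARD('n)"
      using spans_treeD(2)[OF T(1)] by simp
    show "inj_on emb (P ` T)"
      using pt_inj_on_tree[OF T(1)] emb by (auto simp: inj_on_def)
    show "emb s $ k \<in> \<int>" if "s \<in> P ` T" for s k using that emb by (auto simp: pt_nth incidence_def)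
  qed (rule span)
qed

definition polytope :: "'e set \<Rightarrow> (real^'n::{finite,wellorder}) set" where
  "polytope S = convex hull (pt ` (E - S))"

lemma convex_hull_pt:
  assumes "finite Z"
  shows "x \<in> convex hull (pt ` Z) \<longleftrightarrow> (\<exists>c. (\<forall>e\<in>Z. 0 \<le> c e) \<and> sum c Z = 1 \<and> (\<Sum>e\<in>Z. c e *\<^sub>R pt e) = x)"
proof
  assume "x \<in> convex hull (pt ` Z)"
  then obtain u where u: "\<forall>y\<in>pt ` Z. 0 \<le> u y" "sum u (pt ` Z) = 1" "(\<Sum>y\<in>pt ` Z. u y *\<^sub>R y) = x"
    using assms by (auto simp: convex_hull_finite)
  \<comment> \<open>parallel edges give the same point; put the whole coefficient on one of them\<close>
  define r where "r y = (SOME e. e \<in> Z \<and> pt e = y)" for y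
  have r: "r y \<in> Z" "pt (r y) = y" if "y \<in> pt ` Z" for y
    using that someI_ex[of "\<lambda>e. e \<in> Z \<and> pt e = y"] unfolding r_def by blast+
  have inj: "inj_on r (pt ` Z)" using r(2) by (metis inj_on_def)
  define c where "c e = (if e \<in> r ` pt ` Z then u (pt e) else 0)" for e
  have sub: "r ` pt ` Z \<subseteq> Z" using r(1) by auto
  have "(\<Sum>e\<in>Z. c e) = (\<Sum>e\<in>r ` pt ` Z. u (pt e))"
    using assms sub by (intro sum.mono_neutral_cong_right) (auto simp: c_def)
  also have "\<dots> = (\<Sum>y\<in>pt ` Z. u y)" using inj r(2) by (simp add: sum.reindex)
  finally have 1: "sum c Z = 1" using u(2) by simp
  have "(\<Sum>e\<in>Z. c e *\<^sub>R pt e) = (\<Sum>e\<in>r ` pt ` Z. u (pt e) *\<^sub>R pt e)"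
    using assms sub by (intro sum.mono_neutral_cong_right) (auto simp: c_def)
  also have "\<dots> = (\<Sum>y\<in>pt ` Z. u y *\<^sub>R y)" using inj r(2) by (simp add: sum.reindex)
  finally have "(\<Sum>e\<in>Z. c e *\<^sub>R pt e) = x" using u(3) by simp
  moreover have "\<forall>e\<in>Z. 0 \<le> c e" using u(1) by (auto simp: c_def)
  ultimately show "\<exists>c. (\<forall>e\<in>Z. 0 \<le> c e) \<and> sum c Z = 1 \<and> (\<Sum>e\<in>Z. c e *\<^sub>R pt e) = x" using 1 by blast
next
  assume "\<exists>c. (\<forall>e\<in>Z. 0 \<le> c e) \<and> sum c Z = 1 \<and> (\<Sum>e\<in>Z. c e *\<^sub>R pt e) = x"
  then obtain c where c: "\<forall>e\<in>Z. 0 \<le> c e" "sum c Z = 1" "(\<Sum>e\<in>Z. c e *\<^sub>R pt e) = x" by blast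
  show "x \<in> convex hull (pt ` Z)"
    unfolding c(3)[symmetric] using c(1,2) assms by (intro convex_sum convex_convex_hull) (auto intro: hull_inc)
qed

lemma pt_height: "e \<in> E \<Longrightarrow> (\<Sum>v\<in>VA. pt e $ v) = 1"
  using ab_neq finite_E by (auto simp: pt_nth sum_incidence) metis

lemma sum_pt_height:
  assumes "Z \<subseteq> E"
  shows "(\<Sum>v\<in>VA. (\<Sum>e\<in>Z. c e *\<^sub>R pt e) $ v) = sum c Z"
proof -
  have "(\<Sum>v\<in>VA. (\<Sum>e\<in>Z. c e *\<^sub>R pt e) $ v) = (\<Sum>e\<in>Z. c e * (\<Sum>v\<in>VA. pt e $ v))"
    by (simp add: sum_distrib_left) (rule sum.swap)
  also have "\<dots> = sum c Z" using assms pt_height by (intro sum.cong) auto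
  finally show ?thesis .
qed

lemma in_polytope_iff:
  assumes "(\<Sum>v\<in>VA. x $ v) = 1" "\<And>v. v \<notin> V \<Longrightarrow> x $ v = 0"
  shows "x \<in> polytope S \<longleftrightarrow> (\<exists>c. represents S (($) x) c)"
proof
  assume "x \<in> polytope S"
  then obtain c where c: "\<forall>e\<in>E - S. 0 \<le> c e" "(\<Sum>e\<in>E - S. c e *\<^sub>R pt e) = x"
    using finite_E by (auto simp: polytope_def convex_hull_pt)
  let ?c = "\<lambda>e. if e \<in> E - S then c e else 0"
  have "(\<Sum>e\<in>E. ?c e * incidence a b e v) = x $ v" for v
  proof -
    have "(\<Sum>e\<in>E. ?c e * incidence a b e v) = (\<Sum>e\<in>E - S. c e * incidence a b e v)"
      using finite_E by (intro sum.mono_neutral_cong_right) auto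
    then show ?thesis unfolding sum_pt_nth[symmetric] c(2) .
  qed
  then have "represents S (($) x) ?c" using c(1) by (auto simp: represents_def)
  then show "\<exists>c. represents S (($) x) c" by blast
next
  assume "\<exists>c. represents S (($) x) c"
  then obtain c where c: "represents S (($) x) c" by blast
  have "(\<Sum>e\<in>E - S. c e *\<^sub>R pt e) $ v = x $ v" for v
  proof -
    have "(\<Sum>e\<in>E - S. c e * incidence a b e v) = (\<Sum>e\<in>E. c e * incidence a b e v)"
      using finite_E representsD(2)[OF c] by (intro sum.mono_neutral_left) auto
    also have "\<dots> = x $ v"
    proof (cases "v \<in> V")
      case False
      then have "incidence a b e v = (0::real)" if "e \<in> E" for e using that by (auto simp: incidence_def)
      then show ?thesis using assms(2)[OF False] by simp
    qed (rule representsD(4)[OF c])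
    finally show ?thesis by (simp add: pt_nth)
  qed
  then have eq: "(\<Sum>e\<in>E - S. c e *\<^sub>R pt e) = x" by (simp add: Finite_Cartesian_Product.vec_eq_iff)
  moreover have "sum c (E - S) = 1"
    using sum_pt_height[of "E - S" c] unfolding eq by (simp add: assms(1))
  ultimately show "x \<in> polytope S"
    using finite_E representsD(1)[OF c] by (auto simp: polytope_def convex_hull_pt)
qed

lemma complement_dual_tree:
  assumes "T \<in> dual_trees"
  shows "spans_tree (E - T) a b V"
proof -
  interpret rev: dual_multigraphs E L R F a b V
  proof (unfold_locales)
    show "(\<Sum>e\<in>E. incidence L R e f * incidence a b e v) = (0 :: int)" if "f \<in> F" "v \<in> V" for f v
      using graph_dual.orthogonal[OF that(2,1)] by (simp add: mult.commute)
    show "card F + card V = card E + 2" using graph_dual.euler_count by simp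
  qed (rule connects_dual connects_graph)+
  show ?thesis using assms rev.complement_spanning_tree by (auto simp: dual_trees_def)
qed

text \<open>
  Almost every point of the affine hull is generic and lies in as many of the simplices
  \<open>polytope T\<close> as in the polytope itself, namely one or none. By \<open>emeasure_param\<close> the frame of the
  given tree \<open>T0\<close> and the frame of the tree \<open>E - T\<close> measure \<open>polytope T\<close> alike, as a standard simplex.
  The maps \<open>P\<close> and \<open>emb\<close> allow the affine coordinates to refer to another copy of the points, on which
  the vertices need not be well-ordered.
\<close>

theorem polytope_volume:
  assumes T0: "spans_tree T0 a b V" "T0 \<subseteq> E" and emb: "\<And>e. e \<in> T0 \<Longrightarrow> emb (P e) = pt e"
    and s0: "s0 \<in> P ` T0" and f0: "f0 \<in> F" and S: "S \<subseteq> E"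
  shows "fact (card (P ` T0) - 1) * measure (Pi\<^sub>M (P ` T0 - {s0}) (\<lambda>_. lborel :: real measure))
      {c \<in> space (Pi\<^sub>M (P ` T0 - {s0}) (\<lambda>_. lborel)).
        emb s0 + (\<Sum>s\<in>P ` T0 - {s0}. c s *\<^sub>R (emb s - emb s0)) \<in> polytope S} = card (trees_over f0 S)"
proof -
  obtain e0 where e0: "e0 \<in> E" using nonempty by blast
  interpret fr: unimodular_frame "P ` T0" s0 emb "outside e0"
    by (rule tree_frame[OF T0 emb e0 s0])
  note fin = connectsD(1)[OF spans_treeD(1)[OF T0(1)]]
  have injP: "inj_on P T0" using pt_inj_on_tree[OF T0(1)] emb by (metis inj_on_def)
  obtain t0 where t0: "t0 \<in> T0" "s0 = P t0" using s0 by blast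
  let ?M = "fr.param_space"
  let ?A = "\<lambda>X. {c \<in> space ?M. fr.param c \<in> X}"
  let ?d = "card T0 - 1"
  have param: "fr.param c = pt t0 + (\<Sum>e\<in>T0. c (P e) *\<^sub>R (pt e - pt t0))" for c
  proof -
    have "(\<Sum>s\<in>P ` T0 - {s0}. c s *\<^sub>R (emb s - emb s0)) = (\<Sum>s\<in>P ` T0. c s *\<^sub>R (emb s - emb s0))"
      using fin by (intro sum.mono_neutral_left) auto
    then have "fr.param c = emb s0 + (\<Sum>s\<in>P ` T0. c s *\<^sub>R (emb s - emb s0))"
      by (simp only: fr.param_def)
    then show ?thesis using injP t0 emb by (simp add: sum.reindex)
  qed
  \<comment> \<open>the coefficient of \<open>t0\<close> is adjusted so that all coefficients add up to one\<close>
  have affine: "emb s0 + (\<Sum>s\<in>P ` T0 - {s0}. c s *\<^sub>R (emb s - emb s0)) =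
      (\<Sum>e\<in>T0. (c (P e) + of_bool (e = t0) * (1 - sum (\<lambda>e. c (P e)) T0)) *\<^sub>R pt e)" for c
  proof -
    have "(\<Sum>e\<in>T0. (of_bool (e = t0) * (1 - sum (\<lambda>e. c (P e)) T0)) *\<^sub>R pt e) = (1 - sum (\<lambda>e. c (P e)) T0) *\<^sub>R pt t0"
      using t0(1) fin by (subst sum.remove[of _ t0]) auto
    then show ?thesis
      using param[of c] unfolding fr.param_def
      by (simp add: scaleR_add_left sum.distrib scaleR_diff_right sum_subtractf scaleR_diff_left scaleR_sum_left)
  qed
  have range: "polytope S' \<subseteq> range fr.param" for S'
  proof
    fix x assume "x \<in> polytope S'"
    then obtain c where c: "sum c (E - S') = 1" "(\<Sum>e\<in>E - S'. c e *\<^sub>R pt e) = x"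
      using finite_E by (auto simp: polytope_def convex_hull_pt)
    have "\<exists>m :: 'e \<Rightarrow> real. (\<Sum>e'\<in>T0. m e' *\<^sub>R pt e') = pt e" if "e \<in> E" for e
    proof -
      have "a e \<in> V" "b e \<in> V" using that by auto
      from connects_integer_combination[OF spans_treeD(1)[OF T0(1)] this]
      obtain m :: "'e \<Rightarrow> int" where m: "\<And>u. (\<Sum>e'\<in>T0. m e' * incidence a b e' u) = of_bool (u = a e) - of_bool (u = b e)"
        by blast
      have "(\<Sum>e'\<in>T0. of_int (m e') * incidence a b e' u :: real) = of_int (\<Sum>e'\<in>T0. m e' * incidence a b e' u)" for u
        by (simp add: incidence_def)
      then have "(\<Sum>e'\<in>T0. of_int (m e') * incidence a b e' u :: real) = incidence a b e u" for u
        unfolding m by (auto simp: incidence_def)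
      then have "(\<Sum>e'\<in>T0. of_int (m e') *\<^sub>R pt e') = pt e"
        by (simp add: Finite_Cartesian_Product.vec_eq_iff pt_nth)
      then show ?thesis by (rule exI[of _ "\<lambda>e'. of_int (m e')"])
    qed
    then obtain m :: "'e \<Rightarrow> 'e \<Rightarrow> real" where m: "\<And>e. e \<in> E \<Longrightarrow> (\<Sum>e'\<in>T0. m e e' *\<^sub>R pt e') = pt e" by metis
    define w where "w e' = (\<Sum>e\<in>E - S'. c e * m e e')" for e'
    have x: "(\<Sum>e'\<in>T0. w e' *\<^sub>R pt e') = x"
    proof -
      have "(\<Sum>e'\<in>T0. w e' *\<^sub>R pt e') = (\<Sum>e'\<in>T0. \<Sum>e\<in>E - S'. c e *\<^sub>R m e e' *\<^sub>R pt e')"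
        by (simp add: w_def scaleR_sum_left)
      also have "\<dots> = (\<Sum>e\<in>E - S'. c e *\<^sub>R (\<Sum>e'\<in>T0. m e e' *\<^sub>R pt e'))"
        unfolding scaleR_sum_right by (rule sum.swap)
      also have "\<dots> = x" unfolding c(2)[symmetric] using m by (intro sum.cong) auto
      finally show ?thesis .
    qed
    have "sum w T0 = 1"
      using sum_pt_height[OF T0(2), of w] sum_pt_height[of "E - S'" c] c unfolding x by auto
    then have "fr.param (\<lambda>s. w (inv_into T0 P s)) = x"
      using injP x by (simp add: fr.param_def affine)
    then show "x \<in> range fr.param" by blast
  qed
  have compact: "compact (polytope S')" for S'
    unfolding polytope_def using finite_E by (intro compact_convex_hull finite_imp_compact) auto
  have sets: "?A (polytope S') \<in> sets ?M" for S'
    using compact by (intro fr.param_vimage_sets borel_closed compact_imp_closed)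
  have simplex: "emeasure ?M (?A (polytope T)) = ennreal (1 / fact ?d)" if T: "T \<in> trees_over f0 S" for T
  proof -
    have T': "spans_tree (E - T) a b V" "E - T \<subseteq> E"
      using T complement_dual_tree by (auto simp: trees_over_def)
    have "E - T \<noteq> {}"
    proof
      assume "E - T = {}"
      then have "card (E - T) = 0" by (simp only: card.empty)
      then have "card V = 1" using spans_treeD(2)[OF T'(1)] by linarith
      then obtain v where "V = {v}" by (auto simp: card_1_singleton_iff)
      then show False using e0 ab_neq[OF e0 e0] by (metis UnCI imageI singletonD)
    qed
    then obtain e1 where e1: "e1 \<in> E - T" by blast
    interpret fr': unimodular_frame "pt ` (E - T)" "pt e1" id "outside e0"
      by (rule tree_frame[OF T' _ e0]) (use e1 in auto)
    have hull: "polytope T = convex hull (id ` pt ` (E - T))" by (simp add: polytope_def)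
    have "card (pt ` (E - T) - {pt e1}) = ?d"
    proof -
      have "card (pt ` (E - T)) = card (E - T)" using pt_inj_on_tree[OF T'(1)] by (rule card_image)
      then have "card (pt ` (E - T) - {pt e1}) = card (E - T) - 1" using e1 finite_E by simp
      then show ?thesis using spans_treeD(2)[OF T'(1)] spans_treeD(2)[OF T0(1)] by simp
    qed
    then have "measure lebesgue (coordinate_prism (outside e0) (polytope T)) = 1 / fact ?d"
      using fr'.measure_prism_simplex unfolding hull by simp
    then show ?thesis using fr.emeasure_param[OF compact range] by simp
  qed
  have height: "(\<Sum>v\<in>VA. fr.param c $ v) = 1" for c
  proof -
    have "sum (\<lambda>e. c (P e) + of_bool (e = t0) * (1 - sum (\<lambda>e. c (P e)) T0)) T0 = 1"
      using t0(1) fin by (simp add: sum.distrib of_bool_def if_distrib[of "\<lambda>x. x * _"] sum.delta cong: if_cong)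
    then show ?thesis unfolding fr.param_def affine sum_pt_height[OF T0(2)] .
  qed
  have vanish: "fr.param c $ v = 0" if "v \<notin> V" for c v
  proof -
    have "incidence a b e v = (0::real)" if "e \<in> T0" for e
      using that \<open>v \<notin> V\<close> T0(2) by (auto simp: incidence_def)
    then show ?thesis unfolding fr.param_def affine by (simp add: pt_nth)
  qed
  \<comment> \<open>the functional of a cut does not vanish at the point of a tree edge in the cut\<close>
  have ae: "AE c in ?M. generic (($) (fr.param c))"
  proof -
    have "AE c in ?M. \<forall>X\<in>{X. X \<subseteq> V \<and> X \<noteq> {} \<and> X \<noteq> V}. (\<Sum>v\<in>X. fr.param c $ v) \<noteq> 0"
    proof (rule AE_finite_allI)
      fix X assume X: "X \<in> {X. X \<subseteq> V \<and> X \<noteq> {} \<and> X \<noteq> V}"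
      then obtain e where e: "e \<in> T0" "crosses a b X e" using connectsD(6)[OF spans_treeD(1)[OF T0(1)], of X] by auto
      define w :: "real^'n::{finite,wellorder}" where "w = (\<chi> v. of_bool (v \<in> X))"
      have w: "w \<bullet> y = (\<Sum>v\<in>X. y $ v)" for y :: "real^'n::{finite,wellorder}"
        unfolding inner_vec_def inner_real_def w_def by (intro sum.mono_neutral_cong_right) auto
      have "w \<bullet> emb (P e) \<noteq> 0"
        using e unfolding w emb[OF e(1)] pt_nth by (auto simp: sum_incidence crosses_def)
      then have "?A {x. w \<bullet> x = 0} \<in> null_sets ?M"
        using fr.null_set_param[of "P e" w] e(1) by simp
      then have "AE c in ?M. c \<notin> ?A {x. w \<bullet> x = 0}" by (rule AE_not_in)
      then show "AE c in ?M. (\<Sum>v\<in>X. fr.param c $ v) \<noteq> 0"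
        by (rule AE_mp) (auto simp: w intro!: AE_I2)
    qed (simp add: finite_subset[of _ "Pow UNIV"])
    then show ?thesis by (rule AE_mp) (auto simp: generic_def intro!: AE_I2)
  qed
  have finT: "finite (trees_over f0 S)"
    using finite_E by (intro finite_subset[of "trees_over f0 S" "Pow E"]) (auto simp: trees_over_def dual_trees_def)
  have "emeasure ?M (?A (polytope S)) = (\<integral>\<^sup>+c. indicator (?A (polytope S)) c \<partial>?M)"
    using sets by simp
  also have "\<dots> = (\<integral>\<^sup>+c. (\<Sum>T\<in>trees_over f0 S. indicator (?A (polytope T)) c) \<partial>?M)"
  proof (rule nn_integral_cong_AE, rule AE_mp[OF ae], rule AE_I2, rule impI)
    fix c assume c: "c \<in> space ?M" and gen: "generic (($) (fr.param c))"
    have mem: "c \<in> ?A (polytope S') \<longleftrightarrow> (\<exists>w. represents S' (($) (fr.param c)) w)" for S'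
      using c in_polytope_iff[OF height vanish] by simp
    show "(indicator (?A (polytope S)) c :: ennreal) = (\<Sum>T\<in>trees_over f0 S. indicator (?A (polytope T)) c)"
    proof (cases "c \<in> ?A (polytope S)")
      case True
      then obtain w where "represents S (($) (fr.param c)) w" using mem by blast
      from dissection_exists[OF gen this f0 S] obtain T where
        T: "T \<in> trees_over f0 S" "c \<in> ?A (polytope T)" using mem by blast
      have "c \<notin> ?A (polytope T')" if "T' \<in> trees_over f0 S" "T' \<noteq> T" for T'
        using dissection_unique[OF gen f0 T(1) _ that(1)] that(2) T(2) mem by blast
      then have "(\<Sum>T'\<in>trees_over f0 S. indicator (?A (polytope T')) c :: ennreal) = (\<Sum>T'\<in>trees_over f0 S. if T' = T then 1 else 0)"
        using T(2) by (intro sum.cong refl) (auto simp: indicator_def)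
      also have "\<dots> = 1" using T(1) finT by simp
      finally show ?thesis using True by simp
    next
      case False
      have "c \<notin> ?A (polytope T)" if T: "T \<in> trees_over f0 S" for T
      proof
        assume "c \<in> ?A (polytope T)"
        then obtain w where "represents T (($) (fr.param c)) w" using mem by blast
        then have "represents S (($) (fr.param c)) w" using T by (auto simp: represents_def trees_over_def)
        then show False using False mem by blast
      qed
      then have "(\<Sum>T\<in>trees_over f0 S. indicator (?A (polytope T)) c :: ennreal) = 0"
        by (intro sum.neutral ballI indicator_simps(2))
      then show ?thesis using indicator_simps(2)[OF False] by (rule trans[OF _ sym, rotated])
    qed
  qed
  also have "\<dots> = (\<Sum>T\<in>trees_over f0 S. emeasure ?M (?A (polytope T)))"
    using sets by (subst nn_integral_sum) auto
  also have "\<dots> = ennreal (card (trees_over f0 S) * (1 / fact ?d))"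
    using ennreal_mult[of "card (trees_over f0 S)" "1 / fact ?d"] by (simp add: simplex ennreal_of_nat_eq_real_of_nat)
  finally have "measure ?M (?A (polytope S)) = card (trees_over f0 S) * (1 / fact ?d)"
    by (intro measure_eq_emeasure_eq_ennreal) auto
  moreover have "card (P ` T0) = card T0" using injP by (rule card_image)
  ultimately show ?thesis by (simp add: fr.param_def)
qed

end

section \<open>Minors of the Fox matrix\<close>

text \<open>
  Column \<open>j'\<close> is minus the sum of all other columns, so that minus column \<open>j\<close> can take its place in
  the minor that omits \<open>j\<close>.
\<close>

lemma idet_omit_column:
  fixes M :: "'i \<Rightarrow> 'j \<Rightarrow> 'r::idom"
  assumes fin: "finite I" "finite J" and card: "card I + 1 = card J" and j: "j \<in> J" "j' \<in> J"
    and sum: "\<And>i. i \<in> I \<Longrightarrow> (\<Sum>j\<in>J. M i j) = 0"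
  shows "idet I (J - {j}) M =\<^sub>\<plusminus> idet I (J - {j'}) M"
proof (cases "j = j'")
  case False
  \<comment> \<open>\<open>C\<close> expresses the columns except \<open>j'\<close> by the columns except \<open>j\<close>\<close>
  define C where "C c c' = (if c' = j then - 1 else of_bool (c = c') :: 'r)" for c c'
  have cards: "card (J - {j}) = card I" "card (J - {j'}) = card I" using card j fin by simp_all
  have "idet I (J - {j'}) M = idet I (J - {j'}) (\<lambda>i c'. \<Sum>c\<in>J - {j}. M i c * C c c')"
  proof (rule idet_cong)
    fix i c' assume i: "i \<in> I" and c': "c' \<in> J - {j'}"
    show "M i c' = (\<Sum>c\<in>J - {j}. M i c * C c c')"
    proof (cases "c' = j")
      case True
      then show ?thesis using sum[OF i] fin(2) j(1) by (simp add: C_def sum.remove sum_negf eq_neg_iff_add_eq_0)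
    next
      case False
      then have "(\<Sum>c\<in>J - {j}. M i c * C c c') = (\<Sum>c\<in>J - {j}. if c = c' then M i c' else 0)"
        by (intro sum.cong) (auto simp: C_def)
      then show ?thesis using False c' fin(2) by simp
    qed
  qed (use fin cards in auto)
  also have "\<dots> = idet I (J - {j}) M * idet (J - {j}) (J - {j'}) C"
    using fin cards by (intro idet_mult) auto
  finally have 1: "idet I (J - {j'}) M = idet I (J - {j}) M * idet (J - {j}) (J - {j'}) C" .
  have J: "J - {j} = {j'} \<union> (J - {j, j'})" "J - {j'} = {j} \<union> (J - {j, j'})" using j False by auto
  have "idet (J - {j}) (J - {j'}) C =\<^sub>\<plusminus> idet {j'} {j} C * idet (J - {j, j'}) (J - {j, j'}) C"
    unfolding J using fin(2) by (intro idet_block) (auto simp: C_def)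
  also have "idet (J - {j, j'}) (J - {j, j'}) C = idet (J - {j, j'}) (J - {j, j'}) (\<lambda>i j. of_bool (i = j))"
    using fin(2) by (intro idet_cong) (auto simp: C_def)
  also have "\<dots> = 1" using fin(2) by (intro idet_id) simp
  also have "idet {j'} {j} C = - 1" by (simp add: idet_singleton C_def)
  finally show ?thesis unfolding 1 by (auto simp: pm_eq_def)
qed simp

lemma idet_omit_row:
  fixes M :: "'i \<Rightarrow> 'j \<Rightarrow> 'r::idom"
  assumes fin: "finite I" "finite J" and card: "card J + 1 = card I" and i: "i \<in> I" "i0 \<in> I"
    and sum: "\<And>j. j \<in> J \<Longrightarrow> (\<Sum>i\<in>I. w i * M i j) = 0" and w: "w i0 = 1"
  shows "idet (I - {i}) J M =\<^sub>\<plusminus> w i * idet (I - {i0}) J M"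
proof (cases "i = i0")
  case True then show ?thesis using w by simp
next
  case False
  \<comment> \<open>\<open>C\<close> expresses the rows except \<open>i\<close> by the rows except \<open>i0\<close>\<close>
  define C where "C r r' = (if r = i0 then - w r' else of_bool (r = r') :: 'r)" for r r'
  have cards: "card (I - {i}) = card J" "card (I - {i0}) = card J" using card i fin by simp_all
  have "idet (I - {i}) J M = idet (I - {i}) J (\<lambda>r c. \<Sum>r'\<in>I - {i0}. C r r' * M r' c)"
  proof (rule idet_cong)
    fix r c assume r: "r \<in> I - {i}" and c: "c \<in> J"
    show "M r c = (\<Sum>r'\<in>I - {i0}. C r r' * M r' c)"
    proof (cases "r = i0")
      case True
      then show ?thesis using sum[OF c] fin(1) i(2) w by (simp add: C_def sum.remove sum_negf eq_neg_iff_add_eq_0)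
    next
      case False
      then have "(\<Sum>r'\<in>I - {i0}. C r r' * M r' c) = (\<Sum>r'\<in>I - {i0}. if r' = r then M r c else 0)"
        by (intro sum.cong) (auto simp: C_def)
      then show ?thesis using False r fin(1) by simp
    qed
  qed (use fin cards in auto)
  also have "\<dots> = idet (I - {i}) (I - {i0}) C * idet (I - {i0}) J M"
    using fin cards by (intro idet_mult) auto
  finally have 1: "idet (I - {i}) J M = idet (I - {i}) (I - {i0}) C * idet (I - {i0}) J M" .
  have I: "I - {i} = (I - {i, i0}) \<union> {i0}" "I - {i0} = (I - {i, i0}) \<union> {i}" using i False by auto
  have "idet (I - {i}) (I - {i0}) C =\<^sub>\<plusminus> idet (I - {i, i0}) (I - {i, i0}) C * idet {i0} {i} C"
    unfolding I using fin(1) by (intro idet_block) (auto simp: C_def)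
  also have "idet (I - {i, i0}) (I - {i, i0}) C = idet (I - {i, i0}) (I - {i, i0}) (\<lambda>i j. of_bool (i = j))"
    using fin(1) by (intro idet_cong) (auto simp: C_def)
  also have "\<dots> = 1" using fin(1) by (intro idet_id) simp
  also have "idet {i0} {i} C = - w i" by (simp add: idet_singleton C_def)
  finally show ?thesis unfolding 1 by (auto simp: pm_eq_def)
qed

context plane_hypermap
begin

text \<open>
  The Fox matrix, with every segment labelled by the crossing at which it belongs to the
  over-strand: column \<open>Inl e\<close> is the segment that arrives there and \<open>Inr e\<close> the one that leaves. Rows are relations at the crossings, as in
  \<open>alexander_matrix\<close>.
\<close>

fun fox :: "'r::comm_ring_1 \<Rightarrow> 'e + 'e \<Rightarrow> 'e + 'e \<Rightarrow> 'r" where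
  "fox \<tau> (Inl e) (Inl e') = of_bool (e = e')"
| "fox \<tau> (Inl e) (Inr e') = - of_bool (e = e')"
| "fox \<tau> (Inr e) (Inl e') = - (\<tau> * of_bool (\<alpha> e = e'))"
| "fox \<tau> (Inr e) (Inr e') = (1 + \<tau>) * of_bool (e = e') - of_bool (\<beta> e = e')"

lemma sum_of_bool:
  assumes "x \<in> E"
  shows "(\<Sum>e\<in>E. of_bool (x = e)) = (1 :: 'r::comm_ring_1)" "(\<Sum>e\<in>E. of_bool (e = x)) = (1 :: 'r)"
  using assms finite_E by (simp_all add: of_bool_def sum.delta sum.delta')

lemma sum_of_bool_\<alpha>: "x \<in> E \<Longrightarrow> (\<Sum>e\<in>E. of_bool (\<alpha> e = x)) = (1 :: 'r::comm_ring_1)"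
  and sum_of_bool_\<beta>: "x \<in> E \<Longrightarrow> (\<Sum>e\<in>E. of_bool (\<beta> e = x)) = (1 :: 'r::comm_ring_1)"
  using sum_\<alpha>[of "\<lambda>e. of_bool (e = x) :: 'r"] sum_\<beta>[of "\<lambda>e. of_bool (e = x) :: 'r"] by (simp_all add: sum_of_bool)

lemma fox_row_sum:
  assumes "r \<in> E <+> E"
  shows "(\<Sum>c\<in>E <+> E. fox \<tau> r c) = (0 :: 'r::comm_ring_1)"
proof -
  have "(\<Sum>c\<in>E <+> E. fox \<tau> r c) = (\<Sum>e\<in>E. fox \<tau> r (Inl e)) + (\<Sum>e\<in>E. fox \<tau> r (Inr e))"
    using finite_E by (simp add: sum.Plus)
  also have "\<dots> = 0"
    using assms \<alpha>_in \<beta>_in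
    by (auto simp: sum_negf sum_subtractf sum_of_bool sum_distrib_left[symmetric] simp del: sum_mult_of_bool_eq sum_of_bool_mult_eq)
  finally show ?thesis .
qed

lemma fox_column_sum:
  assumes "c \<in> E <+> E"
  shows "(\<Sum>r\<in>E <+> E. case_sum (\<lambda>_. \<tau>) (\<lambda>_. 1) r * fox \<tau> r c) = (0 :: 'r::comm_ring_1)"
proof -
  have "(\<Sum>r\<in>E <+> E. case_sum (\<lambda>_. \<tau>) (\<lambda>_. 1) r * fox \<tau> r c) =
      \<tau> * (\<Sum>e\<in>E. fox \<tau> (Inl e) c) + (\<Sum>e\<in>E. fox \<tau> (Inr e) c)"
    using finite_E by (simp add: sum.Plus sum_distrib_left)
  also have "\<dots> = 0"
    using assms
    by (auto simp: sum_negf sum_subtractf sum_of_bool sum_of_bool_\<alpha> sum_of_bool_\<beta> sum_distrib_left[symmetric]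
        simp del: sum_mult_of_bool_eq sum_of_bool_mult_eq)
  finally show ?thesis .
qed

text \<open>
  The rows \<open>Inl e\<close> identify the two segments of an over-strand at \<open>e\<close>. Adding the columns \<open>Inl e\<close> to
  the columns \<open>Inr e\<close> eliminates them and leaves a minor of \<open>hop\<close>.
\<close>

lemma idet_fox_reduced:
  fixes \<tau> :: "'r::idom"
  assumes e0: "e0 \<in> E"
  shows "idet ((E <+> E) - {Inr e0}) ((E <+> E) - {Inr e0}) (fox \<tau>) =\<^sub>\<plusminus> idet E E (hop \<tau> e0)"
proof -
  let ?E' = "E - {e0}"
  let ?W = "Inl ` E \<union> Inr ` ?E' :: ('e + 'e) set"
  let ?El = "Inl ` E :: ('e + 'e) set" and ?Er = "Inr ` ?E' :: ('e + 'e) set"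
  have W: "(E <+> E) - {Inr e0} = ?W" by auto
  have fin: "finite E" "finite ?E'" "finite ?W" using finite_E by auto
  \<comment> \<open>multiplication by \<open>C\<close> adds the columns \<open>Inl e\<close> to the columns \<open>Inr e\<close>\<close>
  define C :: "'e + 'e \<Rightarrow> 'e + 'e \<Rightarrow> 'r" where
    "C x y = (case (x, y) of (Inr e, Inl e') \<Rightarrow> 0 | (Inl e, Inl e') \<Rightarrow> of_bool (e = e')
       | (Inl e, Inr e') \<Rightarrow> of_bool (e = e') | (Inr e, Inr e') \<Rightarrow> of_bool (e = e'))" for x y
  have sumW: "(\<Sum>x\<in>?W. g x) = (\<Sum>e\<in>E. g (Inl e)) + (\<Sum>e\<in>?E'. g (Inr e))" for g :: "'e + 'e \<Rightarrow> 'r"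
    using fin by (subst sum.union_disjoint) (auto simp: sum.reindex inj_on_def)
  define P where "P x y = (\<Sum>z\<in>?W. fox \<tau> x z * C z y)" for x y
  have delta: "(\<Sum>z\<in>A. g z * of_bool (z = y)) = (if y \<in> A then g y else 0)" if "finite A" for A :: "'e set" and y and g :: "'e \<Rightarrow> 'r"
    using that by (simp add: of_bool_def if_distrib[of "\<lambda>x. _ * x"] sum.delta cong: if_cong)
  have P_l: "P x (Inl e') = fox \<tau> x (Inl e')" if "e' \<in> E" for x e'
    using that fin unfolding P_def sumW by (simp add: C_def delta del: sum_mult_of_bool_eq)
  have P_r: "P x (Inr e') = fox \<tau> x (Inl e') + fox \<tau> x (Inr e')" if "e' \<in> ?E'" for x e'
    using that fin unfolding P_def sumW by (simp add: C_def delta del: sum_mult_of_bool_eq)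
  have "idet ?W ?W C =\<^sub>\<plusminus> 1"
  proof -
    have "idet (?Er \<union> ?El) (?Er \<union> ?El) C =\<^sub>\<plusminus> idet ?Er ?Er C * idet ?El ?El C"
      using fin by (intro idet_block) (auto simp: C_def)
    moreover have "idet ?Er ?Er C = idet ?Er ?Er (\<lambda>x y. of_bool (x = y))"
      using fin by (intro idet_cong) (auto simp: C_def)
    moreover have "idet ?El ?El C = idet ?El ?El (\<lambda>x y. of_bool (x = y))"
      using fin by (intro idet_cong) (auto simp: C_def)
    ultimately show ?thesis using fin by (simp add: idet_id Un_commute)
  qed
  moreover have "idet ?W ?W P = idet ?W ?W (fox \<tau>) * idet ?W ?W C"
    unfolding P_def using fin by (intro idet_mult) auto
  ultimately have 1: "idet ?W ?W (fox \<tau>) =\<^sub>\<plusminus> idet ?W ?W P" by (auto simp: pm_eq_def)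
  have block: "idet ?W ?W P =\<^sub>\<plusminus> idet ?El ?El P * idet ?Er ?Er P"
  proof (rule idet_block)
    fix x y assume "x \<in> ?El" "y \<in> ?Er"
    then obtain e e' where "x = Inl e" "y = Inr e'" "e' \<in> ?E'" by blast
    then show "P x y = 0" using P_r[of e' "Inl e"] by simp
  qed (use fin in auto)
  have "idet ?El ?El P = idet ?El ?El (\<lambda>x y. of_bool (x = y))"
    using fin by (intro idet_cong) (auto simp: P_l)
  then have left: "idet ?El ?El P = 1" using fin by (simp add: idet_id)
  have "idet ?Er ?Er P =\<^sub>\<plusminus> idet ?E' ?Er (\<lambda>e. P (Inr e))"
    using fin by (intro idet_reindex_rows) (auto simp: card_image)
  also have "\<dots> =\<^sub>\<plusminus> idet ?E' ?E' (\<lambda>e e'. P (Inr e) (Inr e'))"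
    using fin by (intro idet_reindex_columns) auto
  also have "\<dots> = idet ?E' ?E' (hop \<tau> e0)"
    using fin by (intro idet_cong) (auto simp: P_r hop_def algebra_simps)
  finally have right: "idet ?Er ?Er P =\<^sub>\<plusminus> idet ?E' ?E' (hop \<tau> e0)" .
  have red: "idet ?W ?W (fox \<tau>) =\<^sub>\<plusminus> idet ?E' ?E' (hop \<tau> e0)"
    using pm_eq_trans[OF 1 pm_eq_trans[OF block]] right left by simp
  \<comment> \<open>the sum of all rows of \<open>hop\<close> is the unit vector of \<open>e0\<close>, which may therefore replace row \<open>e0\<close>\<close>
  define M' where "M' e e' = (if e = e0 then of_bool (e' = e0) else hop \<tau> e0 e e')" for e e'
  define C' where "C' e e' = (if e = e0 then (if e' = e0 then 1 else - 1) else of_bool (e = e') :: 'r)" for e e'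
  have E: "E = {e0} \<union> ?E'" "E = ?E' \<union> {e0}" using e0 by auto
  have "idet ({e0} \<union> ?E') ({e0} \<union> ?E') M' =\<^sub>\<plusminus> idet {e0} {e0} M' * idet ?E' ?E' M'"
    using fin by (intro idet_block) (auto simp: M'_def)
  moreover have "idet ?E' ?E' M' = idet ?E' ?E' (hop \<tau> e0)"
    using fin by (intro idet_cong) (auto simp: M'_def)
  ultimately have M': "idet E E M' =\<^sub>\<plusminus> idet ?E' ?E' (hop \<tau> e0)"
    using E(1) by (simp add: idet_singleton M'_def)
  have "idet (?E' \<union> {e0}) (?E' \<union> {e0}) C' =\<^sub>\<plusminus> idet ?E' ?E' C' * idet {e0} {e0} C'"
    using fin by (intro idet_block) (auto simp: C'_def)
  moreover have "idet ?E' ?E' C' = idet ?E' ?E' (\<lambda>x y. of_bool (x = y))"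
    using fin by (intro idet_cong) (auto simp: C'_def)
  ultimately have C': "idet E E C' =\<^sub>\<plusminus> 1"
    using E(2) fin by (simp add: idet_singleton idet_id C'_def)
  have "idet E E (hop \<tau> e0) = idet E E (\<lambda>e e'. \<Sum>x\<in>E. C' e x * M' x e')"
  proof (rule idet_cong)
    fix e e' assume e: "e \<in> E" "e' \<in> E"
    show "hop \<tau> e0 e e' = (\<Sum>x\<in>E. C' e x * M' x e')"
    proof (cases "e = e0")
      case True
      have "(\<Sum>x\<in>E. hop \<tau> e0 x e') = of_bool (e' = e0)"
        using e e0 fin by (simp add: hop_def sum.distrib sum_subtractf sum_of_bool sum_of_bool_\<alpha> sum_of_bool_\<beta>
          sum_distrib_left[symmetric] sum_distrib_right[symmetric] del: sum_mult_of_bool_eq sum_of_bool_mult_eq sum_of_bool_eq)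
      then have "hop \<tau> e0 e0 e' = of_bool (e' = e0) - (\<Sum>x\<in>?E'. hop \<tau> e0 x e')"
        using fin e0 by (simp add: sum.remove algebra_simps)
      also have "\<dots> = (\<Sum>x\<in>E. C' e x * M' x e')"
        using True fin e0 by (simp add: sum.remove C'_def M'_def sum_negf)
      finally show ?thesis using True by simp
    next
      case False
      then have "(\<Sum>x\<in>E. C' e x * M' x e') = (\<Sum>x\<in>E. if x = e then hop \<tau> e0 e e' else 0)"
        by (intro sum.cong refl) (auto simp: C'_def M'_def)
      then show ?thesis using e fin by simp
    qed
  qed (use fin in auto)
  also have "\<dots> = idet E E C' * idet E E M'" using fin by (intro idet_mult) auto
  finally have "idet E E (hop \<tau> e0) =\<^sub>\<plusminus> idet E E M'" using C' by (auto simp: pm_eq_def)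
  then show ?thesis
    unfolding W using pm_eq_trans[OF red pm_eq_sym[OF pm_eq_trans[OF _ M']]] by blast
qed

theorem fox_minor:
  fixes \<tau> :: "'r::{idom,ring_char_0}"
  assumes r: "r \<in> E <+> E" and c: "c \<in> E <+> E" and e0: "e0 \<in> E"
  shows "idet ((E <+> E) - {r}) ((E <+> E) - {c}) (fox \<tau>) =\<^sub>\<plusminus>
    case_sum (\<lambda>_. \<tau>) (\<lambda>_. 1) r * (\<tau> ^ (card VB - 1) * idet F F (dual_laplacian \<tau> (R e0)))"
proof -
  let ?W = "E <+> E"
  have fin: "finite ?W" using finite_E by simp
  have W0: "Inr e0 \<in> ?W" using e0 by (rule InrI)
  have pos: "card ?W > 0" using fin W0 by (auto simp: card_gt_0_iff)
  have "idet (?W - {r}) (?W - {c}) (fox \<tau>) =\<^sub>\<plusminus> idet (?W - {r}) (?W - {Inr e0}) (fox \<tau>)"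
    using fin r c W0 pos fox_row_sum[of _ \<tau>] by (intro idet_omit_column) auto
  also have "\<dots> =\<^sub>\<plusminus> case_sum (\<lambda>_. \<tau>) (\<lambda>_. 1) r * idet (?W - {Inr e0}) (?W - {Inr e0}) (fox \<tau>)"
    using fin r W0 pos fox_column_sum[of _ \<tau>] by (intro idet_omit_row) auto
  also have "\<dots> =\<^sub>\<plusminus> case_sum (\<lambda>_. \<tau>) (\<lambda>_. 1) r * (\<tau> ^ (card VB - 1) * idet F F (dual_laplacian \<tau> (R e0)))"
    using pm_eq_trans[OF idet_fox_reduced[OF e0] idet_hop[OF e0]] by (intro pm_eq_mult) auto
  finally show ?thesis .
qed

end

section \<open>Subgraphs of a bipartite plane graph\<close>

text \<open>
  From left to right, a path that joins the two sides of a cut uses an edge of the cut; from right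
  to left, no edge leaves the set of reachable vertices.
\<close>

lemma (in wf_digraph) connected_iff_connects:
  assumes "finite (arcs G)" "finite (verts G)"
  shows "Digraph_Component.connected G \<longleftrightarrow> connects (arcs G) (tail G) (head G) (verts G)"
proof
  assume conn: "Digraph_Component.connected G"
  show "connects (arcs G) (tail G) (head G) (verts G)"
    unfolding connects_def
  proof (intro conjI allI impI)
    show "verts G \<noteq> {}" using conn by (simp add: connected_conv)
    fix X assume X: "X \<subseteq> verts G" "X \<noteq> {}" "X \<noteq> verts G"
    then obtain u v where uv: "u \<in> X" "v \<in> verts G - X" by blast
    show "\<exists>e\<in>arcs G. crosses (tail G) (head G) X e"
    proof (rule ccontr)
      assume no: "\<not> (\<exists>e\<in>arcs G. crosses (tail G) (head G) X e)"
      have "(u, v) \<in> rtrancl_on (verts G) ((arcs_ends G)\<^sup>s)"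
        using conn uv X(1) by (auto simp: connected_conv)
      then have "u \<in> X \<Longrightarrow> v \<in> X"
      proof (induction rule: rtrancl_on.induct)
        case (rtrancl_on_into_rtrancl_on a b c)
        then show ?case using no by (auto simp: symcl_def arcs_ends_conv crosses_def)
      qed simp
      then show False using uv by blast
    qed
  qed (use assms in auto)
next
  assume conn: "connects (arcs G) (tail G) (head G) (verts G)"
  note C = connectsD[OF conn]
  show "Digraph_Component.connected G"
    unfolding connected_conv
  proof (intro conjI ballI)
    show "verts G \<noteq> {}" by (rule C(3))
    fix u v assume u: "u \<in> verts G" and v: "v \<in> verts G"
    let ?X = "{w \<in> verts G. (u, w) \<in> rtrancl_on (verts G) ((arcs_ends G)\<^sup>s)}"
    have "?X = verts G"
    proof (rule ccontr)
      assume "?X \<noteq> verts G"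
      moreover have "?X \<noteq> {}" using u by blast
      ultimately obtain e where e: "e \<in> arcs G" "crosses (tail G) (head G) ?X e" using C(6)[of ?X] by blast
      have "(tail G e, head G e) \<in> (arcs_ends G)\<^sup>s" "(head G e, tail G e) \<in> (arcs_ends G)\<^sup>s"
        using e(1) by (auto simp: symcl_def arcs_ends_conv)
      then show False
        using e C(4,5)[OF e(1)] by (auto simp: crosses_def intro: rtrancl_on_into_rtrancl_on)
    qed
    then show "(u, v) \<in> rtrancl_on (verts G) ((arcs_ends G)\<^sup>s)" using v by blast
  qed
qed

context pre_digraph
begin

lemma sum_list_incidence_cas:
  "cas u p v \<Longrightarrow> (\<Sum>e\<leftarrow>p. incidence (tail G) (head G) e w) = (of_bool (u = w) - of_bool (v = w) :: int)"
  by (induction u p v rule: cas.induct) (auto simp: incidence_def)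

lemma head_in_awalk_verts:
  "cas u p v \<Longrightarrow> e \<in> set p \<Longrightarrow> head G e \<in> set (awalk_verts u p)"
proof (induction u p v rule: cas.induct)
  case (2 u e' es v)
  then show ?case by (cases es) auto
qed simp

text \<open>
  Passing an edge in both directions would repeat a vertex.
\<close>

lemma apath_no_reverse:
  "cas u p v \<Longrightarrow> distinct (awalk_verts u p) \<Longrightarrow> x \<in> set p \<Longrightarrow> y \<in> set p \<Longrightarrow>
    \<not> (tail G y = head G x \<and> head G y = tail G x)"
proof (induction u p v rule: cas.induct)
  case (2 u e es v)
  have tl: "tail G e \<notin> set (awalk_verts (head G e) es)" and cas: "cas (head G e) es v"
    using "2.prems" by auto
  have "head G e \<in> set (awalk_verts (head G e) es)" using cas by (cases es) auto
  show ?case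
  proof
    assume rev: "tail G y = head G x \<and> head G y = tail G x"
    consider "x \<in> set es" "y \<in> set es" | "x = e" "y = e" | "x = e" "y \<in> set es" | "x \<in> set es" "y = e"
      using "2.prems"(3,4) by auto
    then show False
    proof cases
      case 1
      then show False using "2.IH"[OF cas] "2.prems"(2) rev by simp
    next
      case 2
      then have "tail G e = head G e" using rev by blast
      then show False using tl \<open>head G e \<in> set (awalk_verts (head G e) es)\<close> by metis
    next
      case 3
      then show False using rev tl head_in_awalk_verts[OF cas, of y] by simp
    next
      case 4
      then show False using rev tl head_in_awalk_verts[OF cas, of x] by simp
    qed
  qed
qed simp

end

locale bipartite_plane_graph = plane_graph G arev rot
  for G :: "('a::finite, 'b) pre_digraph" and arev rot :: "'b \<Rightarrow> 'b" +
  fixes A B :: "'a set"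
  assumes bip: "bipartition G A B"
begin

text \<open>
  Every undirected edge is represented by its dart based in \<open>A\<close>.
\<close>

definition edges :: "'b set" where
  "edges = {e \<in> arcs G. tail G e \<in> A}"

definition subgraph_of :: "'b set \<Rightarrow> ('a, 'b) pre_digraph" where
  "subgraph_of Z = \<lparr>verts = verts G, arcs = Z \<union> arev ` Z, tail = tail G, head = head G\<rparr>"

lemma subgraph_of_simps [simp]:
  "verts (subgraph_of Z) = verts G" "arcs (subgraph_of Z) = Z \<union> arev ` Z"
  "tail (subgraph_of Z) = tail G" "head (subgraph_of Z) = head G"
  by (simp_all add: subgraph_of_def)

lemma side: "e \<in> arcs G \<Longrightarrow> head G e \<in> A \<longleftrightarrow> tail G e \<notin> A"
  using bip by (auto simp: bipartition_def)

lemma edgesD: "e \<in> edges \<Longrightarrow> e \<in> arcs G" "e \<in> edges \<Longrightarrow> tail G e \<in> A" "e \<in> edges \<Longrightarrow> head G e \<notin> A"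
  using side by (auto simp: edges_def)

lemma arev_edges: "e \<in> arcs G \<Longrightarrow> arev e \<in> edges \<longleftrightarrow> e \<notin> edges"
  using side by (auto simp: edges_def)

lemma finite_edges: "finite edges"
  by (simp add: edges_def)

lemma arcs_eq: "arcs G = edges \<union> arev ` edges"
proof
  show "arcs G \<subseteq> edges \<union> arev ` edges"
  proof
    fix e assume e: "e \<in> arcs G"
    have "e \<in> arev ` edges" if "e \<notin> edges"
      using arev_edges[OF e] that by (intro image_eqI[of _ _ "arev e"]) auto
    then show "e \<in> edges \<union> arev ` edges" by blast
  qed
qed (auto dest: edgesD)

lemma disjoint_reverse: "Z \<subseteq> edges \<Longrightarrow> Z \<inter> arev ` Z = {}"
  using arev_edges edgesD(1) by blast

lemma wf_subgraph_of: "Z \<subseteq> edges \<Longrightarrow> wf_digraph (subgraph_of Z)"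
  using edgesD(1) by unfold_locales (auto simp: subset_iff)

lemma spanning_subgraph_of: "Z \<subseteq> Z' \<Longrightarrow> Z' \<subseteq> edges \<Longrightarrow> spanning (subgraph_of Z) (subgraph_of Z')"
  using wf_subgraph_of[of Z] wf_subgraph_of[of Z'] by (auto simp: spanning_def subgraph_def compatible_def)

lemma subgraph_of_edges: "subgraph_of edges = G"
  unfolding subgraph_of_def arcs_eq[symmetric] by simp

lemma arev_image_subgraph_of: "arev ` arcs (subgraph_of Z) = arcs (subgraph_of Z)"
  by (auto simp: image_Un image_image)

lemma spanning_eq_subgraph_of:
  assumes "spanning H (subgraph_of Z)" "arev ` arcs H = arcs H" "Z \<subseteq> edges"
  shows "\<exists>Z'\<subseteq>Z. H = subgraph_of Z'"
proof -
  have H: "arcs H \<subseteq> Z \<union> arev ` Z" "verts H = verts G" "tail H = tail G" "head H = head G"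
    using assms(1) by (auto simp: spanning_def subgraph_def compatible_def)
  let ?Z' = "arcs H \<inter> Z"
  have "arcs H = ?Z' \<union> arev ` ?Z'"
  proof
    show "arcs H \<subseteq> ?Z' \<union> arev ` ?Z'"
    proof
      fix e assume e: "e \<in> arcs H"
      have "e \<in> arev ` ?Z'" if "e \<notin> Z"
      proof -
        obtain z where z: "z \<in> Z" "e = arev z" using e H(1) \<open>e \<notin> Z\<close> by blast
        have "arev e \<in> arcs H" using e assms(2) by blast
        then show ?thesis using z by auto
      qed
      then show "e \<in> ?Z' \<union> arev ` ?Z'" using e by blast
    qed
    show "?Z' \<union> arev ` ?Z' \<subseteq> arcs H" using assms(2) by blast
  qed
  then have "H = subgraph_of ?Z'" using H by (simp add: subgraph_of_def)
  then show ?thesis by blast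
qed

lemma connects_subgraph_of:
  assumes Z: "Z \<subseteq> edges"
  shows "connects (Z \<union> arev ` Z) (tail G) (head G) (verts G) \<longleftrightarrow> connects Z (tail G) (head G) (verts G)"
proof -
  have arc: "e \<in> arcs G" if "e \<in> Z" for e using Z edgesD(1) that by blast
  have "(\<exists>e\<in>Z \<union> arev ` Z. crosses (tail G) (head G) X e) \<longleftrightarrow> (\<exists>e\<in>Z. crosses (tail G) (head G) X e)" for X
    using arc by (auto simp: crosses_def)
  moreover have "finite Z" using Z finite_edges by (rule finite_subset)
  ultimately show ?thesis using arc by (auto simp: connects_def)
qed

lemma connected_subgraph_of:
  assumes Z: "Z \<subseteq> edges"
  shows "Digraph_Component.connected (subgraph_of Z) \<longleftrightarrow> connects Z (tail G) (head G) (verts G)"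
proof -
  interpret H: wf_digraph "subgraph_of Z" by (rule wf_subgraph_of[OF Z])
  have "finite Z" using Z finite_edges by (rule finite_subset)
  then show ?thesis
    using H.connected_iff_connects connects_subgraph_of[OF Z] by simp
qed

lemma connected_spanning_subgraphs_subgraph_of:
  assumes "Z \<subseteq> edges"
  shows "connected_spanning_subgraphs (subgraph_of Z) arev =
    subgraph_of ` {Z'. Z' \<subseteq> Z \<and> connects Z' (tail G) (head G) (verts G)}" (is "?L = ?R")
proof
  show "?L \<subseteq> ?R"
  proof
    fix H assume "H \<in> ?L"
    then have H: "spanning H (subgraph_of Z)" "arev ` arcs H = arcs H" "Digraph_Component.connected H"
      by (auto simp: connected_spanning_subgraphs_def)
    then obtain Z' where Z': "Z' \<subseteq> Z" "H = subgraph_of Z'" using spanning_eq_subgraph_of assms by blast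
    then show "H \<in> ?R" using H(3) connected_subgraph_of[of Z'] assms by blast
  qed
  show "?R \<subseteq> ?L"
  proof
    fix H assume "H \<in> ?R"
    then obtain Z' where Z': "Z' \<subseteq> Z" "connects Z' (tail G) (head G) (verts G)" "H = subgraph_of Z'" by blast
    have "Digraph_Component.connected H" using connected_subgraph_of[of Z'] Z' assms by blast
    then show "H \<in> ?L"
      using spanning_subgraph_of[OF Z'(1) assms] arev_image_subgraph_of[of Z'] Z'(3)
      unfolding connected_spanning_subgraphs_def by blast
  qed
qed

lemma inj_subgraph_of: "inj_on subgraph_of (Pow edges)"
proof (rule inj_onI)
  fix Z Z' assume Z: "Z \<in> Pow edges" "Z' \<in> Pow edges" and eq: "subgraph_of Z = subgraph_of Z'"
  have "(Z \<union> arev ` Z) \<inter> edges = Z" if "Z \<subseteq> edges" for Z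
    using that arev_edges edgesD(1) by blast
  moreover have "Z \<union> arev ` Z = Z' \<union> arev ` Z'" using eq by (metis subgraph_of_simps(2))
  ultimately show "Z = Z'" using Z by (metis PowD)
qed

lemma num_edges_subgraph_of: "Z \<subseteq> edges \<Longrightarrow> num_edges (subgraph_of Z) = card Z"
proof -
  assume Z: "Z \<subseteq> edges"
  then have "finite Z" using finite_edges by (rule finite_subset)
  then have "card (Z \<union> arev ` Z) = 2 * card Z"
    using disjoint_reverse[OF Z] card_image[OF inj_on_arev, of Z] by (subst card_Un_disjoint) auto
  then show ?thesis by (simp add: num_edges_def)
qed

text \<open>
  A closed walk gives a circulation, in which each edge counts with its number of passages,
  signed by direction. On a tree it vanishes, so that every passage is matched by a reverse one.
\<close>

lemma acyclic_if_spans_tree: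
  assumes T: "spans_tree T (tail G) (head G) (verts G)" "T \<subseteq> edges"
    and p: "pre_digraph.cycle (subgraph_of T) p" "\<forall>e\<in>set p. arev e \<notin> set p"
  shows False
proof -
  interpret H: wf_digraph "subgraph_of T" by (rule wf_subgraph_of[OF T(2)])
  obtain u where u: "H.cas u p u" "set p \<subseteq> T \<union> arev ` T" "distinct p" "p \<noteq> []"
    using p(1) unfolding H.cycle_conv H.awalk_def by auto
  have fin: "finite T" using T(2) finite_edges by (rule finite_subset)
  define c :: "'b \<Rightarrow> int" where "c e = of_bool (e \<in> set p) - of_bool (arev e \<in> set p)" for e
  have arc: "e \<in> arcs G" if "e \<in> T" for e using T(2) edgesD(1) that by blast
  have "(\<Sum>e\<in>T. c e * incidence (tail G) (head G) e v) = 0" for v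
  proof -
    have "0 = (\<Sum>e\<leftarrow>p. incidence (tail G) (head G) e v :: int)"
      using H.sum_list_incidence_cas[OF u(1), of v] by simp
    also have "\<dots> = (\<Sum>e\<in>set p. incidence (tail G) (head G) e v)"
      using u(3) by (simp add: sum_list_distinct_conv_sum_set)
    also have "\<dots> = (\<Sum>e\<in>T \<union> arev ` T. of_bool (e \<in> set p) * incidence (tail G) (head G) e v)"
      using u(2) fin by (intro sum.mono_neutral_cong_left) auto
    also have "\<dots> = (\<Sum>e\<in>T. of_bool (e \<in> set p) * incidence (tail G) (head G) e v) +
        (\<Sum>e\<in>arev ` T. of_bool (e \<in> set p) * incidence (tail G) (head G) e v)"
      using fin disjoint_reverse[OF T(2)] by (intro sum.union_disjoint) auto
    also have "(\<Sum>e\<in>arev ` T. of_bool (e \<in> set p) * incidence (tail G) (head G) e v) =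
        (\<Sum>e\<in>T. of_bool (arev e \<in> set p) * (- incidence (tail G) (head G) e v :: int))"
      using arc by (subst sum.reindex) (auto simp: incidence_def intro!: sum.cong)
    finally show ?thesis by (simp add: c_def left_diff_distrib sum_subtractf sum_negf)
  qed
  then have zero: "c e = 0" if "e \<in> T" for e using spans_tree_independent[OF T(1) that, of c] by simp
  obtain x where x: "x \<in> set p" using u(4) by (cases p) auto
  then consider "x \<in> T" | z where "z \<in> T" "x = arev z" using u(2) by blast
  then show False
  proof cases
    case 1
    then show False using zero[OF 1] x p(2) by (auto simp: c_def)
  next
    case 2
    then show False using zero[OF 2(1)] x p(2) by (auto simp: c_def)
  qed
qed

text \<open>
  An edge outside a spanning tree closes a cycle with a path of the tree.
\<close>

lemma cycle_if_not_spans_tree: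
  assumes Z: "connects Z (tail G) (head G) (verts G)" "Z \<subseteq> edges"
    and no: "\<not> spans_tree Z (tail G) (head G) (verts G)"
  shows "\<exists>p. pre_digraph.cycle (subgraph_of Z) p \<and> (\<forall>e\<in>set p. arev e \<notin> set p)"
proof -
  obtain T where T: "T \<subseteq> Z" "spans_tree T (tail G) (head G) (verts G)" using spans_tree_exists[OF Z(1)] by blast
  have "T \<noteq> Z" using T(2) no by metis
  then obtain e where e: "e \<in> Z" "e \<notin> T" using T(1) by blast
  have TE: "T \<subseteq> edges" using T(1) Z(2) by blast
  interpret H: wf_digraph "subgraph_of T" by (rule wf_subgraph_of[OF TE])
  interpret K: wf_digraph "subgraph_of Z" by (rule wf_subgraph_of[OF Z(2)])
  have arc: "e \<in> arcs G" using e(1) Z(2) edgesD(1) by blast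
  have arcT: "x \<in> arcs G" if "x \<in> T" for x using TE edgesD(1) that by blast
  have "symmetric (subgraph_of T)"
    unfolding symmetric_def sym_def arcs_ends_conv using arcT by (auto simp: image_Un image_image) 
  moreover have "Digraph_Component.connected (subgraph_of T)"
    using connected_subgraph_of[OF TE] spans_treeD(1)[OF T(2)] by simp
  ultimately have "strongly_connected (subgraph_of T)" by (rule H.symmetric_connected_imp_strongly_connected)
  then have "reachable (subgraph_of T) (head G e) (tail G e)"
    using arc unfolding strongly_connected_def by simp
  then obtain p where p: "H.apath (head G e) p (tail G e)" unfolding H.reachable_apath by blast
  then have p': "H.cas (head G e) p (tail G e)" "distinct (H.awalk_verts (head G e) p)" "set p \<subseteq> T \<union> arev ` T"
    unfolding H.apath_def H.awalk_def by auto
  have compat: "compatible (subgraph_of T) (subgraph_of Z)" by (simp add: compatible_def)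
  have cyc: "K.cycle (e # p)"
    unfolding K.cycle_def K.awalk_def
    using p' compatible_cas[OF compat] compatible_awalk_verts[OF compat] arc e(1) T(1)
    by (intro exI[of _ "tail G e"]) auto
  have ep: "e \<notin> set p" "arev e \<notin> set p"
  proof -
    have eE: "e \<in> edges" using e(1) Z(2) by blast
    then have "arev e \<notin> edges" using arev_edges[OF arc] by simp
    then have "arev e \<notin> T" using TE by blast
    moreover have "arev e \<notin> arev ` T" using e(2) by (auto simp: arev_eq_iff)
    ultimately show "arev e \<notin> set p" using p'(3) by blast
    show "e \<notin> set p" using p'(3) e(2) eE arev_edges TE arcT by blast
  qed
  have "arev x \<notin> set (e # p)" if x: "x \<in> set (e # p)" for x
  proof
    assume ax: "arev x \<in> set (e # p)"
    have "arev e \<noteq> e" using arc by (rule arev_neq)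
    then have "x \<noteq> e" using ax ep by auto
    moreover have "arev x \<noteq> e" using x ep \<open>arev e \<noteq> e\<close> by (metis arev_arev set_ConsD)
    ultimately have "x \<in> set p" "arev x \<in> set p" using x ax by auto
    moreover have "x \<in> arcs G" using calculation(1) p'(3) arcT by auto
    ultimately show False using H.apath_no_reverse[OF p'(1,2), of x "arev x"] by simp
  qed
  then show ?thesis using cyc by blast
qed

lemma undirected_spanning_tree_iff:
  assumes Z: "Z \<subseteq> edges"
  shows "undirected_spanning_tree arev T (subgraph_of Z) \<longleftrightarrow>
    (\<exists>T0\<subseteq>Z. T = subgraph_of T0 \<and> spans_tree T0 (tail G) (head G) (verts G))"
proof
  assume "undirected_spanning_tree arev T (subgraph_of Z)"
  then obtain T0 where "T0 \<subseteq> Z" "T = subgraph_of T0" "connects T0 (tail G) (head G) (verts G)"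
    "\<not> (\<exists>p. pre_digraph.cycle T p \<and> (\<forall>e\<in>set p. arev e \<notin> set p))"
    unfolding undirected_spanning_tree_def connected_spanning_subgraphs_subgraph_of[OF Z] by blast
  then show "\<exists>T0\<subseteq>Z. T = subgraph_of T0 \<and> spans_tree T0 (tail G) (head G) (verts G)"
    using cycle_if_not_spans_tree[of T0] Z by blast
next
  assume "\<exists>T0\<subseteq>Z. T = subgraph_of T0 \<and> spans_tree T0 (tail G) (head G) (verts G)"
  then obtain T0 where T0: "T0 \<subseteq> Z" "T = subgraph_of T0" "spans_tree T0 (tail G) (head G) (verts G)" by blast
  then show "undirected_spanning_tree arev T (subgraph_of Z)"
    unfolding undirected_spanning_tree_def connected_spanning_subgraphs_subgraph_of[OF Z]
    using acyclic_if_spans_tree[OF T0(3)] spans_treeD(1) Z by blast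
qed

lemma edge_points_subgraph_of:
  assumes "Z \<subseteq> edges"
  shows "edge_points A (subgraph_of Z) = (\<lambda>e. axis (tail G e) 1 - axis (head G e) 1) ` Z"
proof -
  have "tail G (arev e) \<notin> A" "tail G e \<in> A" if "e \<in> Z" for e
    using assms edgesD that by (auto simp: subset_iff)
  then have "{e \<in> arcs (subgraph_of Z). tail (subgraph_of Z) e \<in> A} = Z" by auto
  then show ?thesis by (simp add: edge_points_def)
qed

end

section \<open>The hypermap of a connected bipartite plane graph\<close>

text \<open>
  A copy of a finite type with an arbitrary well-order, as required by \<open>unimodular_frame\<close>.
\<close>

typedef 'a ranked = "UNIV :: 'a set" morphisms unrank Rank by simp

lemma inj_Rank: "inj Rank"
  by (rule injI) (simp add: Rank_inject)

lemma unrank_Rank [simp]: "unrank (Rank x) = x" "Rank (unrank y) = y"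
  by (simp_all add: Rank_inverse unrank_inverse)

instance ranked :: (finite) finite
proof
  have "(UNIV :: 'a ranked set) = range Rank" by (metis UNIV_eq_I rangeI unrank_Rank(2))
  then show "finite (UNIV :: 'a ranked set)" by (metis finite finite_imageI)
qed

instantiation ranked :: (finite) wellorder
begin

definition less_eq_ranked :: "'a ranked \<Rightarrow> 'a ranked \<Rightarrow> bool" where
  "x \<le> y \<longleftrightarrow> to_nat_on UNIV (unrank x) \<le> to_nat_on UNIV (unrank y)"

definition less_ranked :: "'a ranked \<Rightarrow> 'a ranked \<Rightarrow> bool" where
  "x < y \<longleftrightarrow> to_nat_on UNIV (unrank x) < to_nat_on UNIV (unrank y)"

instance
proof
  have inj: "inj (to_nat_on (UNIV :: 'a set))" by (intro inj_on_to_nat_on countable_finite) simp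
  show "x = y" if "x \<le> y" "y \<le> x" for x y :: "'a ranked"
  proof -
    have "unrank x = unrank y" using that inj by (simp add: less_eq_ranked_def inj_eq)
    then show ?thesis by (simp add: unrank_inject)
  qed
  show "P x" if "\<And>x. (\<And>y. y < x \<Longrightarrow> P y) \<Longrightarrow> P x" for P and x :: "'a ranked"
    by (rule measure_induct[of "\<lambda>x. to_nat_on UNIV (unrank x)" P]) (use that in \<open>auto simp: less_ranked_def\<close>)
qed (auto simp: less_eq_ranked_def less_ranked_def)

end

lemma connects_inj_image:
  assumes f: "inj f"
  shows "connects Z (f \<circ> p) (f \<circ> q) (f ` V) \<longleftrightarrow> connects Z p q V"
proof -
  have cr: "crosses (f \<circ> p) (f \<circ> q) (f ` X) e \<longleftrightarrow> crosses p q X e" for X e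
    using f by (simp add: crosses_def inj_image_mem_iff)
  have "(\<forall>Y\<subseteq>f ` V. Y \<noteq> {} \<longrightarrow> Y \<noteq> f ` V \<longrightarrow> (\<exists>e\<in>Z. crosses (f \<circ> p) (f \<circ> q) Y e)) \<longleftrightarrow>
      (\<forall>X\<subseteq>V. X \<noteq> {} \<longrightarrow> X \<noteq> V \<longrightarrow> (\<exists>e\<in>Z. crosses p q X e))" (is "?L \<longleftrightarrow> ?R")
  proof
    assume L: ?L
    show ?R
    proof (intro allI impI)
      fix X assume "X \<subseteq> V" "X \<noteq> {}" "X \<noteq> V"
      then have "f ` X \<subseteq> f ` V" "f ` X \<noteq> {}" "f ` X \<noteq> f ` V" using f by (auto simp: inj_image_eq_iff)
      then show "\<exists>e\<in>Z. crosses p q X e" using L cr by blast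
    qed
  next
    assume R: ?R
    show ?L
    proof (intro allI impI)
      fix Y assume Y: "Y \<subseteq> f ` V" "Y \<noteq> {}" "Y \<noteq> f ` V"
      then obtain X where X: "X \<subseteq> V" "Y = f ` X" by (auto simp: subset_image_iff)
      then have "X \<noteq> {}" "X \<noteq> V" using Y by auto
      then show "\<exists>e\<in>Z. crosses (f \<circ> p) (f \<circ> q) Y e" using R X cr by blast
    qed
  qed
  moreover have "finite (f ` V) \<longleftrightarrow> finite V" using f by (simp add: finite_image_iff inj_on_subset)
  moreover have "(f \<circ> p) ` Z \<subseteq> f ` V \<longleftrightarrow> p ` Z \<subseteq> V" "(f \<circ> q) ` Z \<subseteq> f ` V \<longleftrightarrow> q ` Z \<subseteq> V"
    using f by (simp_all only: image_comp[symmetric] inj_image_subset_iff)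
  ultimately show ?thesis by (simp add: connects_def)
qed

lemma spans_tree_inj_image:
  assumes f: "inj f"
  shows "spans_tree Z (f \<circ> p) (f \<circ> q) (f ` V) \<longleftrightarrow> spans_tree Z p q V"
  using card_image[of f V] f by (simp add: spans_tree_def connects_inj_image inj_on_subset)

locale connected_bipartite_plane_graph = bipartite_plane_graph G arev rot A B
  for G :: "('a::finite, 'b) pre_digraph" and arev rot :: "'b \<Rightarrow> 'b" and A B :: "'a set" +
  assumes connected: "Digraph_Component.connected G" and arcs_nonempty: "arcs G \<noteq> {}"
begin

text \<open>
  The rotation around the head of a dart.
\<close>

definition turn :: "'b \<Rightarrow> 'b" where
  "turn e = arev (rot (arev e))"

definition face :: "'b \<Rightarrow> 'b set" where
  "face e = orbit (face_succ arev rot) e"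

lemma rot_arcs: "rot e \<in> arcs G \<longleftrightarrow> e \<in> arcs G"
  using permutes_in_image[OF rot_permutes] .

lemma rot_edges: "e \<in> edges \<Longrightarrow> rot e \<in> edges"
  using tail_rot rot_arcs by (simp add: edges_def)

lemma rot_nonedges: "e \<in> arcs G \<Longrightarrow> e \<notin> edges \<Longrightarrow> rot e \<notin> edges"
  using tail_rot by (simp add: edges_def)

lemma arev_nonedge: "e \<in> edges \<Longrightarrow> arev e \<in> arcs G \<and> arev e \<notin> edges"
  using arev_edges edgesD(1) by auto

lemma turn_edges: "e \<in> edges \<Longrightarrow> turn e \<in> edges"
  using arev_nonedge[of e] rot_nonedges[of "arev e"] arev_edges[of "rot (arev e)"] rot_arcs by (simp add: turn_def)

lemma rot_inj: "rot x = rot y \<longleftrightarrow> x = y"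
  using permutes_inj[OF rot_permutes] by (simp add: inj_eq)

lemma face_permutes: "face_succ arev rot permutes arcs G"
proof -
  have "face_succ arev rot = rot \<circ> arev" by (auto simp: face_succ_def)
  then show ?thesis using permutes_compose[OF arev_permutes_arcs rot_permutes] by simp
qed

lemma face_face_succ: "face (face_succ arev rot e) = face e"
  using orbit_cyclic_eq3[OF cyclic_on_orbit[OF face_permutes finite_arcs, of e], of "face_succ arev rot e"]
  by (simp add: face_def orbit.base)

lemma edges_nonempty: "edges \<noteq> {}"
  using arcs_nonempty arcs_eq by auto

lemma connects_edges: "connects edges (tail G) (head G) (verts G)"
  using connected connected_subgraph_of[of edges] subgraph_of_edges by simp

lemma verts_eq: "verts G = tail G ` edges \<union> head G ` edges"
proof
  show "verts G \<subseteq> tail G ` edges \<union> head G ` edges"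
  proof
    fix v assume v: "v \<in> verts G"
    obtain e where e: "e \<in> edges" using edges_nonempty by blast
    show "v \<in> tail G ` edges \<union> head G ` edges"
    proof (cases "{v} = verts G")
      case True
      then show ?thesis using e edgesD(1) by force
    next
      case False
      then obtain e where "e \<in> edges" "crosses (tail G) (head G) {v} e"
        using connectsD(6)[OF connects_edges, of "{v}"] v by auto
      then show ?thesis by (auto simp: crosses_def)
    qed
  qed
qed (use edgesD(1) in auto)

lemma isolated_empty: "isolated_verts G = {}"
proof -
  have "out_arcs G v \<noteq> {}" if v: "v \<in> verts G" for v
  proof -
    obtain e where e: "e \<in> edges" "v = tail G e \<or> v = head G e" using v unfolding verts_eq by blast
    have "e \<in> arcs G" "arev e \<in> arcs G" "tail G (arev e) = head G e" using edgesD(1)[OF e(1)] by auto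
    then have "e \<in> out_arcs G v \<or> arev e \<in> out_arcs G v" using e(2) by (auto simp: out_arcs_def)
    then show ?thesis by blast
  qed
  then show ?thesis by (auto simp: isolated_verts_def)
qed

lemma card_sccs: "card sccs = 1"
proof -
  have "symmetric G"
    unfolding symmetric_def
  proof (rule symI)
    fix x y assume "(x, y) \<in> arcs_ends G"
    then obtain e where e: "e \<in> arcs G" "x = tail G e" "y = head G e" by (auto simp: arcs_ends_conv)
    then show "(y, x) \<in> arcs_ends G"
      unfolding arcs_ends_conv by (intro image_eqI[of _ _ "arev e"]) auto
  qed
  then have strong: "strongly_connected G" using connected by (rule symmetric_connected_imp_strongly_connected)
  have "sccs_verts = {verts G}"
  proof (intro Set.set_eqI iffI)
    fix S assume "S \<in> sccs_verts"
    then have S: "S \<noteq> {}" "\<forall>u\<in>S. \<forall>v\<in>S. reachable G u v"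
        "\<forall>u\<in>S. \<forall>v. v \<notin> S \<longrightarrow> \<not> reachable G u v \<or> \<not> reachable G v u"
      by (auto simp: sccs_verts_def)
    have sub: "S \<subseteq> verts G" using S(2) reachable_in_verts(1) by blast
    moreover have "verts G \<subseteq> S"
    proof
      fix v assume v: "v \<in> verts G"
      obtain u where u: "u \<in> S" using S(1) by blast
      then have "reachable G u v" "reachable G v u" using strong sub v unfolding strongly_connected_def by blast+
      then show "v \<in> S" using S(3) u by blast
    qed
    ultimately show "S \<in> {verts G}" by blast
  next
    fix S assume "S \<in> {verts G}"
    then have S: "S = verts G" by simp
    have "\<not> reachable G u v" if "v \<notin> S" for u v using that reachable_in_verts(2) S by blast
    moreover have "S \<noteq> {}" "\<forall>u\<in>S. \<forall>v\<in>S. reachable G u v" using strong unfolding strongly_connected_def S by blast+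
    ultimately show "S \<in> sccs_verts" unfolding sccs_verts_def mem_Collect_eq by blast
  qed
  then show ?thesis using card_sccs_verts by simp
qed

lemma face_image: "face ` edges = facial_walks G arev rot"
proof
  show "facial_walks G arev rot \<subseteq> face ` edges"
  proof
    fix w assume "w \<in> facial_walks G arev rot"
    then obtain e where e: "e \<in> arcs G" "w = face e" by (auto simp: facial_walks_def face_def)
    show "w \<in> face ` edges"
    proof (cases "e \<in> edges")
      case False
      then have "arev e \<in> edges" using arev_edges[OF e(1)] by simp
      then have "face_succ arev rot e \<in> edges" by (simp add: face_succ_def rot_edges)
      then show ?thesis using e(2) face_face_succ[of e] by (metis image_eqI)
    qed (use e in blast)
  qed
qed (auto simp: facial_walks_def face_def dest: edgesD)

lemma sides_disjoint: "tail G ` edges \<inter> head G ` edges = {}"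
  using edgesD(2,3) by (metis (no_types, lifting) disjoint_iff imageE)

lemma euler_edges: "card (tail G ` edges) + card (head G ` edges) + card (face ` edges) = card edges + 2"
proof -
  have "card (arcs G) = 2 * card edges"
    using num_edges_subgraph_of[of edges] card_image[OF inj_on_arev, of edges] disjoint_reverse[of edges] finite_edges
    unfolding arcs_eq by (subst card_Un_disjoint) auto
  moreover have "card (verts G) = card (tail G ` edges) + card (head G ` edges)"
    unfolding verts_eq using finite_edges sides_disjoint by (intro card_Un_disjoint) auto
  ultimately show ?thesis using euler by (simp add: isolated_empty card_sccs face_image)
qed

lemma bij_rot_edges: "bij_betw rot edges edges"
proof -
  have "inj_on rot edges" by (simp add: inj_on_def rot_inj)
  moreover have "rot ` edges \<subseteq> edges" using rot_edges by blast
  ultimately show ?thesis using endo_inj_surj[OF finite_edges] by (auto simp: bij_betw_def)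
qed

lemma bij_turn_edges: "bij_betw turn edges edges"
proof -
  have "inj_on turn edges" by (simp add: inj_on_def turn_def rot_inj arev_eq_iff)
  moreover have "turn ` edges \<subseteq> edges" using turn_edges by blast
  ultimately show ?thesis using endo_inj_surj[OF finite_edges] by (auto simp: bij_betw_def)
qed

text \<open>
  A set of edges closed under both rotations contains, with an edge, all edges at its two ends.
\<close>

lemma rotation_transitive:
  assumes Y: "Y \<subseteq> edges" "Y \<noteq> {}" and rot: "\<And>e. e \<in> Y \<Longrightarrow> rot e \<in> Y" and turn: "\<And>e. e \<in> Y \<Longrightarrow> turn e \<in> Y"
  shows "Y = edges"
proof -
  have star: "e' \<in> orbit rot e" if "e \<in> arcs G" "e' \<in> arcs G" "tail G e' = tail G e" for e e'
  proof -
    have "cyclic_on rot (out_arcs G (tail G e))" using that(1) by (intro rot_cyclic) (auto simp: out_arcs_def)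
    then have "out_arcs G (tail G e) = orbit rot e"
      using that(1) by (auto simp: cyclic_on_alldef out_arcs_def)
    then show ?thesis using that by (auto simp: out_arcs_def)
  qed
  have tails: "e' \<in> Y" if "e \<in> Y" "e' \<in> edges" "tail G e' = tail G e" for e e'
  proof -
    have "e' \<in> orbit rot e" using that Y(1) edgesD(1) by (intro star) auto
    then show ?thesis by (induction rule: orbit.induct) (use rot that(1) in auto)
  qed
  have heads: "e' \<in> Y" if "e \<in> Y" "e' \<in> edges" "head G e' = head G e" for e e'
  proof -
    have arcs: "e \<in> arcs G" "e' \<in> arcs G" using that Y(1) edgesD(1) by auto
    then have "arev e' \<in> orbit rot (arev e)" using that(3) by (intro star) auto
    then have "arev (arev e') \<in> Y"
    proof (induction rule: orbit.induct)
      case base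
      then show ?case using turn[OF that(1)] by (simp add: turn_def)
    next
      case (step x)
      then show ?case using turn[OF step(2)] by (simp add: turn_def)
    qed
    then show ?thesis by simp
  qed
  let ?X = "tail G ` Y \<union> head G ` Y"
  have XA: "v \<in> A" if "v \<in> tail G ` Y" for v using that Y(1) edgesD(2) by auto
  have XB: "v \<notin> A" if "v \<in> head G ` Y" for v using that Y(1) edgesD(3) by auto
  have in_Y: "e \<in> Y" if e: "e \<in> edges" "tail G e \<in> ?X \<or> head G e \<in> ?X" for e
  proof -
    have "tail G e \<in> tail G ` Y \<or> head G e \<in> head G ` Y"
      using e(2) XA XB edgesD(2,3)[OF e(1)] by blast
    then show ?thesis
    proof
      assume "tail G e \<in> tail G ` Y"
      then obtain y where "y \<in> Y" "tail G e = tail G y" by blast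
      then show ?thesis using tails e(1) by blast
    next
      assume "head G e \<in> head G ` Y"
      then obtain y where "y \<in> Y" "head G e = head G y" by blast
      then show ?thesis using heads e(1) by blast
    qed
  qed
  have "?X = verts G"
  proof (rule ccontr)
    assume "?X \<noteq> verts G"
    moreover have "?X \<subseteq> verts G" "?X \<noteq> {}" using Y edgesD(1) by auto
    ultimately obtain e where "e \<in> edges" "crosses (tail G) (head G) ?X e"
      using connectsD(6)[OF connects_edges, of ?X] by blast
    moreover from this have "e \<in> Y" using in_Y[of e] unfolding crosses_def by blast
    then have "tail G e \<in> ?X" "head G e \<in> ?X" by blast+
    ultimately show False unfolding crosses_def by blast
  qed
  then have "edges \<subseteq> Y" using in_Y edgesD(1) by (auto simp del: Un_iff)
  then show ?thesis using Y(1) by blast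
qed

sublocale hm: plane_hypermap_points edges rot turn "Rank \<circ> tail G" "Rank \<circ> head G" face
proof (unfold_locales)
  show "finite edges" "edges \<noteq> {}" "bij_betw rot edges edges" "bij_betw turn edges edges"
    by (rule finite_edges edges_nonempty bij_rot_edges bij_turn_edges)+
  show "(Rank \<circ> tail G) (rot e) = (Rank \<circ> tail G) e" if "e \<in> edges" for e
    using tail_rot edgesD(1)[OF that] by simp
  show "(Rank \<circ> head G) (turn e) = (Rank \<circ> head G) e" if "e \<in> edges" for e
    using tail_rot[of "arev e"] edgesD(1)[OF that] rot_arcs by (simp add: turn_def)
  show "face (rot (turn e)) = face e" for e
    using face_face_succ[of "face_succ arev rot e"] face_face_succ[of e] by (simp add: turn_def face_succ_def)
  show "Y = edges" if "Y \<subseteq> edges" "Y \<noteq> {}" "\<And>e. e \<in> Y \<Longrightarrow> rot e \<in> Y" "\<And>e. e \<in> Y \<Longrightarrow> turn e \<in> Y" for Y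
    using that by (rule rotation_transitive)
  show "(Rank \<circ> tail G) ` edges \<inter> (Rank \<circ> head G) ` edges = {}"
    unfolding image_comp[symmetric] image_Int[OF inj_Rank, symmetric] sides_disjoint by simp
  have "card (Rank ` X) = card X" for X :: "'a set" by (intro card_image inj_on_subset[OF inj_Rank]) simp
  then show "card ((Rank \<circ> tail G) ` edges) + card ((Rank \<circ> head G) ` edges) + card (face ` edges) = card edges + 2"
    using euler_edges by (simp only: image_comp[symmetric])
qed

lemma V_eq: "hm.V = Rank ` verts G"
  unfolding verts_eq by (simp add: image_Un image_comp)

lemma spans_tree_Rank: "spans_tree Z (Rank \<circ> tail G) (Rank \<circ> head G) hm.V \<longleftrightarrow> spans_tree Z (tail G) (head G) (verts G)"
  unfolding V_eq by (rule spans_tree_inj_image[OF inj_Rank])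

end

section \<open>The Alexander polynomial as a sum over dual spanning trees\<close>

lemma alexander_minorsE:
  assumes "m \<in> alexander_minors D k"
  obtains f g where "m = Determinant.det (Matrix.mat k k (\<lambda>(i, j). alexander_matrix D (f i) (g j)))"
    "f ` {..<k} \<subseteq> crossings D <+> crossings D" "inj_on f {..<k}" "g ` {..<k} \<subseteq> segments D" "inj_on g {..<k}"
  using assms unfolding alexander_minors_def mem_Collect_eq by (elim exE conjE) (rule that)

text \<open>
  There is one row and one column more than the minor uses, so it omits exactly one of each.
\<close>

lemma alexander_minor_cases:
  fixes M :: "'i \<Rightarrow> 's \<Rightarrow> 'r::idom"
  assumes f: "f ` {..<k} \<subseteq> I" "inj_on f {..<k}" and g: "g ` {..<k} \<subseteq> J" "inj_on g {..<k}"
    and fin: "finite I" "finite J" and card: "card I = Suc k" "card J = Suc k"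
  shows "\<exists>r\<in>I. \<exists>s\<in>J. Determinant.det (Matrix.mat k k (\<lambda>(i, j). M (f i) (g j))) =\<^sub>\<plusminus> idet (I - {r}) (J - {s}) M"
proof -
  have missing: "\<exists>x\<in>X. h ` {..<k} = X - {x}" if "h ` {..<k} \<subseteq> X" "inj_on h {..<k}" "finite X" "card X = Suc k"
    for h :: "nat \<Rightarrow> 'x" and X
  proof -
    have "card (X - h ` {..<k}) = 1"
      using that card_image[OF that(2)] by (simp add: card_Diff_subset)
    then obtain x where "X - h ` {..<k} = {x}" by (auto simp: card_1_singleton_iff)
    then have "x \<in> X \<and> h ` {..<k} = X - {x}" using that(1) by blast
    then show ?thesis by blast
  qed
  obtain r where r: "r \<in> I" "f ` {..<k} = I - {r}" using missing[OF f fin(1) card(1)] by blast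
  obtain s where s: "s \<in> J" "g ` {..<k} = J - {s}" using missing[OF g fin(2) card(2)] by blast
  have "bij_betw f {..<k} (I - {r})" "bij_betw g {..<k} (J - {s})" using f g r s by (auto simp: bij_betw_def)
  from det_enum_pm[OF this, of M] r(1) s(1) show ?thesis by blast
qed

context bipartite_plane_graph
begin

definition medial :: "('b, 'b + 'a) link_diagram" where
  "medial = medial_link G arev rot A"

lemma medial_simps:
  "crossings medial = edges" "segments medial = arcs G <+> isolated_verts G"
  "over_in medial = (\<lambda>e. Inl (Hilbert_Choice.inv rot e))"
  "over_out medial = (\<lambda>e. Inl (Hilbert_Choice.inv rot (arev e)))"
  "under_in medial = (\<lambda>e. Inl (arev e))" "under_out medial = Inl" "positive medial = (\<lambda>_. True)"
  by (simp_all add: medial_def medial_link_def edges_def)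

lemma tail_inv_rot: "e \<in> arcs G \<Longrightarrow> tail G (Hilbert_Choice.inv rot e) = tail G e"
  using tail_rot[of "Hilbert_Choice.inv rot e"] permutes_in_image[OF permutes_inv[OF rot_permutes], of e]
    permutes_inverses(1)[OF rot_permutes, of e] by simp

text \<open>
  Every segment runs along the region of one vertex, and the strands at a crossing run along the
  regions of the two ends of an edge, which lie on the same side of an empty cut. So the indicator functions of the two sides both lie in the kernel of the
  Alexander matrix, and one of them does not involve the omitted segment.
\<close>

lemma alexander_polynomial_disconnected:
  assumes "\<not> Digraph_Component.connected G"
  shows "alexander_polynomial medial = 0"
proof -
  have "\<not> connects edges (tail G) (head G) (verts G)"
    using assms connected_subgraph_of[of edges] subgraph_of_edges by simp
  moreover have "finite edges" "finite (verts G)" "verts G \<noteq> {}" "tail G ` edges \<subseteq> verts G" "head G ` edges \<subseteq> verts G"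
    using finite_edges verts_nonempty edgesD(1) by auto
  ultimately obtain X where X: "X \<subseteq> verts G" "X \<noteq> {}" "X \<noteq> verts G"
    and no: "\<And>e. e \<in> edges \<Longrightarrow> \<not> crosses (tail G) (head G) X e"
    unfolding connects_def by blast
  \<comment> \<open>the vertex whose region lies along a segment\<close>
  define loc where "loc s = case_sum (tail G) id s" for s :: "'b + 'a"
  have closed: "loc (over_in medial e) \<in> Y \<longleftrightarrow> loc (under_out medial e) \<in> Y"
      "loc (over_out medial e) \<in> Y \<longleftrightarrow> loc (under_in medial e) \<in> Y"
      "loc (over_in medial e) \<in> Y \<longleftrightarrow> loc (over_out medial e) \<in> Y"
    if e: "e \<in> edges" and Y: "Y = X \<or> Y = verts G - X" for e Y
  proof -
    have "e \<in> arcs G" using e by (rule edgesD)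
    then have t: "loc (over_in medial e) = tail G e" "loc (under_out medial e) = tail G e"
      "loc (over_out medial e) = head G e" "loc (under_in medial e) = head G e"
      by (simp_all add: loc_def medial_simps tail_inv_rot)
    have "tail G e \<in> X \<longleftrightarrow> head G e \<in> X" using no[OF e] by (simp add: crosses_def)
    then show "loc (over_in medial e) \<in> Y \<longleftrightarrow> loc (under_out medial e) \<in> Y"
      "loc (over_out medial e) \<in> Y \<longleftrightarrow> loc (under_in medial e) \<in> Y"
      "loc (over_in medial e) \<in> Y \<longleftrightarrow> loc (over_out medial e) \<in> Y"
      using Y \<open>e \<in> arcs G\<close> unfolding t by auto
  qed
  let ?k = "card (segments medial) - 1"
  have finS: "finite (segments medial)" by (simp add: medial_simps isolated_verts_def)
  have inhabited: "\<exists>s\<in>segments medial. loc s \<in> Y" if Y: "Y \<subseteq> verts G" "Y \<noteq> {}" for Y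
  proof -
    obtain v where v: "v \<in> Y" "v \<in> verts G" using Y by blast
    show ?thesis
    proof (cases "out_arcs G v = {}")
      case True
      then show ?thesis using v by (intro bexI[of _ "Inr v"]) (auto simp: loc_def medial_simps isolated_verts_def)
    next
      case False
      then obtain e where "e \<in> arcs G" "tail G e = v" by (auto simp: out_arcs_def)
      then show ?thesis using v by (intro bexI[of _ "Inl e"]) (auto simp: loc_def medial_simps)
    qed
  qed
  have "m = 0" if m: "m \<in> alexander_minors medial ?k" for m
  proof -
    obtain f g where fg: "m = Determinant.det (Matrix.mat ?k ?k (\<lambda>(i, j). alexander_matrix medial (f i) (g j)))"
      "f ` {..<?k} \<subseteq> crossings medial <+> crossings medial" "inj_on f {..<?k}"
      "g ` {..<?k} \<subseteq> segments medial" "inj_on g {..<?k}"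
      using m by (rule alexander_minorsE)
    let ?I = "f ` {..<?k}" and ?J = "g ` {..<?k}"
    have cards: "card ?I = ?k" "card ?J = ?k" using card_image[OF fg(3)] card_image[OF fg(5)] by simp_all
    have "m =\<^sub>\<plusminus> idet ?I ?J (alexander_matrix medial)"
      unfolding fg(1) using fg by (intro det_enum_pm) (auto simp: bij_betw_def)
    moreover have "idet ?I ?J (alexander_matrix medial) = 0"
    proof -
      have "card (segments medial - ?J) = card (segments medial) - ?k"
        using card_Diff_subset[of ?J "segments medial"] fg(4) cards(2) by simp
      then have "card (segments medial - ?J) \<le> 1" by linarith
      then obtain s0 where s0: "segments medial - ?J \<subseteq> {s0}"
        using finS card_le_Suc0_iff_eq[of "segments medial - ?J"] by (metis One_nat_def finite_Diff insertI1 subsetI)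
      \<comment> \<open>the side of the cut away from the omitted segment contributes a kernel vector\<close>
      define Y where "Y = (if loc s0 \<in> X then verts G - X else X)"
      have Y: "Y = X \<or> Y = verts G - X" "Y \<subseteq> verts G" "Y \<noteq> {}" "loc s0 \<notin> Y" using X by (auto simp: Y_def)
      obtain s where s: "s \<in> segments medial" "loc s \<in> Y" using inhabited[OF Y(2,3)] by blast
      have all: "s \<in> ?J" if "s \<in> segments medial" "loc s \<in> Y" for s using that s0 Y(4) by blast
      show ?thesis
      proof (rule idet_zero_if_kernel_vector[where j = s and v = "\<lambda>s. of_bool (loc s \<in> Y)"])
        fix r assume "r \<in> ?I"
        then have r: "r \<in> edges <+> edges" using fg(2) by (auto simp: medial_simps)
        have ext: "(\<Sum>s\<in>?J. alexander_matrix medial r s * of_bool (loc s \<in> Y)) =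
            (\<Sum>s\<in>segments medial. alexander_matrix medial r s * of_bool (loc s \<in> Y))"
          using finS fg(4) all by (intro sum.mono_neutral_left) auto
        have pick: "(\<Sum>s\<in>segments medial. of_bool (s = x) * p * of_bool (loc s \<in> Y)) = p * of_bool (loc x \<in> Y)"
          if "x \<in> segments medial" for x and p :: "int poly"
          using that finS by (simp add: of_bool_def if_distrib[of "\<lambda>z. z * _"] sum.delta cong: if_cong)
        have inv_arcs: "Hilbert_Choice.inv rot e \<in> arcs G \<longleftrightarrow> e \<in> arcs G" for e
          using permutes_in_image[OF permutes_inv[OF rot_permutes]] .
        show "(\<Sum>s\<in>?J. alexander_matrix medial r s * of_bool (loc s \<in> Y)) = 0"
        proof (cases r)
          case (Inl e)
          then have e: "e \<in> edges" "e \<in> arcs G" using r edgesD(1) by auto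
          have seg: "over_in medial e \<in> segments medial" "over_out medial e \<in> segments medial"
            using e(2) by (auto simp: medial_simps inv_arcs)
          have "(\<Sum>s\<in>segments medial. alexander_matrix medial r s * of_bool (loc s \<in> Y)) =
              (\<Sum>s\<in>segments medial. of_bool (s = over_in medial e) * 1 * of_bool (loc s \<in> Y)) -
              (\<Sum>s\<in>segments medial. of_bool (s = over_out medial e) * 1 * of_bool (loc s \<in> Y))"
            unfolding Inl by (simp add: left_diff_distrib sum_subtractf del: sum_mult_of_bool_eq sum_of_bool_mult_eq)
          then show ?thesis unfolding ext pick[OF seg(1)] pick[OF seg(2)] using closed[OF e(1) Y(1)] by simp
        next
          case (Inr e)
          then have e: "e \<in> edges" "e \<in> arcs G" using r edgesD(1) by auto
          have seg: "over_out medial e \<in> segments medial" "under_out medial e \<in> segments medial"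
            "under_in medial e \<in> segments medial"
            using e(2) by (auto simp: medial_simps inv_arcs)
          have "(\<Sum>s\<in>segments medial. alexander_matrix medial r s * of_bool (loc s \<in> Y)) =
              (\<Sum>s\<in>segments medial. of_bool (s = over_out medial e) * [:1, -1:] * of_bool (loc s \<in> Y)) +
              ((\<Sum>s\<in>segments medial. of_bool (s = under_out medial e) * [:0, 1:] * of_bool (loc s \<in> Y)) -
              (\<Sum>s\<in>segments medial. of_bool (s = under_in medial e) * 1 * of_bool (loc s \<in> Y)))"
            unfolding Inr sum_subtractf[symmetric] sum.distrib[symmetric]
            by (intro sum.cong refl) (simp add: medial_simps(7) left_diff_distrib distrib_right)
          also have "\<dots> = [:1, -1:] * of_bool (loc (over_out medial e) \<in> Y) +
              ([:0, 1:] * of_bool (loc (under_out medial e) \<in> Y) - 1 * of_bool (loc (under_in medial e) \<in> Y))"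
            unfolding pick[OF seg(1)] pick[OF seg(2)] pick[OF seg(3)] ..
          also have "\<dots> = 0"
            using closed[OF e(1) Y(1)] by (cases "loc (over_out medial e) \<in> Y") (simp_all add: one_pCons)
          finally show ?thesis unfolding ext .
        qed
      qed (use s all cards in auto)
    qed
    ultimately show "m = 0" by (auto simp: pm_eq_def)
  qed
  then show ?thesis unfolding alexander_polynomial_def by (intro Gcd_0_iff[THEN iffD2]) blast
qed

end

context connected_bipartite_plane_graph
begin

text \<open>
  Every segment of the medial link is the incoming or the outgoing over-segment of exactly one
  crossing.
\<close>

definition seg :: "'b + 'b \<Rightarrow> 'b + 'a" where
  "seg x = Inl (case x of Inl e \<Rightarrow> Hilbert_Choice.inv rot e | Inr e \<Rightarrow> Hilbert_Choice.inv rot (arev e))"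

lemma inv_rot_eq_iff: "Hilbert_Choice.inv rot x = y \<longleftrightarrow> x = rot y" "y = Hilbert_Choice.inv rot x \<longleftrightarrow> rot y = x"
  using permutes_inverses[OF rot_permutes] by metis+

lemma seg_eq_iff: "x \<in> edges <+> edges \<Longrightarrow> y \<in> edges <+> edges \<Longrightarrow> seg x = seg y \<longleftrightarrow> x = y"
  using arev_nonedge
  by (cases x; cases y) (auto simp: seg_def inv_rot_eq_iff permutes_inverses[OF rot_permutes] arev_eq_iff)

lemma segments_medial: "segments medial = seg ` (edges <+> edges)"
proof -
  have "Hilbert_Choice.inv rot ` arcs G = arcs G" by (rule permutes_image[OF permutes_inv[OF rot_permutes]])
  then have "arcs G = Hilbert_Choice.inv rot ` edges \<union> Hilbert_Choice.inv rot ` arev ` edges"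
    unfolding image_Un[symmetric] arcs_eq[symmetric] by simp
  moreover have "segments medial = Inl ` arcs G" by (auto simp: medial_simps isolated_empty)
  ultimately show ?thesis by (simp add: Plus_def image_Un image_image seg_def)
qed

lemma alexander_matrix_fox:
  assumes "r \<in> edges <+> edges" "c \<in> edges <+> edges"
  shows "alexander_matrix medial r (seg c) = hm.fox [:0, -1:] r c"
proof -
  note simps = seg_def medial_simps inv_rot_eq_iff permutes_inverses[OF rot_permutes]
  consider e e' where "r = Inl e" "c = Inl e'" "e \<in> edges" "e' \<in> edges"
    | e e' where "r = Inl e" "c = Inr e'" "e \<in> edges" "e' \<in> edges"
    | e e' where "r = Inr e" "c = Inl e'" "e \<in> edges" "e' \<in> edges"
    | e e' where "r = Inr e" "c = Inr e'" "e \<in> edges" "e' \<in> edges"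
    using assms by blast
  then show ?thesis
  proof cases
    case 1
    have "e' \<noteq> arev e" using arev_nonedge[OF 1(3)] 1(4) by blast
    then show ?thesis unfolding 1 by (auto simp: simps)
  next
    case 2
    have "arev e' \<noteq> e" using arev_nonedge[OF 2(4)] 2(3) by blast
    then show ?thesis unfolding 2 by (auto simp: simps arev_eq_iff)
  next
    case 3
    have "e' \<noteq> arev e" using arev_nonedge[OF 3(3)] 3(4) by blast
    moreover have "e' \<noteq> rot (arev e)" using arev_nonedge[OF 3(3)] rot_nonedges 3(4) by blast
    ultimately show ?thesis unfolding 3 by (auto simp: simps)
  next
    case 4
    have "arev e' \<noteq> rot e" using arev_nonedge[OF 4(4)] rot_edges[OF 4(3)] by metis
    moreover have "arev e' = rot (arev e) \<longleftrightarrow> turn e = e'" by (metis arev_arev turn_def)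
    ultimately show ?thesis unfolding 4
      by (auto simp: simps arev_eq_iff one_pCons)
  qed
qed

definition tree_sum :: "int poly" where
  "tree_sum = [:0, -1:] ^ (card ((Rank \<circ> head G) ` edges) - 1) *
     idet (face ` edges) (face ` edges) (hm.dual_laplacian [:0, -1:] (face (SOME e. e \<in> edges)))"

lemma alexander_minor_tree_sum:
  assumes r: "r \<in> edges <+> edges" and c: "c \<in> edges <+> edges"
  shows "idet (edges <+> edges - {r}) (segments medial - {seg c}) (alexander_matrix medial) =\<^sub>\<plusminus>
    case_sum (\<lambda>_. [:0, -1:]) (\<lambda>_. 1) r * tree_sum"
proof -
  let ?W = "edges <+> edges"
  have fin: "finite ?W" using finite_edges by simp
  have e0: "(SOME e. e \<in> edges) \<in> edges" using edges_nonempty by (simp add: some_in_eq)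
  have S: "segments medial - {seg c} = seg ` (?W - {c})"
    unfolding segments_medial using c seg_eq_iff by (auto simp del: Plus_def)
  have cards: "card (?W - {r}) = card (?W - {c})" using r c fin by simp
  have inj: "inj_on seg (?W - {c})" using seg_eq_iff by (intro inj_onI) blast
  have "idet (?W - {r}) (seg ` (?W - {c})) (alexander_matrix medial) =\<^sub>\<plusminus>
      idet (?W - {r}) (?W - {c}) (\<lambda>i j. alexander_matrix medial i (seg j))"
    using fin cards inj by (intro idet_reindex_columns) auto
  also have "\<dots> = idet (?W - {r}) (?W - {c}) (hm.fox [:0, -1:])"
    using fin cards alexander_matrix_fox by (intro idet_cong) auto
  also have "\<dots> =\<^sub>\<plusminus> case_sum (\<lambda>_. [:0, -1:]) (\<lambda>_. 1) r * tree_sum"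
    unfolding tree_sum_def by (rule hm.fox_minor[OF r c e0])
  finally show ?thesis unfolding S .
qed

text \<open>
  All the minors are multiples of \<open>tree_sum\<close>, and the minor that omits a row of type \<open>Inr\<close> is
  \<open>tree_sum\<close> up to sign.
\<close>

lemma alexander_polynomial_tree_sum: "alexander_polynomial medial =\<^sub>\<plusminus> tree_sum"
proof -
  let ?W = "edges <+> edges" and ?k = "card (segments medial) - 1"
  have fin: "finite ?W" "finite (segments medial)" using finite_edges unfolding segments_medial by simp_all
  obtain e0 where e0: "e0 \<in> edges" using edges_nonempty by blast
  have W0: "Inr e0 \<in> ?W" using e0 by (rule InrI)
  have "inj_on seg ?W" using seg_eq_iff by (intro inj_onI) blast
  then have cardS: "card (segments medial) = card ?W" unfolding segments_medial by (rule card_image)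
  have pos: "card ?W > 0" using fin(1) W0 by (auto simp: card_gt_0_iff simp del: Plus_def)
  have k: "card ?W = Suc ?k" "card (segments medial) = Suc ?k" using cardS pos by simp_all
  have dvd: "tree_sum dvd m" if m: "m \<in> alexander_minors medial ?k" for m
  proof -
    obtain f g where fg: "m = Determinant.det (Matrix.mat ?k ?k (\<lambda>(i, j). alexander_matrix medial (f i) (g j)))"
      "f ` {..<?k} \<subseteq> ?W" "inj_on f {..<?k}" "g ` {..<?k} \<subseteq> segments medial" "inj_on g {..<?k}"
      using m unfolding medial_simps(1)[symmetric] by (rule alexander_minorsE)
    from alexander_minor_cases[OF fg(2-5) fin k, of "alexander_matrix medial"] obtain r s where
      rs: "r \<in> ?W" "s \<in> segments medial" "m =\<^sub>\<plusminus> idet (?W - {r}) (segments medial - {s}) (alexander_matrix medial)"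
      unfolding fg(1) by blast
    obtain c where c: "c \<in> ?W" "s = seg c" using rs(2) unfolding segments_medial by blast
    have "m =\<^sub>\<plusminus> case_sum (\<lambda>_. [:0, -1:]) (\<lambda>_. 1) r * tree_sum"
      using rs(3) alexander_minor_tree_sum[OF rs(1) c(1)] unfolding c(2) by (rule pm_eq_trans)
    then show ?thesis by (auto simp: pm_eq_def)
  qed
  have "idet (?W - {Inr e0}) (segments medial - {seg (Inr e0)}) (alexander_matrix medial) \<in> alexander_minors medial ?k"
  proof -
    let ?I = "?W - {Inr e0}" and ?J = "segments medial - {seg (Inr e0)}"
    have s0: "seg (Inr e0) \<in> segments medial" using W0 unfolding segments_medial by blast
    have cIJ: "card ?I = ?k" "card ?J = ?k" using fin W0 s0 k by simp_all
    have "bij_betw (from_nat_into ?I) {..<?k} ?I" "bij_betw (from_nat_into ?J) {..<?k} ?J"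
      using bij_betw_from_nat_into_finite[of ?I] bij_betw_from_nat_into_finite[of ?J] fin cIJ by auto
    then have "from_nat_into ?I ` {..<?k} \<subseteq> ?W \<and> inj_on (from_nat_into ?I) {..<?k} \<and>
        from_nat_into ?J ` {..<?k} \<subseteq> segments medial \<and> inj_on (from_nat_into ?J) {..<?k}"
      unfolding bij_betw_def by blast
    then show ?thesis unfolding alexander_minors_def medial_simps(1) idet_def cIJ(1) by blast
  qed
  moreover have "idet (?W - {Inr e0}) (segments medial - {seg (Inr e0)}) (alexander_matrix medial) =\<^sub>\<plusminus> tree_sum"
    using alexander_minor_tree_sum[OF W0 W0] by simp
  ultimately have 1: "alexander_polynomial medial dvd tree_sum"
    unfolding alexander_polynomial_def using Gcd_dvd by (fastforce simp: pm_eq_def)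
  have 2: "tree_sum dvd alexander_polynomial medial"
    unfolding alexander_polynomial_def by (rule Gcd_greatest) (rule dvd)
  obtain u where u: "tree_sum = alexander_polynomial medial * u" using 1 by (rule dvdE)
  obtain w where w: "alexander_polynomial medial = tree_sum * w" using 2 by (rule dvdE)
  show ?thesis
  proof (cases "tree_sum = 0")
    case True
    then show ?thesis using w by (simp add: pm_eq_def)
  next
    case False
    then have "u * w = 1" using u w by (metis mult.assoc mult.commute mult_cancel_left1)
    then have "w dvd 1" by (metis dvd_triv_right)
    then obtain c :: int where c: "w = [:c:]" "c dvd 1" by (auto simp: is_unit_poly_iff)
    then have "c = 1 \<or> c = -1" by auto
    then show ?thesis using w c(1) by (auto simp: pm_eq_def)
  qed
qed

end

section \<open>Root polytopes of the connected spanning subgraphs\<close>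

definition rename_coords :: "real ^ 'a::finite \<Rightarrow> real ^ 'a ranked" where
  "rename_coords x = (\<chi> i. x $ unrank i)"

lemma linear_rename_coords: "linear rename_coords"
  by (rule linearI) (simp_all add: rename_coords_def Finite_Cartesian_Product.vec_eq_iff)

lemma inj_rename_coords: "inj rename_coords"
proof (rule injI)
  fix x y :: "real ^ 'a" assume "rename_coords x = rename_coords y"
  then have "rename_coords x $ Rank i = rename_coords y $ Rank i" for i by simp
  then show "x = y" by (simp add: rename_coords_def Finite_Cartesian_Product.vec_eq_iff)
qed

lemma rename_coords_axis: "rename_coords (axis v 1) = axis (Rank v) 1"
proof -
  have "unrank i = v \<longleftrightarrow> i = Rank v" for i using unrank_Rank by metis
  then show ?thesis by (simp add: rename_coords_def axis_def Finite_Cartesian_Product.vec_eq_iff)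
qed

lemma map_poly_of_int_hom:
  "map_poly real_of_int (p + q) = map_poly real_of_int p + map_poly real_of_int q"
  "map_poly real_of_int (p * q) = map_poly real_of_int p * map_poly real_of_int q"
  "map_poly real_of_int (- p) = - map_poly real_of_int p"
  by (auto intro!: poly_eqI simp: coeff_map_poly coeff_mult)

context connected_bipartite_plane_graph
begin

lemma normalized_volume_subgraph_of:
  assumes Z: "Z \<subseteq> edges" "connects Z (tail G) (head G) (verts G)" and f0: "f0 \<in> face ` edges"
  shows "normalized_volume arev A (subgraph_of Z) = real (card (hm.trees_over f0 (edges - Z)))"
proof -
  define P :: "'b \<Rightarrow> real ^ 'a" where "P e = axis (tail G e) 1 - axis (head G e) 1" for e
  define T where "T = (SOME T. undirected_spanning_tree arev T (subgraph_of Z))"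
  obtain T1 where "T1 \<subseteq> Z" "spans_tree T1 (tail G) (head G) (verts G)" using spans_tree_exists[OF Z(2)] by blast
  then have "undirected_spanning_tree arev (subgraph_of T1) (subgraph_of Z)"
    using undirected_spanning_tree_iff[OF Z(1)] by blast
  then have "undirected_spanning_tree arev T (subgraph_of Z)" unfolding T_def by (rule someI)
  then obtain T0 where T0: "T0 \<subseteq> Z" "T = subgraph_of T0" "spans_tree T0 (tail G) (head G) (verts G)"
    using undirected_spanning_tree_iff[OF Z(1)] by blast
  have TE: "T0 \<subseteq> edges" using T0(1) Z(1) by blast
  have points: "edge_points A (subgraph_of T0) = P ` T0" "edge_points A (subgraph_of Z) = P ` Z"
    using edge_points_subgraph_of[OF TE] edge_points_subgraph_of[OF Z(1)] unfolding P_def by blast+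
  have "T0 \<noteq> {}"
  proof
    assume "T0 = {}"
    then have "card (verts G) = 1" using spans_treeD(2)[OF T0(3)] by simp
    moreover obtain e where e: "e \<in> edges" using edges_nonempty by blast
    ultimately obtain v where "verts G = {v}" by (auto simp: card_1_singleton_iff)
    then have "tail G e = head G e" using edgesD(1)[OF e] by (metis singletonD tail_in_verts head_in_verts)
    then show False using edgesD(2,3)[OF e] by simp
  qed
  then have ne: "P ` T0 \<noteq> {}" by simp
  define s0 where "s0 = (SOME s. s \<in> P ` T0)"
  have s0: "s0 \<in> P ` T0" unfolding s0_def using ne by (rule some_in_eq[THEN iffD2])
  have emb: "rename_coords (P e) = hm.pt e" for e
    by (simp add: P_def hm.pt_def linear_diff[OF linear_rename_coords] rename_coords_axis)
  have "edges - (edges - Z) = Z" using Z(1) by blast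
  then have poly: "hm.polytope (edges - Z) = rename_coords ` root_polytope A (subgraph_of Z)"
    unfolding hm.polytope_def root_polytope_def points(2) convex_hull_linear_image[OF linear_rename_coords]
    by (simp add: image_image emb)
  have mem: "rename_coords s0 + (\<Sum>s\<in>P ` T0 - {s0}. c s *\<^sub>R (rename_coords s - rename_coords s0)) \<in> hm.polytope (edges - Z) \<longleftrightarrow>
      s0 + (\<Sum>s\<in>P ` T0 - {s0}. c s *\<^sub>R (s - s0)) \<in> root_polytope A (subgraph_of Z)" for c
  proof -
    have "rename_coords s0 + (\<Sum>s\<in>P ` T0 - {s0}. c s *\<^sub>R (rename_coords s - rename_coords s0)) =
        rename_coords (s0 + (\<Sum>s\<in>P ` T0 - {s0}. c s *\<^sub>R (s - s0)))"
      by (simp add: linear_add[OF linear_rename_coords] linear_sum[OF linear_rename_coords]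
          linear_scale[OF linear_rename_coords] linear_diff[OF linear_rename_coords])
    then show ?thesis unfolding poly by (simp add: inj_image_mem_iff[OF inj_rename_coords])
  qed
  have "normalized_volume arev A (subgraph_of Z) =
      fact (card (P ` T0) - 1) * measure (Pi\<^sub>M (P ` T0 - {s0}) (\<lambda>_. lborel :: real measure))
        {c \<in> space (Pi\<^sub>M (P ` T0 - {s0}) (\<lambda>_. lborel)).
          s0 + (\<Sum>s\<in>P ` T0 - {s0}. c s *\<^sub>R (s - s0)) \<in> root_polytope A (subgraph_of Z)}"
    unfolding normalized_volume_def T_def[symmetric] T0(2) points(1) volume_wrt_simplex_def
    using ne by (simp add: Let_def s0_def[symmetric])
  also have "\<dots> = card (hm.trees_over f0 (edges - Z))"
    unfolding mem[symmetric]
    by (rule hm.polytope_volume[OF _ TE emb s0 f0]) (use T0(3) spans_tree_Rank in auto)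
  finally show ?thesis .
qed

text \<open>
  The complement of a tree over \<open>S\<close> is a spanning tree contained in \<open>edges - S\<close>.
\<close>

lemma trees_over_empty:
  assumes "\<not> connects (edges - S) (tail G) (head G) (verts G)"
  shows "hm.trees_over f0 S = {}"
proof (rule ccontr)
  assume "hm.trees_over f0 S \<noteq> {}"
  then obtain T where T: "T \<in> hm.dual_trees" "S \<subseteq> T" by (auto simp: hm.trees_over_def)
  have "spans_tree (edges - T) (tail G) (head G) (verts G)"
    using hm.complement_dual_tree[OF T(1)] spans_tree_Rank by blast
  then have "connects (edges - T) (tail G) (head G) (verts G)" by (rule spans_treeD)
  moreover have "edges - T \<subseteq> edges - S" using T(2) by blast
  moreover have "tail G ` (edges - S) \<subseteq> verts G" "head G ` (edges - S) \<subseteq> verts G" using edgesD(1) by auto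
  ultimately have "connects (edges - S) (tail G) (head G) (verts G)"
    using connects_mono finite_edges by (metis finite_Diff)
  then show False using assms by blast
qed

text \<open>
  The substitution of \<open>-t\<close> for \<open>t\<close> turns the weight \<open>\<tau> = -t\<close> into \<open>t\<close>. In the expansion of the
  determinant, the set \<open>S\<close> stands for the subgraph with edge set \<open>edges - S\<close>; if this subgraph is
  not connected, there are no trees over \<open>S\<close>.
\<close>

lemma map_poly_tree_sum:
  "map_poly real_of_int (pcompose tree_sum [:0, -1:]) = monom 1 (card (head G ` edges) - 1) *
    (\<Sum>H\<in>connected_spanning_subgraphs G arev.
      Polynomial.smult (normalized_volume arev A H) ([:-1, 1:] ^ (num_edges H + 1 - card (verts G))))"
proof -
  let ?f0 = "face (SOME e. e \<in> edges)" and ?h = "\<lambda>p. map_poly real_of_int (pcompose p [:0, -1:])"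
  let ?C = "{Z. Z \<subseteq> edges \<and> connects Z (tail G) (head G) (verts G)}"
  have f0: "?f0 \<in> face ` edges" using edges_nonempty by (simp add: some_in_eq)
  have h_add: "?h (p + q) = ?h p + ?h q" for p q
    by (simp only: pcompose_add map_poly_of_int_hom)
  have h_mult: "?h (p * q) = ?h p * ?h q" for p q
    by (simp only: pcompose_mult map_poly_of_int_hom)
  have h_1: "?h 1 = 1" by (simp add: pcompose_1)
  have h_0: "?h 0 = 0" by simp
  have h_power: "?h (p ^ n) = ?h p ^ n" for p n by (induction n) (simp_all only: power_0 power_Suc h_1 h_mult)
  have h_of_nat: "?h (of_nat n) = of_nat n" for n
    by (induction n) (simp_all only: of_nat_0 of_nat_Suc h_0 h_1 h_add)
  have h_sum: "?h (sum g X) = (\<Sum>x\<in>X. ?h (g x))" for g and X :: "'b set set"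
    by (induction X rule: infinite_finite_induct) (simp_all add: pcompose_add map_poly_of_int_hom)
  have h_vals: "?h [:0, -1:] = [:0, 1:]" "?h ([:0, -1:] - 1) = [:-1, 1:]"
    by (simp_all add: pcompose_pCons one_pCons map_poly_pCons)
  have cardB: "card ((Rank \<circ> head G) ` edges) = card (head G ` edges)"
    unfolding image_comp[symmetric] by (intro card_image inj_on_subset[OF inj_Rank]) simp
  have exponent: "card (face ` edges) - 1 - card (edges - Z) = card Z + 1 - card (verts G)" if "Z \<subseteq> edges" for Z
  proof -
    have "card (verts G) + card (face ` edges) = card edges + 2"
      using euler_edges finite_edges sides_disjoint unfolding verts_eq by (subst card_Un_disjoint) auto
    moreover have "card (edges - Z) = card edges - card Z" "card Z \<le> card edges"
      using that finite_edges by (auto simp: card_Diff_subset finite_subset card_mono)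
    ultimately show ?thesis by linarith
  qed
  have "?h tree_sum = [:0, 1:] ^ (card (head G ` edges) - 1) *
      (\<Sum>S\<in>Pow edges. of_nat (card (hm.trees_over ?f0 S)) * [:-1, 1:] ^ (card (face ` edges) - 1 - card S))"
    unfolding tree_sum_def hm.idet_dual_laplacian_expansion[OF f0] cardB
    by (simp only: h_mult h_power h_sum h_of_nat h_vals)
  also have "(\<Sum>S\<in>Pow edges. of_nat (card (hm.trees_over ?f0 S)) * [:-1, 1:] ^ (card (face ` edges) - 1 - card S)) =
      (\<Sum>Z\<in>Pow edges. of_nat (card (hm.trees_over ?f0 (edges - Z))) * ([:-1, 1:] :: real poly) ^ (card Z + 1 - card (verts G)))"
  proof (rule sum.reindex_bij_witness[of _ "\<lambda>Z. edges - Z" "\<lambda>Z. edges - Z"])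
    fix S assume S: "S \<in> Pow edges"
    then have "edges - (edges - S) = S" by blast
    then show "of_nat (card (hm.trees_over ?f0 (edges - (edges - S)))) * [:-1, 1:] ^ (card (edges - S) + 1 - card (verts G)) =
        of_nat (card (hm.trees_over ?f0 S)) * ([:-1, 1:] :: real poly) ^ (card (face ` edges) - 1 - card S)"
      using exponent[of "edges - S"] by simp
  qed auto
  also have "\<dots> = (\<Sum>Z\<in>?C. of_nat (card (hm.trees_over ?f0 (edges - Z))) * [:-1, 1:] ^ (card Z + 1 - card (verts G)))"
  proof (rule sum.mono_neutral_right)
    have "hm.trees_over ?f0 (edges - Z) = {}" if "Z \<in> Pow edges - ?C" for Z
      using that trees_over_empty[of "edges - Z" ?f0] by (auto simp: double_diff)
    then show "\<forall>Z\<in>Pow edges - ?C. of_nat (card (hm.trees_over ?f0 (edges - Z))) *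
        ([:-1, 1:] :: real poly) ^ (card Z + 1 - card (verts G)) = 0"
      by simp
  qed (use finite_edges in auto)
  also have "\<dots> = (\<Sum>Z\<in>?C. Polynomial.smult (normalized_volume arev A (subgraph_of Z))
      ([:-1, 1:] ^ (num_edges (subgraph_of Z) + 1 - card (verts G))))"
    using normalized_volume_subgraph_of[OF _ _ f0] num_edges_subgraph_of
    by (intro sum.cong) (auto simp: of_nat_poly)
  also have "\<dots> = (\<Sum>H\<in>connected_spanning_subgraphs G arev.
      Polynomial.smult (normalized_volume arev A H) ([:-1, 1:] ^ (num_edges H + 1 - card (verts G))))"
  proof -
    have "connected_spanning_subgraphs G arev = subgraph_of ` ?C"
      using connected_spanning_subgraphs_subgraph_of[of edges] subgraph_of_edges by simp
    moreover have "inj_on subgraph_of ?C" using inj_subgraph_of by (rule inj_on_subset) blast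
    ultimately show ?thesis by (simp add: sum.reindex)
  qed
  finally show ?thesis by (simp add: monom_altdef)
qed

lemma alexander_polynomial_volumes:
  "map_poly real_of_int (pcompose (alexander_polynomial medial) [:0, -1:]) \<sim>\<^sub>t
    (\<Sum>H\<in>connected_spanning_subgraphs G arev.
      Polynomial.smult (normalized_volume arev A H) ([:-1, 1:] ^ (num_edges H + 1 - card (verts G))))"
proof -
  have "map_poly real_of_int (pcompose (- p) [:0, -1:]) = - map_poly real_of_int (pcompose p [:0, -1:])" for p
    by (simp only: pcompose_uminus map_poly_of_int_hom)
  then show ?thesis
    using alexander_polynomial_tree_sum map_poly_tree_sum
    unfolding unit_equiv_def pm_eq_def
    by (intro exI[of _ 0] exI[of _ "card (head G ` edges) - 1"]) (auto simp: monom_0 one_pCons[symmetric])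
qed

end

lemma (in bipartite_plane_graph) alexander_polynomial_one_vertex:
  assumes conn: "Digraph_Component.connected G" and none: "arcs G = {}"
  shows "alexander_polynomial medial = 1"
    and "(\<Sum>H\<in>connected_spanning_subgraphs G arev.
      Polynomial.smult (normalized_volume arev A H) ([:-1, 1:] ^ (num_edges H + 1 - card (verts G)))) = 1"
proof -
  have edges: "edges = {}" using none by (simp add: edges_def)
  have con: "connects {} (tail G) (head G) (verts G)"
    using conn connected_subgraph_of[of edges] subgraph_of_edges unfolding edges by simp
  have one: "card (verts G) = 1"
    using connects_card_le[OF con] verts_nonempty card_gt_0_iff[of "verts G"] by simp
  have "isolated_verts G = verts G" using none by (auto simp: isolated_verts_def out_arcs_def)
  then have "card (segments medial) = 1"
    using one none card_Plus[of "{} :: 'b set" "verts G"] by (simp add: medial_simps)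
  then have "alexander_minors medial (card (segments medial) - 1) = {1}"
    by (auto simp: alexander_minors_def)
  then show "alexander_polynomial medial = 1" by (simp add: alexander_polynomial_def)
  have sub: "connected_spanning_subgraphs G arev = {subgraph_of {}}"
  proof -
    have "{Z'. Z' \<subseteq> {} \<and> connects Z' (tail G) (head G) (verts G)} = {{}}" using con by auto
    then show ?thesis
      using connected_spanning_subgraphs_subgraph_of[of edges] subgraph_of_edges unfolding edges by simp
  qed
  let ?T = "SOME T. undirected_spanning_tree arev T (subgraph_of {})"
  have "spans_tree {} (tail G) (head G) (verts G)" using con one by (simp add: spans_tree_def)
  then have "undirected_spanning_tree arev (subgraph_of {}) (subgraph_of {})"
    using undirected_spanning_tree_iff[of "{}"] by blast
  then have "undirected_spanning_tree arev ?T (subgraph_of {})" by (rule someI)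
  then have "?T = subgraph_of {}" using undirected_spanning_tree_iff[of "{}"] by auto
  moreover have "edge_points A (subgraph_of {}) = {}" using edge_points_subgraph_of[of "{}"] by simp
  ultimately have "normalized_volume arev A (subgraph_of {}) = 1"
    by (simp add: normalized_volume_def volume_wrt_simplex_def)
  moreover have "num_edges (subgraph_of {}) = 0" using num_edges_subgraph_of[of "{}"] by simp
  ultimately show "(\<Sum>H\<in>connected_spanning_subgraphs G arev.
      Polynomial.smult (normalized_volume arev A H) ([:-1, 1:] ^ (num_edges H + 1 - card (verts G)))) = 1"
    unfolding sub using one by simp
qed

theorem corollary1p8:
  fixes G :: "('a::finite, 'b) pre_digraph"
    and arev rot :: "'b \<Rightarrow> 'b"
    and A B :: "'a set"
    and Out :: "'b set"
  assumes "plane_graph G arev rot"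
    and "bipartition G A B"
    and "alternating_dual_orientation G arev rot Out"
    and "left_right_classes G Out A B"
  shows "map_poly real_of_int (pcompose (alexander_polynomial (medial_link G arev rot A)) [:0, -1:])
    \<sim>\<^sub>t (\<Sum>H\<in>connected_spanning_subgraphs G arev.
          Polynomial.smult (normalized_volume arev A H) ([:-1, 1:] ^ (num_edges H + 1 - card (verts G))))"
proof -
  interpret bipartite_plane_graph G arev rot A B
    using assms(1,2) by (simp add: bipartite_plane_graph_def bipartite_plane_graph_axioms_def)
  consider "\<not> Digraph_Component.connected G" | "Digraph_Component.connected G" "arcs G = {}"
    | "Digraph_Component.connected G" "arcs G \<noteq> {}"
    by blast
  then show ?thesis
  proof cases
    case 1
    have "\<not> connects Z' (tail G) (head G) (verts G)" if "Z' \<subseteq> edges" for Z'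
    proof
      assume "connects Z' (tail G) (head G) (verts G)"
      moreover have "tail G ` edges \<subseteq> verts G" "head G ` edges \<subseteq> verts G" using edgesD(1) by auto
      ultimately have "connects edges (tail G) (head G) (verts G)" using connects_mono that finite_edges by metis
      then show False using 1 connected_subgraph_of[of edges] subgraph_of_edges by simp
    qed
    then have "connected_spanning_subgraphs G arev = {}"
      using connected_spanning_subgraphs_subgraph_of[of edges] subgraph_of_edges by auto
    then show ?thesis
      using alexander_polynomial_disconnected[OF 1] by (simp add: medial_def unit_equiv_def)
  next
    case 2
    then show ?thesis
      using alexander_polynomial_one_vertex by (auto simp: medial_def unit_equiv_def pcompose_1)
  next
    case 3
    then interpret connected_bipartite_plane_graph G arev rot A B by unfold_locales
    show ?thesis using alexander_polynomial_volumes by (simp only: medial_def)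
  qed
qed

end
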